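(* Let $H$ be the $8$-dimensional Kac Hopf algebra over $\mathbb{C}$, generated as an algebra by $b,c,w$ with relations $b^2=c^2=w^2=1$, $cb=bc$, $wb=cw$, $wc=bw$, with $b,c$ group-like, $\varepsilon(w)=1$ and $$\Delta(w)=\Big(\tfrac12(1+bc)\otimes1+\tfrac{1+\sqrt{-1}}4(1-bc)\otimes b+\tfrac{1-\sqrt{-1}}4(1-bc)\otimes c\Big)(w\otimes w).$$ Let $B=\mathbb{C}\{1,b,c,bc\}\subseteq H$ with inclusion $\iota$, let $\pi:H\to C:=H/B^+H=\mathbb{C}\{\overline1,\overline w\}$ be the quotient Hopf algebra map, let $\zeta:H\to B$ be the left $B$-module map with $\zeta(w)=1$ and $\zeta|_B=\mathrm{id}_B$, and let $\gamma:C\to H$ be the linear map with $\gamma(\overline1)=1$, $\gamma(\overline w)=w$. Then the left partial dual $C^*\#B$ of $H$ determined by the partially admissible mapping system $(\zeta,\gamma^* )$ for $\iota$ is a commutative semisimple quasi-Hopf algebra which is genuine.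
   Context: All spaces are over $\mathbb{C}$; $(-)^*$ denotes linear dual/transpose; $\langle-,-\rangle$ evaluation; Sweedler notation is used; $B^+=B\cap\ker\varepsilon$. Partially admissible mapping system. For a left coideal subalgebra $\iota:B\hookrightarrow H$ of a finite-dimensional Hopf algebra and the quotient right $H$-module coalgebra $\pi:H\to C=H/B^+H$ (action $\blacktriangleleft$), a partially admissible mapping system $(\zeta,\gamma^* )$ for $\iota$ consists of linear maps $\zeta:H\to B$, $\gamma:C\to H$ (with transposes $\zeta^*,\gamma^*$) such that: $\zeta,\gamma$ are convolution invertible; $\zeta(\iota(b)h)=b\,\zeta(h)$ and $\sum\gamma(x)_{(1)}\otimes\pi(\gamma(x)_{(2)})=\sum\gamma(x_{(1)})\otimes x_{(2)}$; $\zeta(1)=1$, $\varepsilon\circ\iota\circ\zeta=\varepsilon$, $\gamma(\pi(1))=1$, $\varepsilon\circ\gamma=\varepsilon_C$; and $\sum\iota(\zeta(h_{(1)}))\gamma(\pi(h_{(2)}))=h$. (The maps in the claim form such a system.) Left partial dual. Write $\sum b_{(1)}\otimes b_{(2)}\in H\otimes B$ for $b\in B$, and $\sum f_{(1)}\otimes f_{(2)}\in C^*\otimes H^*$ for $f\in C^*$, determined by $\langle f,x\blacktriangleleft h\rangle=\sum\langle f_{(1)},x\rangle\langle f_{(2)},h\rangle$. The left partial dual of $H$ determined by $(\zeta,\gamma^* )$ is the quasi-Hopf algebra $C^*\#B=C^*\otimes B$ with unit $\varepsilon\#1$, product $(f\#b)(g\#c)=\sum fg_{(1)}\#\langle g_{(2)},b_{(1)}\rangle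 b_{(2)}c$, comultiplication $\mathbf\Delta(f\#b)=\sum_{i,j}(f_{(1)}\#b_i\zeta[\gamma(f_j^* )b_{(1)}])\otimes(\gamma^*[f_{(2)}\zeta^*(b_i^* )]f_j\#b_{(2)})$, counit $f\#b\mapsto\langle f,\pi(1)\rangle\langle\varepsilon,b\rangle$, and associator with inverse $\sum_{i,j}(\varepsilon\#b_i)\otimes(\gamma^*[\zeta^*(b_i^* )_{(1)}]\#b_j)\otimes(\gamma^*[\zeta^*(b_i^* )_{(2)}\zeta^*(b_j^* )]\#1)$; here $\{b_i\},\{b_i^*\}$ are dual bases of $B,B^*$ and $\{f_j\},\{f_j^*\}$ dual bases of $C^*,C$. A finite-dimensional quasi-Hopf algebra $K$ is genuine if it is not gauge equivalent (equal up to isomorphism and twisting by a gauge transformation) to any Hopf algebra; equivalently, $\mathsf{Rep}(K)$ is not tensor equivalent to $\mathsf{Rep}(K')$ for any finite-dimensional Hopf algebra $K'$. *)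

theory Defs
  imports "HOL-Analysis.Analysis"
begin

section \<open>Coordinate tensor calculus over the complex numbers\<close>

text \<open>
  Finite-dimensional complex vector spaces are coordinate spaces \<^typ>\<open>complex ^ 'n\<close>, and
  \<^typ>\<open>complex ^ 'n\<close> \<open>\<otimes>\<close> \<^typ>\<open>complex ^ 'm\<close> is \<^typ>\<open>complex ^ ('n \<times> 'm)\<close>. Iterated tensor products
  are nested to the right. The dual of \<^typ>\<open>complex ^ 'n\<close> is again \<^typ>\<open>complex ^ 'n\<close>, through the
  bilinear (not sesquilinear) pairing \<open>pair\<close>, so that \<open>bv i\<close> is both the \<open>i\<close>-th basis
  vector and the \<open>i\<close>-th vector of the dual basis.
\<close>

abbreviation clinear_map :: "(complex ^ 'n \<Rightarrow> complex ^ 'm) \<Rightarrow> bool" where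
  "clinear_map f \<equiv> Vector_Spaces.linear (*s) (*s) f"

abbreviation clinear_form :: "(complex ^ 'n \<Rightarrow> complex) \<Rightarrow> bool" where
  "clinear_form f \<equiv> Vector_Spaces.linear (*s) (*) f"

abbreviation bv :: "'n \<Rightarrow> complex ^ 'n" where
  "bv i \<equiv> axis i 1"

definition pair :: "complex ^ 'n \<Rightarrow> complex ^ 'n \<Rightarrow> complex" where
  "pair f x = (\<Sum>i\<in>UNIV. f $ i * x $ i)"

definition transp :: "(complex ^ 'n \<Rightarrow> complex ^ 'm) \<Rightarrow> complex ^ 'm \<Rightarrow> complex ^ 'n" where
  "transp f p = (\<chi> i. pair p (f (bv i)))"

definition tensor :: "complex ^ 'n \<Rightarrow> complex ^ 'm \<Rightarrow> complex ^ ('n \<times> 'm)" (infixr "\<otimes>" 75) where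
  "x \<otimes> y = (\<chi> ij. x $ fst ij * y $ snd ij)"

text \<open>Sweedler notation: for bilinear \<open>F\<close> and \<open>t = \<Sum> t\<^sub>1 \<otimes> t\<^sub>2\<close> this is \<open>\<Sum> F t\<^sub>1 t\<^sub>2\<close>.\<close>

definition sw :: "complex ^ ('n \<times> 'm) \<Rightarrow> (complex ^ 'n \<Rightarrow> complex ^ 'm \<Rightarrow> complex ^ 'k) \<Rightarrow> complex ^ 'k"
  where "sw t F = (\<Sum>i\<in>UNIV. \<Sum>j\<in>UNIV. t $ (i, j) *s F (bv i) (bv j))"

definition tmap :: "(complex ^ 'n::finite \<Rightarrow> complex ^ 'k) \<Rightarrow> (complex ^ 'm \<Rightarrow> complex ^ 'l) \<Rightarrow>
    complex ^ ('n \<times> 'm) \<Rightarrow> complex ^ ('k \<times> 'l)" where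
  "tmap f g t = sw t (\<lambda>x y. f x \<otimes> g y)"

definition reassoc :: "complex ^ (('n::finite \<times> 'm::finite) \<times> 'k::finite) \<Rightarrow> complex ^ ('n \<times> 'm \<times> 'k)" where
  "reassoc t = (\<chi> ijk. t $ ((fst ijk, fst (snd ijk)), snd (snd ijk)))"

definition tmult :: "(complex ^ 'n \<Rightarrow> complex ^ 'n \<Rightarrow> complex ^ 'n) \<Rightarrow>
    (complex ^ 'm \<Rightarrow> complex ^ 'm \<Rightarrow> complex ^ 'm) \<Rightarrow>
    complex ^ ('n \<times> 'm) \<Rightarrow> complex ^ ('n \<times> 'm) \<Rightarrow> complex ^ ('n \<times> 'm)" where
  "tmult m m' s t = sw s (\<lambda>a b. sw t (\<lambda>c d. m a c \<otimes> m' b d))"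

definition inverse_in :: "('v \<Rightarrow> 'v \<Rightarrow> 'v) \<Rightarrow> 'v \<Rightarrow> 'v \<Rightarrow> 'v \<Rightarrow> bool" where
  "inverse_in m u x y \<longleftrightarrow> m x y = u \<and> m y x = u"

section \<open>Hopf and quasi-Hopf algebras\<close>

record ('n::finite) hopf_data =
  mult :: "complex ^ 'n \<Rightarrow> complex ^ 'n \<Rightarrow> complex ^ 'n"
  one :: "complex ^ 'n"
  comult :: "complex ^ 'n \<Rightarrow> complex ^ ('n \<times> 'n)"
  counit :: "complex ^ 'n \<Rightarrow> complex"

record ('n::finite) quasi_hopf_data = "'n hopf_data" +
  associator :: "complex ^ ('n \<times> 'n \<times> 'n)"

definition mult2 :: "('n::finite, 'z) hopf_data_scheme \<Rightarrow>
    complex ^ ('n \<times> 'n) \<Rightarrow> complex ^ ('n \<times> 'n) \<Rightarrow> complex ^ ('n \<times> 'n)" where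
  "mult2 K = tmult (mult K) (mult K)"

definition mult3 :: "('n::finite, 'z) hopf_data_scheme \<Rightarrow>
    complex ^ ('n \<times> 'n \<times> 'n) \<Rightarrow> complex ^ ('n \<times> 'n \<times> 'n) \<Rightarrow> complex ^ ('n \<times> 'n \<times> 'n)" where
  "mult3 K = tmult (mult K) (mult2 K)"

definition mult4 :: "('n::finite, 'z) hopf_data_scheme \<Rightarrow>
    complex ^ ('n \<times> 'n \<times> 'n \<times> 'n) \<Rightarrow> complex ^ ('n \<times> 'n \<times> 'n \<times> 'n) \<Rightarrow>
    complex ^ ('n \<times> 'n \<times> 'n \<times> 'n)" where
  "mult4 K = tmult (mult K) (mult3 K)"

abbreviation one2 :: "('n::finite, 'z) hopf_data_scheme \<Rightarrow> complex ^ ('n \<times> 'n)" where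
  "one2 K \<equiv> one K \<otimes> one K"

abbreviation one3 :: "('n::finite, 'z) hopf_data_scheme \<Rightarrow> complex ^ ('n \<times> 'n \<times> 'n)" where
  "one3 K \<equiv> one K \<otimes> one K \<otimes> one K"

definition unital_algebra :: "('n::finite, 'z) hopf_data_scheme \<Rightarrow> bool" where
  "unital_algebra K \<longleftrightarrow>
     (\<forall>x. clinear_map (\<lambda>y. mult K x y)) \<and> (\<forall>y. clinear_map (\<lambda>x. mult K x y)) \<and>
     (\<forall>x y z. mult K (mult K x y) z = mult K x (mult K y z)) \<and>
     (\<forall>x. mult K (one K) x = x \<and> mult K x (one K) = x)"

text \<open>The axioms common to bialgebras and quasi-bialgebras.\<close>

definition prebialgebra :: "('n::finite, 'z) hopf_data_scheme \<Rightarrow> bool" where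
  "prebialgebra K \<longleftrightarrow> unital_algebra K \<and>
     clinear_map (comult K) \<and> comult K (one K) = one2 K \<and>
     (\<forall>x y. comult K (mult K x y) = mult2 K (comult K x) (comult K y)) \<and>
     clinear_form (counit K) \<and> counit K (one K) = 1 \<and>
     (\<forall>x y. counit K (mult K x y) = counit K x * counit K y) \<and>
     (\<forall>a. sw (comult K a) (\<lambda>x y. counit K x *s y) = a \<and>
          sw (comult K a) (\<lambda>x y. counit K y *s x) = a)"

definition hopf_algebra :: "('n::finite, 'z) hopf_data_scheme \<Rightarrow> bool" where
  "hopf_algebra H \<longleftrightarrow> prebialgebra H \<and>
     (\<forall>a. tmap id (comult H) (comult H a) = reassoc (tmap (comult H) id (comult H a))) \<and>
     (\<exists>S. clinear_map S \<and>
        (\<forall>a. sw (comult H a) (\<lambda>x y. mult H (S x) y) = counit H a *s one H \<and>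
             sw (comult H a) (\<lambda>x y. mult H x (S y)) = counit H a *s one H))"

text \<open>
  Drinfeld's conventions: the associator \<open>\<phi>\<close> satisfies
  \<open>(id \<otimes> \<Delta>)\<Delta>(a) \<phi> = \<phi> (\<Delta> \<otimes> id)\<Delta>(a)\<close> and
  \<open>(id \<otimes> id \<otimes> \<Delta>)(\<phi>) (\<Delta> \<otimes> id \<otimes> id)(\<phi>) = (1 \<otimes> \<phi>) (id \<otimes> \<Delta> \<otimes> id)(\<phi>) (\<phi> \<otimes> 1)\<close>.
\<close>

definition quasi_bialgebra :: "'n::finite quasi_hopf_data \<Rightarrow> bool" where
  "quasi_bialgebra K \<longleftrightarrow> prebialgebra K \<and>
     (\<exists>\<psi>. inverse_in (mult3 K) (one3 K) (associator K) \<psi>) \<and>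
     (\<forall>a. mult3 K (tmap id (comult K) (comult K a)) (associator K) =
          mult3 K (associator K) (reassoc (tmap (comult K) id (comult K a)))) \<and>
     mult4 K (tmap id (tmap id (comult K)) (associator K))
             (reassoc (tmap (comult K) id (associator K))) =
     mult4 K (one K \<otimes> associator K)
       (mult4 K (tmap id (\<lambda>t. reassoc (tmap (comult K) id t)) (associator K))
                (tmap id (tmap id (\<lambda>z. z \<otimes> one K)) (associator K))) \<and>
     tmap id (\<lambda>t. sw t (\<lambda>y z. counit K y *s z)) (associator K) = one2 K"

definition quasi_antipode :: "'n::finite quasi_hopf_data \<Rightarrow> (complex ^ 'n \<Rightarrow> complex ^ 'n) \<Rightarrow>
    complex ^ 'n \<Rightarrow> complex ^ 'n \<Rightarrow> bool" where
  "quasi_antipode K S \<alpha> \<beta> \<longleftrightarrow>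
     clinear_map S \<and> bij S \<and> S (one K) = one K \<and>
     (\<forall>x y. S (mult K x y) = mult K (S y) (S x)) \<and>
     (\<forall>a. sw (comult K a) (\<lambda>x y. mult K (S x) (mult K \<alpha> y)) = counit K a *s \<alpha>) \<and>
     (\<forall>a. sw (comult K a) (\<lambda>x y. mult K x (mult K \<beta> (S y))) = counit K a *s \<beta>) \<and>
     sw (associator K) (\<lambda>x t. sw t (\<lambda>y z.
        mult K x (mult K \<beta> (mult K (S y) (mult K \<alpha> z))))) = one K \<and>
     (\<forall>\<psi>. inverse_in (mult3 K) (one3 K) (associator K) \<psi> \<longrightarrow>
        sw \<psi> (\<lambda>x t. sw t (\<lambda>y z.
          mult K (S x) (mult K \<alpha> (mult K y (mult K \<beta> (S z)))))) = one K)"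

definition quasi_hopf_algebra :: "'n::finite quasi_hopf_data \<Rightarrow> bool" where
  "quasi_hopf_algebra K \<longleftrightarrow> quasi_bialgebra K \<and> (\<exists>S \<alpha> \<beta>. quasi_antipode K S \<alpha> \<beta>)"

definition commutative_algebra :: "('n::finite, 'z) hopf_data_scheme \<Rightarrow> bool" where
  "commutative_algebra K \<longleftrightarrow> (\<forall>x y. mult K x y = mult K y x)"

definition left_ideal :: "('n::finite, 'z) hopf_data_scheme \<Rightarrow> (complex ^ 'n) set \<Rightarrow> bool" where
  "left_ideal K I \<longleftrightarrow> vec.subspace I \<and> (\<forall>a. \<forall>x\<in>I. mult K a x \<in> I)"

text \<open>Semisimplicity of the regular module.\<close>

definition semisimple_algebra :: "('n::finite, 'z) hopf_data_scheme \<Rightarrow> bool" where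
  "semisimple_algebra K \<longleftrightarrow>
     (\<forall>I. left_ideal K I \<longrightarrow>
        (\<exists>J. left_ideal K J \<and> I \<inter> J = {0} \<and> (\<forall>x. \<exists>y\<in>I. \<exists>z\<in>J. x = y + z)))"

definition subalgebra_generated :: "('n::finite, 'z) hopf_data_scheme \<Rightarrow>
    (complex ^ 'n) set \<Rightarrow> (complex ^ 'n) set" where
  "subalgebra_generated K X =
     \<Inter> {A. vec.subspace A \<and> one K \<in> A \<and> (\<forall>x\<in>A. \<forall>y\<in>A. mult K x y \<in> A) \<and> X \<subseteq> A}"

definition group_like :: "('n::finite, 'z) hopf_data_scheme \<Rightarrow> complex ^ 'n \<Rightarrow> bool" where
  "group_like H g \<longleftrightarrow> comult H g = g \<otimes> g \<and> counit H g = 1"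

section \<open>Gauge equivalence and genuine quasi-Hopf algebras\<close>

definition hopf_as_quasi :: "'n::finite hopf_data \<Rightarrow> 'n quasi_hopf_data" where
  "hopf_as_quasi H = \<lparr>mult = mult H, one = one H, comult = comult H, counit = counit H,
                      associator = one3 H\<rparr>"

text \<open>\<open>G\<close> is the inverse of the gauge transformation \<open>F\<close>.\<close>

definition gauge_transformation :: "'n::finite quasi_hopf_data \<Rightarrow>
    complex ^ ('n \<times> 'n) \<Rightarrow> complex ^ ('n \<times> 'n) \<Rightarrow> bool" where
  "gauge_transformation K F G \<longleftrightarrow> inverse_in (mult2 K) (one2 K) F G \<and>
     sw F (\<lambda>x y. counit K x *s y) = one K \<and> sw F (\<lambda>x y. counit K y *s x) = one K"

text \<open>
  \<open>\<Delta>\<^sub>F(a) = F \<Delta>(a) F\<inverse>\<close> and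
  \<open>\<phi>\<^sub>F = (1 \<otimes> F) (id \<otimes> \<Delta>)(F) \<phi> (\<Delta> \<otimes> id)(F\<inverse>) (F\<inverse> \<otimes> 1)\<close>.
\<close>

definition twist :: "'n::finite quasi_hopf_data \<Rightarrow>
    complex ^ ('n \<times> 'n) \<Rightarrow> complex ^ ('n \<times> 'n) \<Rightarrow> 'n quasi_hopf_data" where
  "twist K F G = K\<lparr>
     comult := \<lambda>a. mult2 K F (mult2 K (comult K a) G),
     associator :=
       mult3 K (one K \<otimes> F) (mult3 K (tmap id (comult K) F) (mult3 K (associator K)
         (mult3 K (reassoc (tmap (comult K) id G)) (reassoc (G \<otimes> one K)))))\<rparr>"

definition quasi_iso :: "'n::finite quasi_hopf_data \<Rightarrow> 'm::finite quasi_hopf_data \<Rightarrow>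
    (complex ^ 'n \<Rightarrow> complex ^ 'm) \<Rightarrow> bool" where
  "quasi_iso K L f \<longleftrightarrow> clinear_map f \<and> bij f \<and>
     f (one K) = one L \<and> (\<forall>x y. f (mult K x y) = mult L (f x) (f y)) \<and>
     (\<forall>a. comult L (f a) = tmap f f (comult K a)) \<and> (\<forall>a. counit L (f a) = counit K a) \<and>
     associator L = tmap f (tmap f f) (associator K)"

definition gauge_equivalent :: "'n::finite quasi_hopf_data \<Rightarrow> 'm::finite quasi_hopf_data \<Rightarrow> bool"
  where "gauge_equivalent K L \<longleftrightarrow>
     (\<exists>F G f. gauge_transformation K F G \<and> quasi_iso (twist K F G) L f)"

text \<open>
  HOL cannot quantify over index types inside a formula, so the type carrying the competing Hopf
  algebras is a parameter. A statement \<open>genuine TYPE('m) K\<close> with \<open>'m\<close> a free type variable ranges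
  over Hopf algebras of every finite dimension.
\<close>

definition genuine :: "'m::finite itself \<Rightarrow> 'n::finite quasi_hopf_data \<Rightarrow> bool" where
  "genuine _ K \<longleftrightarrow> quasi_hopf_algebra K \<and>
     \<not> (\<exists>H :: 'm hopf_data. hopf_algebra H \<and> gauge_equivalent K (hopf_as_quasi H))"

section \<open>Left coideal subalgebras and partially admissible mapping systems\<close>

text \<open>
  A subalgebra \<open>B\<close> is given by its inclusion \<open>\<iota>\<close>, a quotient \<open>C\<close> by its projection \<open>\<pi>\<close>. Their
  structure is transported along \<open>inv \<iota>\<close> and \<open>inv \<pi>\<close>, where \<open>inv \<pi>\<close> chooses preimages; the
  quotient operations do not depend on that choice, because the kernel \<open>B\<^sup>+H\<close> of \<open>\<pi>\<close> is a right
  ideal and a coideal.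
\<close>

definition sub_mult :: "'h::finite hopf_data \<Rightarrow> (complex ^ 'b \<Rightarrow> complex ^ 'h) \<Rightarrow>
    complex ^ 'b \<Rightarrow> complex ^ 'b \<Rightarrow> complex ^ 'b" where
  "sub_mult H \<iota> x y = inv \<iota> (mult H (\<iota> x) (\<iota> y))"

definition sub_one :: "'h::finite hopf_data \<Rightarrow> (complex ^ 'b \<Rightarrow> complex ^ 'h) \<Rightarrow> complex ^ 'b" where
  "sub_one H \<iota> = inv \<iota> (one H)"

definition sub_coact :: "'h::finite hopf_data \<Rightarrow> (complex ^ 'b \<Rightarrow> complex ^ 'h) \<Rightarrow>
    complex ^ 'b \<Rightarrow> complex ^ ('h \<times> 'b)" where
  "sub_coact H \<iota> x = inv (tmap id \<iota>) (comult H (\<iota> x))"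

definition quot_act :: "'h::finite hopf_data \<Rightarrow> (complex ^ 'h \<Rightarrow> complex ^ 'c) \<Rightarrow>
    complex ^ 'c \<Rightarrow> complex ^ 'h \<Rightarrow> complex ^ 'c" where
  "quot_act H \<pi> x h = \<pi> (mult H (inv \<pi> x) h)"

definition quot_comult :: "'h::finite hopf_data \<Rightarrow> (complex ^ 'h \<Rightarrow> complex ^ 'c) \<Rightarrow>
    complex ^ 'c \<Rightarrow> complex ^ ('c \<times> 'c)" where
  "quot_comult H \<pi> x = tmap \<pi> \<pi> (comult H (inv \<pi> x))"

definition quot_counit :: "'h::finite hopf_data \<Rightarrow> (complex ^ 'h \<Rightarrow> complex ^ 'c) \<Rightarrow>
    complex ^ 'c \<Rightarrow> complex" where
  "quot_counit H \<pi> x = counit H (inv \<pi> x)"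

definition left_coideal_subalgebra :: "'h::finite hopf_data \<Rightarrow>
    (complex ^ 'b \<Rightarrow> complex ^ 'h) \<Rightarrow> bool" where
  "left_coideal_subalgebra H \<iota> \<longleftrightarrow> clinear_map \<iota> \<and> inj \<iota> \<and> one H \<in> range \<iota> \<and>
     (\<forall>x y. mult H (\<iota> x) (\<iota> y) \<in> range \<iota>) \<and>
     (\<forall>x. comult H (\<iota> x) \<in> range (tmap (id :: complex ^ 'h \<Rightarrow> complex ^ 'h) \<iota>))"

text \<open>\<open>\<pi>\<close> realises \<open>H \<rightarrow> H / B\<^sup>+H\<close>.\<close>

definition quotient_projection :: "'h::finite hopf_data \<Rightarrow>
    (complex ^ 'b \<Rightarrow> complex ^ 'h) \<Rightarrow> (complex ^ 'h \<Rightarrow> complex ^ 'c) \<Rightarrow> bool" where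
  "quotient_projection H \<iota> \<pi> \<longleftrightarrow> clinear_map \<pi> \<and> surj \<pi> \<and>
     {h. \<pi> h = 0} = vec.span {mult H (\<iota> x) h | x h. counit H (\<iota> x) = 0}"

definition convolution_invertible :: "(complex ^ 'n \<Rightarrow> complex ^ ('n \<times> 'n)) \<Rightarrow>
    (complex ^ 'n \<Rightarrow> complex) \<Rightarrow> (complex ^ 'm \<Rightarrow> complex ^ 'm \<Rightarrow> complex ^ 'm) \<Rightarrow>
    complex ^ 'm \<Rightarrow> (complex ^ 'n \<Rightarrow> complex ^ 'm) \<Rightarrow> bool" where
  "convolution_invertible \<Delta> e m u f \<longleftrightarrow>
     (\<exists>g. clinear_map g \<and> (\<forall>x. sw (\<Delta> x) (\<lambda>y z. m (f y) (g z)) = e x *s u \<and>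
                             sw (\<Delta> x) (\<lambda>y z. m (g y) (f z)) = e x *s u))"

text \<open>The pair \<open>(\<zeta>, \<gamma>\<^sup>*)\<close> is presented by \<open>\<zeta>\<close> and \<open>\<gamma>\<close>.\<close>

definition partially_admissible :: "'h::finite hopf_data \<Rightarrow>
    (complex ^ 'b \<Rightarrow> complex ^ 'h) \<Rightarrow> (complex ^ 'h \<Rightarrow> complex ^ 'c) \<Rightarrow>
    (complex ^ 'h \<Rightarrow> complex ^ 'b) \<Rightarrow> (complex ^ 'c \<Rightarrow> complex ^ 'h) \<Rightarrow> bool" where
  "partially_admissible H \<iota> \<pi> \<zeta> \<gamma> \<longleftrightarrow>
     left_coideal_subalgebra H \<iota> \<and> quotient_projection H \<iota> \<pi> \<and>
     clinear_map \<zeta> \<and> clinear_map \<gamma> \<and>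
     convolution_invertible (comult H) (counit H) (sub_mult H \<iota>) (sub_one H \<iota>) \<zeta> \<and>
     convolution_invertible (quot_comult H \<pi>) (quot_counit H \<pi>) (mult H) (one H) \<gamma> \<and>
     (\<forall>x h. \<zeta> (mult H (\<iota> x) h) = sub_mult H \<iota> x (\<zeta> h)) \<and>
     (\<forall>x. tmap id \<pi> (comult H (\<gamma> x)) = tmap \<gamma> id (quot_comult H \<pi> x)) \<and>
     \<zeta> (one H) = sub_one H \<iota> \<and> (\<forall>h. counit H (\<iota> (\<zeta> h)) = counit H h) \<and>
     \<gamma> (\<pi> (one H)) = one H \<and> (\<forall>x. counit H (\<gamma> x) = quot_counit H \<pi> x) \<and>
     (\<forall>h. sw (comult H h) (\<lambda>x y. mult H (\<iota> (\<zeta> x)) (\<gamma> (\<pi> y))) = h)"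

section \<open>The left partial dual\<close>

definition dual_mult :: "(complex ^ 'n \<Rightarrow> complex ^ ('n \<times> 'n)) \<Rightarrow>
    complex ^ 'n \<Rightarrow> complex ^ 'n \<Rightarrow> complex ^ 'n" where
  "dual_mult \<Delta> f g = transp \<Delta> (f \<otimes> g)"

text \<open>
  The transpose of a bilinear map \<open>m\<close>: the element \<open>\<Sum> f\<^sub>1 \<otimes> f\<^sub>2\<close> determined by
  \<open>\<langle>f, m x y\<rangle> = \<Sum> \<langle>f\<^sub>1, x\<rangle> \<langle>f\<^sub>2, y\<rangle>\<close>.
\<close>

definition transp2 :: "(complex ^ 'n \<Rightarrow> complex ^ 'm \<Rightarrow> complex ^ 'k) \<Rightarrow>
    complex ^ 'k \<Rightarrow> complex ^ ('n \<times> 'm)" where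
  "transp2 m f = (\<chi> ij. pair f (m (bv (fst ij)) (bv (snd ij))))"

definition dual_unit :: "(complex ^ 'n \<Rightarrow> complex) \<Rightarrow> complex ^ 'n" where
  "dual_unit e = (\<chi> i. e (bv i))"

definition pd_mult :: "'h::finite hopf_data \<Rightarrow>
    (complex ^ 'b \<Rightarrow> complex ^ 'h) \<Rightarrow> (complex ^ 'h \<Rightarrow> complex ^ 'c) \<Rightarrow>
    complex ^ ('c \<times> 'b) \<Rightarrow> complex ^ ('c \<times> 'b) \<Rightarrow> complex ^ ('c \<times> 'b)" where
  "pd_mult H \<iota> \<pi> s t =
     sw s (\<lambda>f b. sw t (\<lambda>g c.
       sw (transp2 (quot_act H \<pi>) g) (\<lambda>g1 g2. sw (sub_coact H \<iota> b) (\<lambda>b1 b2.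
         dual_mult (quot_comult H \<pi>) f g1 \<otimes> (pair g2 b1 *s sub_mult H \<iota> b2 c)))))"

definition pd_comult :: "'h::finite hopf_data \<Rightarrow>
    (complex ^ 'b \<Rightarrow> complex ^ 'h) \<Rightarrow> (complex ^ 'h \<Rightarrow> complex ^ 'c) \<Rightarrow>
    (complex ^ 'h \<Rightarrow> complex ^ 'b) \<Rightarrow> (complex ^ 'c \<Rightarrow> complex ^ 'h) \<Rightarrow>
    complex ^ ('c \<times> 'b) \<Rightarrow> complex ^ (('c::finite \<times> 'b::finite) \<times> ('c \<times> 'b))" where
  "pd_comult H \<iota> \<pi> \<zeta> \<gamma> s =
     sw s (\<lambda>f b. sw (transp2 (quot_act H \<pi>) f) (\<lambda>f1 f2. sw (sub_coact H \<iota> b) (\<lambda>b1 b2.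
       \<Sum>i\<in>UNIV. \<Sum>j\<in>UNIV.
         (f1 \<otimes> sub_mult H \<iota> (bv i) (\<zeta> (mult H (\<gamma> (bv j)) b1))) \<otimes>
         (dual_mult (quot_comult H \<pi>)
            (transp \<gamma> (dual_mult (comult H) f2 (transp \<zeta> (bv i)))) (bv j) \<otimes> b2))))"

definition pd_one :: "'h::finite hopf_data \<Rightarrow>
    (complex ^ 'b \<Rightarrow> complex ^ 'h) \<Rightarrow> (complex ^ 'h \<Rightarrow> complex ^ 'c) \<Rightarrow> complex ^ ('c \<times> 'b)" where
  "pd_one H \<iota> \<pi> = dual_unit (quot_counit H \<pi>) \<otimes> sub_one H \<iota>"

definition pd_counit :: "'h::finite hopf_data \<Rightarrow>
    (complex ^ 'b \<Rightarrow> complex ^ 'h) \<Rightarrow> (complex ^ 'h \<Rightarrow> complex ^ 'c) \<Rightarrow>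
    complex ^ ('c \<times> 'b) \<Rightarrow> complex" where
  "pd_counit H \<iota> \<pi> s =
     (\<Sum>k\<in>UNIV. \<Sum>i\<in>UNIV. s $ (k, i) * (pair (bv k) (\<pi> (one H)) * counit H (\<iota> (bv i))))"

definition pd_associator_inv :: "'h::finite hopf_data \<Rightarrow>
    (complex ^ 'b \<Rightarrow> complex ^ 'h) \<Rightarrow> (complex ^ 'h \<Rightarrow> complex ^ 'c) \<Rightarrow>
    (complex ^ 'h \<Rightarrow> complex ^ 'b) \<Rightarrow> (complex ^ 'c \<Rightarrow> complex ^ 'h) \<Rightarrow>
    complex ^ (('c::finite \<times> 'b::finite) \<times> ('c \<times> 'b) \<times> ('c \<times> 'b))" where
  "pd_associator_inv H \<iota> \<pi> \<zeta> \<gamma> =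
     (\<Sum>i\<in>UNIV. \<Sum>j\<in>UNIV. sw (transp2 (mult H) (transp \<zeta> (bv i))) (\<lambda>p q.
        (dual_unit (quot_counit H \<pi>) \<otimes> bv i) \<otimes>
        (transp \<gamma> p \<otimes> bv j) \<otimes>
        (transp \<gamma> (dual_mult (comult H) q (transp \<zeta> (bv j))) \<otimes> sub_one H \<iota>)))"

definition left_partial_dual :: "'h::finite hopf_data \<Rightarrow>
    (complex ^ 'b::finite \<Rightarrow> complex ^ 'h) \<Rightarrow> (complex ^ 'h \<Rightarrow> complex ^ 'c::finite) \<Rightarrow>
    (complex ^ 'h \<Rightarrow> complex ^ 'b) \<Rightarrow> (complex ^ 'c \<Rightarrow> complex ^ 'h) \<Rightarrow>
    ('c \<times> 'b) quasi_hopf_data" where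
  "left_partial_dual H \<iota> \<pi> \<zeta> \<gamma> =
     (let A = \<lparr>mult = pd_mult H \<iota> \<pi>, one = pd_one H \<iota> \<pi>,
               comult = pd_comult H \<iota> \<pi> \<zeta> \<gamma>, counit = pd_counit H \<iota> \<pi>\<rparr> :: ('c \<times> 'b) hopf_data
      in \<lparr>mult = mult A, one = one A, comult = comult A, counit = counit A,
          associator =
            (THE x. inverse_in (mult3 A) (one3 A) (pd_associator_inv H \<iota> \<pi> \<zeta> \<gamma>) x)\<rparr>)"

section \<open>The eight-dimensional Kac algebra\<close>

text \<open>
  The eight-dimensional algebra generated by \<open>b, c, w\<close> subject to the relations: the words
  \<open>b\<^sup>i c\<^sup>j w\<^sup>k\<close> with exponents in \<open>{0, 1}\<close> span any algebra generated by elements satisfying the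
  relations, so dimension eight leaves no room for further relations.
\<close>

definition kac_algebra :: "'h::finite hopf_data \<Rightarrow>
    complex ^ 'h \<Rightarrow> complex ^ 'h \<Rightarrow> complex ^ 'h \<Rightarrow> bool" where
  "kac_algebra H b c w \<longleftrightarrow> hopf_algebra H \<and> CARD('h) = 8 \<and>
     subalgebra_generated H {b, c, w} = UNIV \<and>
     mult H b b = one H \<and> mult H c c = one H \<and> mult H w w = one H \<and>
     mult H c b = mult H b c \<and> mult H w b = mult H c w \<and> mult H w c = mult H b w \<and>
     group_like H b \<and> group_like H c \<and> counit H w = 1 \<and>
     comult H w = mult2 H
       ((1 / 2) *s (one H + mult H b c) \<otimes> one H
         + ((1 + \<i>) / 4) *s (one H - mult H b c) \<otimes> b
         + ((1 - \<i>) / 4) *s (one H - mult H b c) \<otimes> c)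
       (w \<otimes> w)"

end

theory Submission
  imports Defs
begin

text \<open>
  Let \<open>e\<^sub>p\<close> be the primitive idempotents of \<open>B = \<complex>\<langle>b, c\<rangle>\<close>, indexed by the characters \<open>p\<close> of the Klein
  four-group \<open>\<langle>b, c\<rangle>\<close>. The elements \<open>e\<^sub>p w\<^sup>x\<close> with \<open>x \<in> {0, 1}\<close> span the Kac algebra, because their span is
  closed under multiplication and contains the generators, and so they are a basis by the dimension
  count. In this basis the structure is nearly diagonal: \<open>w e\<^sub>p = e\<^sub>p\<^sub>' w\<close> with \<open>p'\<close> the character
  \<open>p\<close> with its values on \<open>b\<close> and \<open>c\<close> exchanged, and \<open>\<Delta>(w) = \<Sum> J(p, q) e\<^sub>p w \<otimes> e\<^sub>q w\<close> for a function \<open>J\<close> with values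
  \<open>1, -1, \<i>, -\<i>\<close>.

  The quotient \<open>C\<close> is the group algebra of the group \<open>{\<pi>(1), \<pi>(w)}\<close> of order two. If \<open>\<delta>\<^sub>x\<close> is the basis of
  \<open>C\<^sup>*\<close> dual to \<open>\<pi>(w\<^sup>x)\<close>, then the elements \<open>E(p, x) = \<delta>\<^sub>x # e\<^sub>p\<close> of the partial dual \<open>K = C\<^sup>* # B\<close> are eight
  orthogonal idempotents with sum \<open>1\<close> (\<open>pd_mult_E\<close>, \<open>pd_one_E\<close>). Their comultiplication is
  \<open>\<Delta>(E g) = \<Sum> E h \<otimes> E k\<close>, summed over all \<open>h k = g\<close> in the dihedral group of order eight, the semidirect product
  of the character group with the group of order two (\<open>pd_comult_E\<close>), and the associator is diagonal with entries
  \<open>\<omega>(g, h, k)\<close>, where \<open>\<omega>((p, x), (q, y), (r, z))\<close> is \<open>1 / J(p, q)\<close> for \<open>z = 1\<close> and \<open>1\<close> for \<open>z = 0\<close>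
  (\<open>pd_associator_inv_E\<close>). So \<open>K\<close> is the algebra of functions on the dihedral group, with associator a
  3-cocycle \<open>\<omega>\<close>. For every finite group with a normalised 3-cocycle this is a commutative semisimple quasi-Hopf
  algebra: in the coordinates given by group elements the axioms become the group axioms and the cocycle
  identity.

  It is genuine because the class of \<open>\<omega>\<close> is not trivial. In a commutative algebra a gauge transformation \<open>F\<close>
  leaves the comultiplication alone and multiplies the associator by the coboundary of \<open>F\<close>, so a gauge
  equivalence to a Hopf algebra would make \<open>\<omega>\<close> a coboundary. For an element \<open>g\<close> with \<open>g\<^sup>n = 1\<close> the product of the
  values \<open>\<omega>(g, g\<^sup>k, g)\<close> for \<open>k < n\<close> telescopes to \<open>1\<close> if \<open>\<omega>\<close> is a coboundary (\<open>trivial_periods\<close>), whereas for a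
  rotation of order four it is \<open>-1\<close> (\<open>d4_period\<close>).
\<close>

section \<open>Multilinear algebra in coordinates\<close>

definition cbilinear :: "(complex ^ 'n \<Rightarrow> complex ^ 'm \<Rightarrow> complex ^ 'k) \<Rightarrow> bool" where
  "cbilinear F \<longleftrightarrow> (\<forall>x. clinear_map (F x)) \<and> (\<forall>y. clinear_map (\<lambda>x. F x y))"

lemma clinear_map_iff:
  "clinear_map f \<longleftrightarrow> (\<forall>x y. f (x + y) = f x + f y) \<and> (\<forall>a x. f (a *s x) = a *s f x)"
  unfolding Vector_Spaces.linear_iff by (auto intro: vec.vector_space_axioms)

lemma clinear_form_iff:
  "clinear_form f \<longleftrightarrow> (\<forall>x y. f (x + y) = f x + f y) \<and> (\<forall>a x. f (a *s x) = a * f x)"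
  unfolding Vector_Spaces.linear_iff
  by (auto intro: vec.vector_space_axioms vector_space_over_itself.vector_space_axioms)

lemma clinear_mapI:
  "(\<And>x y. f (x + y) = f x + f y) \<Longrightarrow> (\<And>a x. f (a *s x) = a *s f x) \<Longrightarrow> clinear_map f"
  by (simp add: clinear_map_iff)

lemma clinear_formI:
  "(\<And>x y. f (x + y) = f x + f y) \<Longrightarrow> (\<And>a x. f (a *s x) = a * f x) \<Longrightarrow> clinear_form f"
  by (simp add: clinear_form_iff)

lemma clinear_map_add: "clinear_map f \<Longrightarrow> f (x + y) = f x + f y"
  and clinear_map_scale: "clinear_map f \<Longrightarrow> f (a *s x) = a *s f x"
  by (simp_all add: clinear_map_iff)

lemma clinear_map_zero: "clinear_map f \<Longrightarrow> f 0 = 0"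
  using clinear_map_scale[of f 0 0] by simp

lemma clinear_map_diff: "clinear_map f \<Longrightarrow> f (x - y) = f x - f y"
  by (metis clinear_map_add add_diff_cancel diff_add_cancel)

lemma clinear_map_sum: "clinear_map f \<Longrightarrow> f (\<Sum>i\<in>A. F i) = (\<Sum>i\<in>A. f (F i))"
  by (induction A rule: infinite_finite_induct) (simp_all add: clinear_map_zero clinear_map_add)

lemma clinear_form_add: "clinear_form f \<Longrightarrow> f (x + y) = f x + f y"
  and clinear_form_scale: "clinear_form f \<Longrightarrow> f (a *s x) = a * f x"
  by (simp_all add: clinear_form_iff)

lemma clinear_form_sum: "clinear_form f \<Longrightarrow> f (\<Sum>i\<in>A. F i) = (\<Sum>i\<in>A. f (F i))"
proof (induction A rule: infinite_finite_induct)
  case empty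
  then show ?case using clinear_form_scale[of f 0 0] by simp
qed (use clinear_form_scale[of f 0 0] in \<open>simp_all add: clinear_form_add\<close>)

lemma cbilinearD:
  assumes "cbilinear F"
  shows "F (x + x') y = F x y + F x' y" "F x (y + y') = F x y + F x y'"
    "F (a *s x) y = a *s F x y" "F x (a *s y) = a *s F x y" "F 0 y = 0" "F x 0 = 0"
    "F (x - x') y = F x y - F x' y" "F x (y - y') = F x y - F x y'"
  using assms clinear_map_add[of "F x"] clinear_map_add[of "\<lambda>x. F x y"]
    clinear_map_scale[of "F x"] clinear_map_scale[of "\<lambda>x. F x y"]
    clinear_map_zero[of "F x"] clinear_map_zero[of "\<lambda>x. F x y"]
    clinear_map_diff[of "F x"] clinear_map_diff[of "\<lambda>x. F x y"]
  by (auto simp: cbilinear_def)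

lemma cbilinear_sum:
  assumes "cbilinear F"
  shows "F (\<Sum>i\<in>A. f i) y = (\<Sum>i\<in>A. F (f i) y)" "F x (\<Sum>i\<in>A. g i) = (\<Sum>i\<in>A. F x (g i))"
  using assms clinear_map_sum[of "F x"] clinear_map_sum[of "\<lambda>x. F x y"] by (auto simp: cbilinear_def)

lemma sum_scale: "(\<Sum>i\<in>A. f i) *s (x :: complex ^ 'n) = (\<Sum>i\<in>A. f i *s x)"
  by (rule vec.scale_sum_left)

lemma scale_sum: "a *s (\<Sum>i\<in>A. f i :: complex ^ 'n) = (\<Sum>i\<in>A. a *s f i)"
  by (rule vec.scale_sum_right)

lemma sum_UNIV_prod:
  "(\<Sum>p\<in>UNIV. f p) = (\<Sum>i\<in>UNIV. \<Sum>j\<in>UNIV. f (i, j))"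
  by (simp add: sum.cartesian_product)

lemma pair_linear:
  "pair f (x + y) = pair f x + pair f y" "pair f (a *s x) = a * pair f x"
  "pair (f + g) x = pair f x + pair g x" "pair (a *s f) x = a * pair f x"
  by (simp_all add: pair_def algebra_simps sum.distrib sum_distrib_left)

lemma pair_sum:
  "pair f (\<Sum>i\<in>A. g i) = (\<Sum>i\<in>A. pair f (g i))" "pair (\<Sum>i\<in>A. h i) x = (\<Sum>i\<in>A. pair (h i) x)"
proof -
  have z: "pair f 0 = 0" "pair 0 x = 0" by (simp_all add: pair_def)
  show "pair f (\<Sum>i\<in>A. g i) = (\<Sum>i\<in>A. pair f (g i))"
    by (induction A rule: infinite_finite_induct) (simp_all add: z pair_linear)
  show "pair (\<Sum>i\<in>A. h i) x = (\<Sum>i\<in>A. pair (h i) x)"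
    by (induction A rule: infinite_finite_induct) (simp_all add: z pair_linear)
qed

lemma pair_bv [simp]: "pair (bv i) x = x $ i" "pair f (bv i) = f $ i"
  by (simp_all add: pair_def axis_def if_distrib if_distribR cong: if_cong)

lemma bv_expansion: "(x :: complex ^ 'n) = (\<Sum>i\<in>UNIV. x $ i *s bv i)"
  by (simp add: vec_eq_iff axis_def if_distrib cong: if_cong)

lemma pair_transp: "clinear_map f \<Longrightarrow> pair (transp f p) x = pair p (f x)"
  by (subst (2) bv_expansion[of x])
     (simp add: clinear_map_sum clinear_map_scale pair_sum pair_linear, simp add: pair_def transp_def mult.commute)

lemma tensor_nth [simp]: "(x \<otimes> y) $ (i, j) = x $ i * y $ j"
  by (simp add: tensor_def)

lemma bv_tensor: "bv i \<otimes> bv j = bv (i, j)"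
  by (auto simp: vec_eq_iff axis_def)

lemma pair_tensor: "pair (f \<otimes> g) (x \<otimes> y) = pair f x * pair g y"
  by (simp add: pair_def sum_UNIV_prod sum_product mult_ac)

lemma tensor_sum:
  "(\<Sum>i\<in>A. f i) \<otimes> y = (\<Sum>i\<in>A. f i \<otimes> y)" "x \<otimes> (\<Sum>i\<in>A. g i) = (\<Sum>i\<in>A. x \<otimes> g i)"
  by (simp_all add: vec_eq_iff sum_distrib_left sum_distrib_right)

lemma tensor_linear:
  "(x + x') \<otimes> y = x \<otimes> y + x' \<otimes> y" "x \<otimes> (y + y') = x \<otimes> y + x \<otimes> y'"
  "(a *s x) \<otimes> y = a *s (x \<otimes> y)" "x \<otimes> (a *s y) = a *s (x \<otimes> y)"
  "0 \<otimes> y = 0" "x \<otimes> 0 = 0"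
  by (simp_all add: vec_eq_iff algebra_simps)

lemma sw_linear: "sw (s + t) F = sw s F + sw t F" "sw (a *s t) F = a *s sw t F"
  by (simp_all add: sw_def vec.scale_left_distrib sum.distrib scale_sum vec.scale_scale)

text \<open>
  Almost every calculation below evaluates \<open>sw\<close> on a multilinear expression. The rules \<open>clin\<close> prove such an
  expression linear in one of its variables by following its syntax.
\<close>

named_theorems clin

lemma clin_basic [clin]:
  "clinear_map (\<lambda>x. x)" "clinear_map id" "clinear_map (\<lambda>x. 0)"
  "clinear_map f \<Longrightarrow> clinear_map g \<Longrightarrow> clinear_map (\<lambda>x. f x + g x)"
  "clinear_map f \<Longrightarrow> clinear_map (\<lambda>x. a *s f x)"
  "clinear_map f \<Longrightarrow> clinear_map (\<lambda>x. f x \<otimes> y)"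
  "clinear_map g \<Longrightarrow> clinear_map (\<lambda>x. z \<otimes> g x)"
  "clinear_map g \<Longrightarrow> clinear_map (\<lambda>x. pair p (g x) *s v)"
  "clinear_map g \<Longrightarrow> clinear_map (\<lambda>x. pair (g x) p *s v)"
  by (rule clinear_mapI;
      simp add: clinear_map_add clinear_map_scale vec.scale_right_distrib vec.scale_left_distrib
        mult.commute tensor_linear pair_linear)+

lemma clin_sum [clin]:
  "(\<And>i. clinear_map (F i)) \<Longrightarrow> clinear_map (\<lambda>x. \<Sum>i\<in>A. F i x)"
  by (rule clinear_mapI) (simp_all add: clinear_map_add clinear_map_scale sum.distrib scale_sum)

lemma clin_sw_tensor [clin]:
  "clinear_map f \<Longrightarrow> clinear_map (\<lambda>x. sw (f x) F)"
  by (rule clinear_mapI) (simp_all add: clinear_map_add clinear_map_scale sw_linear)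

lemma clin_sw_fun [clin]:
  "(\<And>y z. clinear_map (\<lambda>x. F x y z)) \<Longrightarrow> clinear_map (\<lambda>x. sw t (F x))"
  unfolding sw_def by (intro clin)

lemma clin_compose: "clinear_map g \<Longrightarrow> clinear_map f \<Longrightarrow> clinear_map (\<lambda>x. g (f x))"
  by (simp add: clinear_map_iff)

lemma clin_bilinear:
  "cbilinear m \<Longrightarrow> clinear_map f \<Longrightarrow> clinear_map (\<lambda>x. m (f x) y)"
  "cbilinear m \<Longrightarrow> clinear_map f \<Longrightarrow> clinear_map (\<lambda>x. m y (f x))"
  unfolding cbilinear_def clinear_map_iff by auto

lemma clin_form_scale [clin]:
  "clinear_form e \<Longrightarrow> clinear_map f \<Longrightarrow> clinear_map (\<lambda>x. e (f x) *s y)"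
  by (rule clinear_mapI)
    (simp_all add: clinear_map_add clinear_map_scale clinear_form_add clinear_form_scale vec.scale_left_distrib)

lemma clin_transp [clin]: "clinear_map f \<Longrightarrow> clinear_map (\<lambda>x. transp g (f x))"
  by (rule clinear_mapI) (simp_all add: transp_def clinear_map_add clinear_map_scale pair_linear vec_eq_iff)

lemma clin_transp2 [clin]: "clinear_map f \<Longrightarrow> clinear_map (\<lambda>x. transp2 m (f x))"
  by (rule clinear_mapI) (simp_all add: transp2_def clinear_map_add clinear_map_scale pair_linear vec_eq_iff)

lemma clin_dual_mult [clin]:
  "clinear_map f \<Longrightarrow> clinear_map (\<lambda>x. dual_mult \<Delta> (f x) y)"
  "clinear_map f \<Longrightarrow> clinear_map (\<lambda>x. dual_mult \<Delta> y (f x))"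
  unfolding dual_mult_def by (intro clin; assumption)+

lemma clin_tmap [clin]: "clinear_map f \<Longrightarrow> clinear_map (\<lambda>x. tmap g h (f x))"
  unfolding tmap_def by (intro clin)

lemma clin_tmap' [clin]: "clinear_map (tmap g h)"
  by (rule clin_tmap) (rule clin)

lemma clin_reassoc [clin]: "clinear_map f \<Longrightarrow> clinear_map (\<lambda>x. reassoc (f x))"
  by (rule clinear_mapI) (simp_all add: clinear_map_add clinear_map_scale reassoc_def vec_eq_iff)

lemma clin_tmult [clin]:
  "clinear_map f \<Longrightarrow> clinear_map (\<lambda>x. tmult m n (f x) t)"
  "clinear_map f \<Longrightarrow> clinear_map (\<lambda>x. tmult m n s (f x))"
  unfolding tmult_def by (intro clin; assumption)+

lemma cbilinearI:
  "(\<And>x. clinear_map (\<lambda>y. F x y)) \<Longrightarrow> (\<And>y. clinear_map (\<lambda>x. F x y)) \<Longrightarrow> cbilinear F"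
  by (simp add: cbilinear_def)

text \<open>
  The constant \<open>sw\<close> is defined by coordinates; bilinearity makes it independent of the presentation of the
  tensor, which is what Sweedler notation presupposes.
\<close>

lemma sw_tensor:
  assumes "cbilinear F"
  shows "sw (x \<otimes> y) F = F x y"
proof -
  have "F x y = F (\<Sum>i\<in>UNIV. x $ i *s bv i) (\<Sum>j\<in>UNIV. y $ j *s bv j)"
    by (rule arg_cong2[OF bv_expansion bv_expansion])
  then show ?thesis
    by (simp add: sw_def cbilinear_sum[OF assms] cbilinearD[OF assms] scale_sum vec.scale_scale)
      (subst sum.swap, simp add: mult.commute)
qed

lemma sw_bv: "sw (bv (i, j)) F = F (bv i) (bv j)"
proof -
  have "bv (i, j) $ (k, l) *s F (bv k) (bv l) =
      (if l = j then if k = i then F (bv i) (bv j) else 0 else 0)" for k l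
    by (auto simp: axis_def)
  then show ?thesis by (simp add: sw_def)
qed

lemma sw_sum: "sw (\<Sum>i\<in>A. t i) F = (\<Sum>i\<in>A. sw (t i) F)"
  by (rule clinear_map_sum) (intro clin)

lemma tensor_expansion: "t = (\<Sum>i\<in>UNIV. \<Sum>j\<in>UNIV. t $ (i, j) *s (bv i \<otimes> bv j))"
  by (rule trans[OF bv_expansion]) (simp add: bv_tensor sum_UNIV_prod)

lemma tensor_ext:
  assumes "clinear_map f" "clinear_map g" "\<And>x y. f (x \<otimes> y) = g (x \<otimes> y)"
  shows "f t = g t"
  by (subst (1 2) tensor_expansion[of t])
    (simp add: assms clinear_map_sum clinear_map_scale)

lemma tensor3_ext:
  assumes "clinear_map f" "clinear_map g" "\<And>x y z. f ((x \<otimes> y) \<otimes> z) = g ((x \<otimes> y) \<otimes> z)"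
  shows "f t = g t"
proof (rule tensor_ext[OF assms(1,2)])
  fix s :: "complex ^ ('a \<times> 'b)" and z :: "complex ^ 'c"
  show "f (s \<otimes> z) = g (s \<otimes> z)"
    by (rule tensor_ext[of "\<lambda>s. f (s \<otimes> z)" "\<lambda>s. g (s \<otimes> z)"])
      (intro clin_compose[OF assms(1)] clin_compose[OF assms(2)] clin | rule assms(3))+
qed

lemma sw_tmap: "cbilinear F \<Longrightarrow> sw (tmap f g t) F = sw t (\<lambda>x y. F (f x) (g y))"
  unfolding tmap_def sw_def[of t]
  by (simp add: sw_sum sw_linear sw_tensor)

lemma clinear_sw: "clinear_map h \<Longrightarrow> h (sw t F) = sw t (\<lambda>x y. h (F x y))"
  by (simp add: sw_def clinear_map_sum clinear_map_scale)

lemma tmap_tensor: "clinear_map f \<Longrightarrow> clinear_map g \<Longrightarrow> tmap f g (x \<otimes> y) = f x \<otimes> g y"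
  unfolding tmap_def by (intro sw_tensor cbilinearI clin)

lemma tmap_tmap:
  "clinear_map f \<Longrightarrow> clinear_map g \<Longrightarrow>
    tmap f g (tmap f' g' t) = tmap (\<lambda>x. f (f' x)) (\<lambda>x. g (g' x)) t"
  unfolding tmap_def[of f g] by (subst sw_tmap) (intro cbilinearI clin | simp add: tmap_def)+

lemma tmap_id: "tmap (\<lambda>x. x) (\<lambda>x. x) t = t" "tmap id id t = t"
  using tensor_expansion[of t, symmetric] by (simp_all add: tmap_def sw_def)

lemma reassoc_tensor: "reassoc ((x \<otimes> y) \<otimes> z) = x \<otimes> y \<otimes> z"
  by (simp add: reassoc_def vec_eq_iff tensor_def)

lemma reassoc_tmap:
  assumes "clinear_map f" "clinear_map g" "clinear_map h"
  shows "reassoc (tmap (tmap f g) h t) = tmap f (tmap g h) (reassoc t)"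
  by (rule tensor3_ext[of "\<lambda>t. reassoc (tmap (tmap f g) h t)" "\<lambda>t. tmap f (tmap g h) (reassoc t)"])
    (intro clin | simp add: tmap_tensor reassoc_tensor assms clin)+

lemma tmult_tensor:
  assumes "cbilinear m" "cbilinear n"
  shows "tmult m n (x \<otimes> y) (x' \<otimes> y') = m x x' \<otimes> n y y'"
proof -
  note [clin] = clin_bilinear[OF assms(1)] clin_bilinear[OF assms(2)]
  have "sw (x' \<otimes> y') (\<lambda>c d. m a c \<otimes> n b d) = m a x' \<otimes> n b y'" for a b
    by (intro sw_tensor cbilinearI clin)
  then show ?thesis
    unfolding tmult_def by (simp, intro sw_tensor cbilinearI clin)
qed

lemma cbilinear_tmult: "cbilinear (tmult m n)"
  by (intro cbilinearI clin)

lemma tmap_tmult: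
  assumes "clinear_map f" "clinear_map g" "cbilinear m'" "cbilinear n'"
    "\<And>x y. f (m x y) = m' (f x) (f y)" "\<And>x y. g (n x y) = n' (g x) (g y)"
  shows "tmap f g (tmult m n s t) = tmult m' n' (tmap f g s) (tmap f g t)"
proof -
  note [clin] = clin_bilinear[OF assms(3)] clin_bilinear[OF assms(4)]
  have "tmult m' n' (tmap f g s) (tmap f g t) =
      sw s (\<lambda>a b. sw (tmap f g t) (\<lambda>c d. m' (f a) c \<otimes> n' (g b) d))"
    unfolding tmult_def by (subst sw_tmap) (intro cbilinearI clin assms | simp)+
  also have "\<dots> = sw s (\<lambda>a b. sw t (\<lambda>c d. m' (f a) (f c) \<otimes> n' (g b) (g d)))"
    by (subst sw_tmap) (intro cbilinearI clin assms | simp)+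
  also have "\<dots> = tmap f g (tmult m n s t)"
    unfolding tmult_def
    by (simp add: clinear_sw[of "tmap f g"] clin tmap_tensor assms)
  finally show ?thesis ..
qed

lemma sw_nth: "sw t F $ k = (\<Sum>i\<in>UNIV. \<Sum>j\<in>UNIV. t $ (i, j) * F (bv i) (bv j) $ k)"
  by (simp add: sw_def)

lemma bv_nth: "bv i $ j = of_bool (i = j)"
  by (simp add: axis_def)

lemma sum_single: "(\<And>i. i \<noteq> a \<Longrightarrow> f i = 0) \<Longrightarrow> (\<Sum>i\<in>UNIV. f i) = f (a :: 'i::finite)"
  by (rule sum.remove[THEN trans, of _ a]) simp_all

lemma sum2_single:
  "(\<And>i j. i \<noteq> a \<or> j \<noteq> b \<Longrightarrow> f i j = 0) \<Longrightarrow> (\<Sum>i\<in>UNIV. \<Sum>j\<in>UNIV. f i j) = f (a :: 'i::finite) (b :: 'j::finite)"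
  using sum_single[of "(a, b)" "\<lambda>p. f (fst p) (snd p)"] by (auto simp: sum_UNIV_prod)

lemma tmap_expand: "tmap f g t = (\<Sum>i\<in>UNIV. \<Sum>j\<in>UNIV. t $ (i, j) *s (f (bv i) \<otimes> g (bv j)))"
  by (simp add: tmap_def sw_def)

lemma of_bool_scale: "of_bool P *s x = (if P then x else (0 :: complex ^ 'n))"
  by simp

section \<open>Dual bases\<close>

definition dual_bases :: "('i::finite \<Rightarrow> complex ^ 'n) \<Rightarrow> ('i \<Rightarrow> complex ^ 'n) \<Rightarrow> bool" where
  "dual_bases u d \<longleftrightarrow> (\<forall>i j. pair (d i) (u j) = of_bool (i = j)) \<and>
     (\<forall>x. x = (\<Sum>i\<in>UNIV. pair (d i) x *s u i))"

lemma dual_bases_pair: "dual_bases u d \<Longrightarrow> pair (d i) (u j) = of_bool (i = j)"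
  and dual_bases_expansion: "dual_bases u d \<Longrightarrow> x = (\<Sum>i\<in>UNIV. pair (d i) x *s u i)"
  unfolding dual_bases_def by (erule conjE, erule allE, erule allE, assumption)
    (erule conjE, erule allE, assumption)

lemma dual_bases_dual_expansion:
  assumes "dual_bases u d"
  shows "f = (\<Sum>i\<in>UNIV. pair f (u i) *s d i)"
proof -
  have "f $ j = (\<Sum>i\<in>UNIV. pair f (u i) *s d i) $ j" for j
  proof -
    have "f $ j = pair f (bv j)" by simp
    also have "\<dots> = pair f (\<Sum>i\<in>UNIV. pair (d i) (bv j) *s u i)"
      by (simp only: dual_bases_expansion[OF assms, symmetric])
    finally show ?thesis
      unfolding pair_sum pair_linear by (simp add: mult.commute)
  qed
  then show ?thesis by (simp add: vec_eq_iff)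
qed

lemma dual_bases_dual_ext:
  assumes "dual_bases u d" "\<And>i. pair f (u i) = pair g (u i)"
  shows "f = g"
  using dual_bases_dual_expansion[OF assms(1), of f] dual_bases_dual_expansion[OF assms(1), of g]
  unfolding assms(2) by (rule trans[OF _ sym])

lemma dual_bases_ext:
  assumes "dual_bases u d" "clinear_map f" "clinear_map g" "\<And>i. f (u i) = g (u i)"
  shows "f x = g x"
  by (subst (1 2) dual_bases_expansion[OF assms(1), of x])
    (simp add: assms clinear_map_sum clinear_map_scale)

text \<open>
  The canonical element of \<open>V\<^sup>* \<otimes> V\<close> is the same for all pairs of dual bases. The coordinate bases in the
  definition of the partial dual can therefore be replaced by adapted ones.
\<close>

lemma dual_bases_contract:
  assumes "dual_bases u d" "cbilinear F"
  shows "(\<Sum>j\<in>UNIV. F (bv j) (bv j)) = (\<Sum>i\<in>UNIV. F (d i) (u i))"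
proof -
  have "(\<Sum>j\<in>UNIV. F (bv j) (bv j)) = (\<Sum>j\<in>UNIV. F (bv j) (\<Sum>i\<in>UNIV. pair (d i) (bv j) *s u i))"
    by (simp only: dual_bases_expansion[OF assms(1), symmetric])
  also have "\<dots> = (\<Sum>j\<in>UNIV. \<Sum>i\<in>UNIV. d i $ j *s F (bv j) (u i))"
    by (simp add: cbilinear_sum[OF assms(2)] cbilinearD[OF assms(2)])
  also have "\<dots> = (\<Sum>i\<in>UNIV. \<Sum>j\<in>UNIV. F (d i $ j *s bv j) (u i))"
    by (subst sum.swap) (simp add: cbilinearD[OF assms(2)])
  also have "\<dots> = (\<Sum>i\<in>UNIV. F (\<Sum>j\<in>UNIV. d i $ j *s bv j) (u i))"
    by (simp add: cbilinear_sum[OF assms(2)])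
  finally show ?thesis by (simp add: bv_expansion[symmetric])
qed

text \<open>
  A spanning family of the right cardinality is a basis, and its coefficient functionals form the dual basis.
\<close>

lemma dual_bases_of_spanning:
  fixes u :: "'i::finite \<Rightarrow> complex ^ 'n"
  assumes "CARD('i) = CARD('n)" "vec.span (range u) = UNIV"
  shows "\<exists>d. dual_bases u d"
proof -
  have fin: "finite (range u)" by simp
  have "CARD('n) \<le> card (range u)"
    using vec.dim_le_card[of UNIV "range u"] assms(2) fin unfolding vec_dim_card by simp
  then have card: "card (range u) = CARD('n)"
    using card_image_le[of "UNIV :: 'i set" u] assms(1) by simp
  have inj: "inj u" using card assms(1) by (simp add: eq_card_imp_inj_on)
  have ind: "vec.independent (range u)"
    using vec.card_le_dim_spanning[of "range u" UNIV] assms(2) card unfolding vec_dim_card by simp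
  define r where "r i x = vec.representation (range u) x (u i)" for i x
  define d where "d i = (\<chi> j. r i (bv j))" for i
  have r_lin: "clinear_form (r i)" for i
    using ind assms(2) by (intro clinear_formI) (simp_all add: r_def vec.representation_add vec.representation_scale)
  have pair_d: "pair (d i) x = r i x" for i x
    by (subst (2) bv_expansion[of x])
       (simp add: clinear_form_sum[OF r_lin] clinear_form_scale[OF r_lin], simp add: d_def pair_def mult.commute)
  have "x = (\<Sum>i\<in>UNIV. r i x *s u i)" for x
  proof -
    have "(\<Sum>i\<in>UNIV. r i x *s u i) = (\<Sum>v\<in>range u. vec.representation (range u) x v *s v)"
      unfolding r_def by (simp add: sum.reindex[OF inj])
    also have "\<dots> = x"
      using vec.sum_representation_eq[OF ind, of x "range u"] assms(2) by simp
    finally show ?thesis ..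
  qed
  moreover have "r i (u j) = of_bool (i = j)" for i j
    using inj by (auto simp: r_def vec.representation_basis[OF ind] inj_eq)
  ultimately show ?thesis
    unfolding dual_bases_def by (intro exI[of _ d] conjI allI) (simp_all only: pair_d)
qed

lemma pair_commute: "pair f x = pair x f"
  by (simp add: pair_def mult.commute)

lemma dual_bases_swap: "dual_bases u d \<Longrightarrow> dual_bases d u"
  unfolding dual_bases_def[of d u] pair_commute[of "u _"]
  by (intro conjI allI) (auto simp: dual_bases_pair, rule dual_bases_dual_expansion)

lemma dual_bases_tensor:
  assumes "dual_bases u d" "dual_bases v e"
  shows "dual_bases (\<lambda>g. u (snd g) \<otimes> v (fst g)) (\<lambda>g. d (snd g) \<otimes> e (fst g))"
  unfolding dual_bases_def
proof (intro conjI allI)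
  fix i j
  show "pair (d (snd i) \<otimes> e (fst i)) (u (snd j) \<otimes> v (fst j)) = of_bool (i = j)"
    by (auto simp: pair_tensor dual_bases_pair[OF assms(1)] dual_bases_pair[OF assms(2)] prod_eq_iff)
next
  fix t
  show "t = (\<Sum>g\<in>UNIV. pair (d (snd g) \<otimes> e (fst g)) t *s (u (snd g) \<otimes> v (fst g)))"
  proof (rule tensor_ext[of "\<lambda>t. t"])
    show "clinear_map (\<lambda>t. \<Sum>g\<in>UNIV. pair (d (snd g) \<otimes> e (fst g)) t *s (u (snd g) \<otimes> v (fst g)))"
      by (intro clin)
    fix x y
    have "x \<otimes> y = (\<Sum>i\<in>UNIV. pair (d i) x *s u i) \<otimes> (\<Sum>j\<in>UNIV. pair (e j) y *s v j)"
      by (simp only: dual_bases_expansion[OF assms(1), symmetric] dual_bases_expansion[OF assms(2), symmetric])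
    also have "\<dots> = (\<Sum>g\<in>UNIV. pair (d (snd g) \<otimes> e (fst g)) (x \<otimes> y) *s (u (snd g) \<otimes> v (fst g)))"
      by (simp add: tensor_sum tensor_linear sum_UNIV_prod pair_tensor scale_sum vec.scale_scale mult.commute)
    finally show "x \<otimes> y = (\<Sum>g\<in>UNIV. pair (d (snd g) \<otimes> e (fst g)) (x \<otimes> y) *s (u (snd g) \<otimes> v (fst g)))" .
  qed (rule clin)
qed

lemma transp2_expansion:
  assumes "dual_bases u d" "dual_bases v e" "cbilinear m"
  shows "transp2 m f = (\<Sum>i\<in>UNIV. \<Sum>j\<in>UNIV. pair f (m (u i) (v j)) *s (d i \<otimes> e j))"
proof -
  have "transp2 m f $ (k, l) = (\<Sum>i\<in>UNIV. \<Sum>j\<in>UNIV. pair f (m (u i) (v j)) *s (d i \<otimes> e j)) $ (k, l)" for k l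
  proof -
    have "transp2 m f $ (k, l) = pair f (m (bv k) (bv l))" by (simp add: transp2_def)
    also have "\<dots> = pair f (m (\<Sum>i\<in>UNIV. pair (d i) (bv k) *s u i) (\<Sum>j\<in>UNIV. pair (e j) (bv l) *s v j))"
      by (simp only: dual_bases_expansion[OF assms(1), symmetric] dual_bases_expansion[OF assms(2), symmetric])
    also have "\<dots> = (\<Sum>j\<in>UNIV. \<Sum>i\<in>UNIV. pair f (m (u i) (v j)) * (d i $ k * e j $ l))"
      by (simp add: cbilinear_sum[OF assms(3)] cbilinearD[OF assms(3)] pair_sum pair_linear sum_distrib_left
          scale_sum mult_ac)
    also have "\<dots> = (\<Sum>i\<in>UNIV. \<Sum>j\<in>UNIV. pair f (m (u i) (v j)) * (d i $ k * e j $ l))"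
      by (rule sum.swap)
    finally show ?thesis by simp
  qed
  then show ?thesis by (auto simp: vec_eq_iff)
qed

lemma sw_expansion:
  assumes "t = (\<Sum>i\<in>UNIV. \<Sum>j\<in>UNIV. c i j *s (x i j \<otimes> y i j))" "cbilinear F"
  shows "sw t F = (\<Sum>i\<in>UNIV. \<Sum>j\<in>UNIV. c i j *s F (x i j) (y i j))"
  by (simp add: assms sw_sum sw_linear sw_tensor)

section \<open>Transport along isomorphisms of quasi-Hopf algebras\<close>

text \<open>
  The image of a structure on \<open>L\<close> under an isomorphism \<open>g\<close> is compared with \<open>K\<close> in every tensor power: each term
  of an axiom for \<open>K\<close>, evaluated at \<open>g x\<close>, is the image under \<open>g \<otimes> \<dots> \<otimes> g\<close> of the same term for \<open>L\<close>.
\<close>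

locale transport =
  fixes L :: "'n::finite quasi_hopf_data" and K :: "'m::finite quasi_hopf_data"
    and g :: "complex ^ 'n \<Rightarrow> complex ^ 'm"
  assumes iso: "quasi_iso L K g" and mult_L: "cbilinear (mult L)"
begin

definition gi :: "complex ^ 'm \<Rightarrow> complex ^ 'n" where "gi = inv g"

abbreviation "g2 \<equiv> tmap g g"
abbreviation "g3 \<equiv> tmap g (tmap g g)"
abbreviation "g4 \<equiv> tmap g (tmap g (tmap g g))"

lemma g_linear [clin]: "clinear_map g" and bij_g: "bij g"
  using iso by (simp_all add: quasi_iso_def)

lemma g_lin [clin]: "clinear_map f \<Longrightarrow> clinear_map (\<lambda>x. g (f x))"
  by (rule clin_compose[OF g_linear])

lemma gi_g [simp]: "gi (g x) = x" and g_gi [simp]: "g (gi y) = y"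
  using bij_g by (simp_all add: gi_def bij_is_inj bij_is_surj surj_f_inv_f)

lemma gi_linear [clin]: "clinear_map gi"
proof (rule clinear_mapI)
  show "gi (x + y) = gi x + gi y" for x y
    by (metis g_gi gi_g clinear_map_add[OF g_linear])
  show "gi (a *s x) = a *s gi x" for a x
    by (metis g_gi gi_g clinear_map_scale[OF g_linear])
qed

lemma gi_lin [clin]: "clinear_map f \<Longrightarrow> clinear_map (\<lambda>x. gi (f x))"
  by (rule clin_compose[OF gi_linear])

lemma mult_g: "mult K (g x) (g y) = g (mult L x y)"
  and one_g: "one K = g (one L)"
  and comult_g: "comult K (g x) = g2 (comult L x)"
  and counit_g: "counit K (g x) = counit L x"
  and associator_g: "associator K = g3 (associator L)"
  using iso by (simp_all add: quasi_iso_def)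

lemma mult_K: "cbilinear (mult K)"
proof -
  have "mult K = (\<lambda>x y. g (mult L (gi x) (gi y)))"
    by (intro ext) (simp add: mult_g[symmetric])
  then show ?thesis
    by (simp only:) (intro cbilinearI clin clin_bilinear[OF mult_L])
qed

lemma mult2_g: "mult2 K (g2 s) (g2 t) = g2 (mult2 L s t)"
  unfolding mult2_def
  by (rule tmap_tmult[symmetric]) (simp_all add: clin mult_g mult_K)

lemma mult3_g: "mult3 K (g3 s) (g3 t) = g3 (mult3 L s t)"
  unfolding mult3_def
  by (rule tmap_tmult[symmetric])
    (simp_all add: clin mult_g mult_K mult2_g, simp add: mult2_def cbilinear_tmult)

lemma mult4_g: "mult4 K (g4 s) (g4 t) = g4 (mult4 L s t)"
  unfolding mult4_def
  by (rule tmap_tmult[symmetric])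
    (simp_all add: clin mult_g mult_K mult3_g, simp add: mult3_def cbilinear_tmult)

lemma g2_inverse: "g2 (tmap gi gi t) = t" "tmap gi gi (g2 s) = s"
  and g3_inverse: "g3 (tmap gi (tmap gi gi) t') = t'" "tmap gi (tmap gi gi) (g3 s') = s'"
  by (simp_all add: tmap_tmap clin tmap_id)

lemma one2_g: "one2 K = g2 (one2 L)" and one3_g: "one3 K = g3 (one3 L)"
  by (simp_all add: one_g tmap_tensor clin)

lemma g3_inject: "g3 s = g3 t \<longleftrightarrow> s = t" and g2_inject: "g2 s' = g2 t' \<longleftrightarrow> s' = t'"
  by (metis g3_inverse, metis g2_inverse)

lemma unital_algebra_g:
  assumes "unital_algebra L"
  shows "unital_algebra K"
proof -
  have "mult K (mult K (g x) (g y)) (g z) = mult K (g x) (mult K (g y) (g z))" for x y z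
    using assms by (simp add: unital_algebra_def mult_g)
  then have "mult K (mult K x y) z = mult K x (mult K y z)" for x y z
    by (metis g_gi)
  moreover have "mult K (one K) (g x) = g x \<and> mult K (g x) (one K) = g x" for x
    using assms by (simp add: unital_algebra_def mult_g one_g)
  then have "mult K (one K) x = x \<and> mult K x (one K) = x" for x
    by (metis g_gi)
  ultimately show ?thesis
    using mult_K unfolding unital_algebra_def cbilinear_def by blast
qed

lemma counit_lin:
  assumes "clinear_form (counit L)"
  shows "clinear_form (counit K)"
proof -
  have "counit K y = counit L (gi y)" for y
    by (simp add: counit_g[symmetric])
  then show ?thesis
    using assms gi_linear by (simp add: clinear_form_iff clinear_map_add clinear_map_scale)
qed

lemma prebialgebra_g:
  assumes L: "prebialgebra L"
  shows "prebialgebra K"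
proof -
  have e: "clinear_form (counit K)" and eL: "clinear_form (counit L)"
    using counit_lin L by (auto simp: prebialgebra_def)
  have u: "unital_algebra K" using L unital_algebra_g by (simp add: prebialgebra_def)
  have "comult K = (\<lambda>y. g2 (comult L (gi y)))" 
    by (intro ext) (simp add: comult_g[symmetric])
  moreover have "clinear_map (\<lambda>y. g2 (comult L (gi y)))"
    using L by (intro clin clin_compose[of "comult L", OF _ gi_linear]) (simp add: prebialgebra_def)
  ultimately have "clinear_map (comult K)" by simp
  moreover have "comult K (one K) = one2 K"
    using L unfolding one2_g by (simp add: prebialgebra_def one_g comult_g)
  moreover have "comult K (mult K (g x) (g y)) = mult2 K (comult K (g x)) (comult K (g y))" for x y
    using L by (simp add: prebialgebra_def comult_g mult_g mult2_g)
  then have "comult K (mult K x y) = mult2 K (comult K x) (comult K y)" for x y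
    by (metis g_gi)
  moreover have "counit K (mult K (g x) (g y)) = counit K (g x) * counit K (g y)" for x y
    using L by (simp add: prebialgebra_def counit_g mult_g)
  then have "counit K (mult K x y) = counit K x * counit K y" for x y
    by (metis g_gi)
  moreover have "counit K (one K) = 1" using L by (simp add: prebialgebra_def one_g counit_g)
  moreover have "sw (comult K (g a)) (\<lambda>x y. counit K x *s y) = g a"
    "sw (comult K (g a)) (\<lambda>x y. counit K y *s x) = g a" for a
  proof -
    have "sw (comult K (g a)) (\<lambda>x y. counit K x *s y) = sw (comult L a) (\<lambda>x y. counit K (g x) *s g y)"
      unfolding comult_g by (intro sw_tmap cbilinearI clin e)
    also have "\<dots> = sw (comult L a) (\<lambda>x y. g (counit L x *s y))"
      by (simp add: counit_g clinear_map_scale[OF g_linear])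
    also have "\<dots> = g (sw (comult L a) (\<lambda>x y. counit L x *s y))"
      by (rule clinear_sw[OF g_linear, symmetric])
    finally show "sw (comult K (g a)) (\<lambda>x y. counit K x *s y) = g a"
      using L by (simp add: prebialgebra_def)
    have "sw (comult K (g a)) (\<lambda>x y. counit K y *s x) = sw (comult L a) (\<lambda>x y. counit K (g y) *s g x)"
      unfolding comult_g by (intro sw_tmap cbilinearI clin e)
    also have "\<dots> = sw (comult L a) (\<lambda>x y. g (counit L y *s x))"
      by (simp add: counit_g clinear_map_scale[OF g_linear])
    also have "\<dots> = g (sw (comult L a) (\<lambda>x y. counit L y *s x))"
      by (rule clinear_sw[OF g_linear, symmetric])
    finally show "sw (comult K (g a)) (\<lambda>x y. counit K y *s x) = g a"
      using L by (simp add: prebialgebra_def)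
  qed
  then have "sw (comult K a) (\<lambda>x y. counit K x *s y) = a \<and> sw (comult K a) (\<lambda>x y. counit K y *s x) = a" for a
    by (metis g_gi)
  ultimately show ?thesis
    using e u by (simp add: prebialgebra_def)
qed

lemma comult_linear:
  assumes "prebialgebra L"
  shows "clinear_map (comult L)" "clinear_map (comult K)"
  using assms prebialgebra_g by (simp_all add: prebialgebra_def)

lemma inverse_in_g: "inverse_in (mult3 K) (one3 K) (g3 s) (g3 t) \<longleftrightarrow> inverse_in (mult3 L) (one3 L) s t"
  unfolding inverse_in_def one3_g by (simp add: mult3_g g3_inject)

lemma inverse_in2_g: "inverse_in (mult2 K) (one2 K) (g2 s) (g2 t) \<longleftrightarrow> inverse_in (mult2 L) (one2 L) s t"
  unfolding inverse_in_def one2_g by (simp add: mult2_g g2_inject)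

lemma quasi_bialgebra_g:
  assumes L: "quasi_bialgebra L"
  shows "quasi_bialgebra K"
proof -
  have pL: "prebialgebra L" using L by (simp add: quasi_bialgebra_def)
  note pK = prebialgebra_g[OF pL]
  note lin = comult_linear[OF pL]
  note [clin] = lin clin_compose[OF lin(1)] clin_compose[OF lin(2)]
  note simps = tmap_tmap clin comult_g reassoc_tmap[symmetric]
  have inv: "\<exists>\<psi>. inverse_in (mult3 K) (one3 K) (associator K) \<psi>"
    using L unfolding quasi_bialgebra_def associator_g by (metis inverse_in_g)
  have q: "mult3 K (tmap id (comult K) (comult K (g a))) (associator K) =
      mult3 K (associator K) (reassoc (tmap (comult K) id (comult K (g a))))" for a
  proof -
    have 1: "tmap id (comult K) (comult K (g a)) = g3 (tmap id (comult L) (comult L a))"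
      by (simp add: simps)
    have 2: "reassoc (tmap (comult K) id (comult K (g a))) =
        g3 (reassoc (tmap (comult L) id (comult L a)))"
      by (simp add: simps)
    show ?thesis using L unfolding 1 2 associator_g mult3_g by (simp add: quasi_bialgebra_def)
  qed
  then have q: "mult3 K (tmap id (comult K) (comult K a)) (associator K) =
      mult3 K (associator K) (reassoc (tmap (comult K) id (comult K a)))" for a
    by (metis g_gi)
  have p1: "tmap id (tmap id (comult K)) (associator K) =
      g4 (tmap id (tmap id (comult L)) (associator L))"
    by (simp add: simps associator_g)
  have p2: "reassoc (tmap (comult K) id (associator K)) =
      g4 (reassoc (tmap (comult L) id (associator L)))"
    by (simp add: simps associator_g)
  have p3: "one K \<otimes> associator K = g4 (one L \<otimes> associator L)"
    by (simp add: tmap_tensor clin associator_g one_g)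
  have p4: "tmap id (\<lambda>t. reassoc (tmap (comult K) id t)) (associator K) =
      g4 (tmap id (\<lambda>t. reassoc (tmap (comult L) id t)) (associator L))"
    by (simp add: simps associator_g)
  have p5: "tmap id (tmap id (\<lambda>z. z \<otimes> one K)) (associator K) =
      g4 (tmap id (tmap id (\<lambda>z. z \<otimes> one L)) (associator L))"
    by (simp add: simps associator_g one_g tmap_tensor)
  have eK: "clinear_form (counit K)" "clinear_form (counit L)"
    using pL pK by (simp_all add: prebialgebra_def)
  have "sw (g2 t) (\<lambda>y z. counit K y *s z) = g (sw t (\<lambda>y z. counit L y *s z))" for t
  proof -
    have "sw (g2 t) (\<lambda>y z. counit K y *s z) = sw t (\<lambda>x y. counit K (g x) *s g y)"
      by (intro sw_tmap cbilinearI clin eK)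
    then show ?thesis by (simp add: clinear_sw[OF g_linear] clinear_map_scale[OF g_linear] counit_g)
  qed
  then have u: "tmap id (\<lambda>t. sw t (\<lambda>y z. counit K y *s z)) (associator K) =
      g2 (tmap id (\<lambda>t. sw t (\<lambda>y z. counit L y *s z)) (associator L))"
    by (simp add: associator_g tmap_tmap clin)
  have pentagon: "mult4 K (tmap id (tmap id (comult K)) (associator K))
        (reassoc (tmap (comult K) id (associator K))) =
      mult4 K (one K \<otimes> associator K)
        (mult4 K (tmap id (\<lambda>t. reassoc (tmap (comult K) id t)) (associator K))
          (tmap id (tmap id (\<lambda>z. z \<otimes> one K)) (associator K)))"
    using L unfolding p1 p2 p3 p4 p5 mult4_g by (simp add: quasi_bialgebra_def)
  have "tmap id (\<lambda>t. sw t (\<lambda>y z. counit K y *s z)) (associator K) = one2 K"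
    using L unfolding u one2_g by (simp add: quasi_bialgebra_def)
  then show ?thesis
    unfolding quasi_bialgebra_def using pK inv q pentagon by blast
qed

lemma quasi_antipode_g:
  assumes S: "quasi_antipode L S \<alpha> \<beta>" and pL: "prebialgebra L"
  shows "quasi_antipode K (\<lambda>y. g (S (gi y))) (g \<alpha>) (g \<beta>)"
proof -
  let ?S = "\<lambda>y. g (S (gi y))"
  have lin: "clinear_map S" using S by (simp add: quasi_antipode_def)
  note [clin] = clin_compose[OF lin] clin_bilinear[OF mult_K] clin_bilinear[OF mult_L]
  have bij: "bij ?S"
  proof -
    have "bij gi" by (metis bij_betw_def gi_g g_gi injI surjI)
    then have "bij (g \<circ> S \<circ> gi)" using S bij_g unfolding quasi_antipode_def by (intro bij_comp) auto
    then show ?thesis by (simp add: o_def)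
  qed
  have anti: "?S (mult K (g x) (g y)) = mult K (?S (g y)) (?S (g x))" for x y
    using S by (simp add: mult_g quasi_antipode_def)
  then have anti: "?S (mult K x y) = mult K (?S y) (?S x)" for x y
    by (metis g_gi)
  have a: "sw (comult K (g a)) (\<lambda>x y. mult K (?S x) (mult K (g \<alpha>) y)) = counit K (g a) *s g \<alpha>" for a
  proof -
    have "sw (comult K (g a)) (\<lambda>x y. mult K (?S x) (mult K (g \<alpha>) y)) =
        sw (comult L a) (\<lambda>x y. mult K (?S (g x)) (mult K (g \<alpha>) (g y)))"
      unfolding comult_g by (intro sw_tmap cbilinearI clin)
    also have "\<dots> = g (sw (comult L a) (\<lambda>x y. mult L (S x) (mult L \<alpha> y)))"
      by (simp add: mult_g clinear_sw[OF g_linear])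
    also have "\<dots> = counit K (g a) *s g \<alpha>"
      using S by (simp add: quasi_antipode_def clinear_map_scale[OF g_linear] counit_g)
    finally show ?thesis .
  qed
  then have a: "sw (comult K a) (\<lambda>x y. mult K (?S x) (mult K (g \<alpha>) y)) = counit K a *s g \<alpha>" for a
    by (metis g_gi)
  have b: "sw (comult K (g a)) (\<lambda>x y. mult K x (mult K (g \<beta>) (?S y))) = counit K (g a) *s g \<beta>" for a
  proof -
    have "sw (comult K (g a)) (\<lambda>x y. mult K x (mult K (g \<beta>) (?S y))) =
        sw (comult L a) (\<lambda>x y. mult K (g x) (mult K (g \<beta>) (?S (g y))))"
      unfolding comult_g by (intro sw_tmap cbilinearI clin)
    also have "\<dots> = g (sw (comult L a) (\<lambda>x y. mult L x (mult L \<beta> (S y))))"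
      by (simp add: mult_g clinear_sw[OF g_linear])
    also have "\<dots> = counit K (g a) *s g \<beta>"
      using S by (simp add: quasi_antipode_def clinear_map_scale[OF g_linear] counit_g)
    finally show ?thesis .
  qed
  then have b: "sw (comult K a) (\<lambda>x y. mult K x (mult K (g \<beta>) (?S y))) = counit K a *s g \<beta>" for a
    by (metis g_gi)
  have c: "sw (g3 \<psi>) (\<lambda>x t. sw t (\<lambda>y z. mult K x (mult K (g \<beta>) (mult K (?S y) (mult K (g \<alpha>) z))))) =
      g (sw \<psi> (\<lambda>x t. sw t (\<lambda>y z. mult L x (mult L \<beta> (mult L (S y) (mult L \<alpha> z))))))" for \<psi>
  proof -
    have 1: "sw (g2 t) (\<lambda>y z. mult K x (mult K (g \<beta>) (mult K (?S y) (mult K (g \<alpha>) z)))) =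
        sw t (\<lambda>y z. mult K x (mult K (g \<beta>) (mult K (?S (g y)) (mult K (g \<alpha>) (g z)))))" for x t
      by (intro sw_tmap cbilinearI clin)
    have "sw (g3 \<psi>) (\<lambda>x t. sw t (\<lambda>y z. mult K x (mult K (g \<beta>) (mult K (?S y) (mult K (g \<alpha>) z))))) =
      sw \<psi> (\<lambda>x t. sw (g2 t) (\<lambda>y z. mult K (g x) (mult K (g \<beta>) (mult K (?S y) (mult K (g \<alpha>) z)))))"
      by (intro sw_tmap cbilinearI clin)
    then show ?thesis unfolding 1 by (simp add: mult_g clinear_sw[OF g_linear])
  qed
  have d: "sw (g3 \<psi>) (\<lambda>x t. sw t (\<lambda>y z. mult K (?S x) (mult K (g \<alpha>) (mult K y (mult K (g \<beta>) (?S z)))))) =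
      g (sw \<psi> (\<lambda>x t. sw t (\<lambda>y z. mult L (S x) (mult L \<alpha> (mult L y (mult L \<beta> (S z)))))))" for \<psi>
  proof -
    have 1: "sw (g2 t) (\<lambda>y z. mult K (?S x) (mult K (g \<alpha>) (mult K y (mult K (g \<beta>) (?S z))))) =
        sw t (\<lambda>y z. mult K (?S x) (mult K (g \<alpha>) (mult K (g y) (mult K (g \<beta>) (?S (g z))))))" for x t
      by (intro sw_tmap cbilinearI clin)
    have "sw (g3 \<psi>) (\<lambda>x t. sw t (\<lambda>y z. mult K (?S x) (mult K (g \<alpha>) (mult K y (mult K (g \<beta>) (?S z)))))) =
      sw \<psi> (\<lambda>x t. sw (g2 t) (\<lambda>y z. mult K (?S (g x)) (mult K (g \<alpha>) (mult K y (mult K (g \<beta>) (?S z))))))"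
      by (intro sw_tmap cbilinearI clin)
    then show ?thesis unfolding 1 by (simp add: mult_g clinear_sw[OF g_linear])
  qed
  have e: "\<forall>\<psi>. inverse_in (mult3 K) (one3 K) (associator K) \<psi> \<longrightarrow>
      sw \<psi> (\<lambda>x t. sw t (\<lambda>y z. mult K (?S x) (mult K (g \<alpha>) (mult K y (mult K (g \<beta>) (?S z)))))) = one K"
  proof (intro allI impI)
    fix \<psi> assume inv: "inverse_in (mult3 K) (one3 K) (associator K) \<psi>"
    define \<psi>' where "\<psi>' = tmap gi (tmap gi gi) \<psi>"
    then have \<psi>: "\<psi> = g3 \<psi>'" by (simp add: g3_inverse)
    have "inverse_in (mult3 L) (one3 L) (associator L) \<psi>'"
      using inv unfolding \<psi> associator_g inverse_in_g .
    then show "sw \<psi> (\<lambda>x t. sw t (\<lambda>y z. mult K (?S x) (mult K (g \<alpha>) (mult K y (mult K (g \<beta>) (?S z)))))) = one K"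
      using S unfolding \<psi> d one_g by (simp add: quasi_antipode_def)
  qed
  have lin': "clinear_map ?S" by (intro clin)
  have "sw (associator K) (\<lambda>x t. sw t (\<lambda>y z.
      mult K x (mult K (g \<beta>) (mult K (?S y) (mult K (g \<alpha>) z))))) = one K"
    unfolding associator_g c using S by (simp add: quasi_antipode_def one_g)
  moreover have "?S (one K) = one K" using S by (simp add: quasi_antipode_def one_g)
  ultimately show ?thesis
    unfolding quasi_antipode_def using lin' bij anti a b e by blast
qed

lemma quasi_hopf_algebra_g:
  assumes "quasi_hopf_algebra L"
  shows "quasi_hopf_algebra K"
  using assms quasi_bialgebra_g quasi_antipode_g
  unfolding quasi_hopf_algebra_def quasi_bialgebra_def by blast

lemma commutative_algebra_g:
  assumes "commutative_algebra L"
  shows "commutative_algebra K"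
  using assms unfolding commutative_algebra_def by (metis g_gi mult_g)

lemma semisimple_algebra_g:
  assumes L: "semisimple_algebra L"
  shows "semisimple_algebra K"
  unfolding semisimple_algebra_def
proof (intro allI impI)
  fix I assume I: "left_ideal K I"
  have "left_ideal L (g -` I)"
    unfolding left_ideal_def vec.subspace_def
  proof (intro conjI ballI allI)
    show "0 \<in> g -` I" using I clinear_map_zero[OF g_linear] by (simp add: left_ideal_def vec.subspace_def)
    show "x + y \<in> g -` I" if "x \<in> g -` I" "y \<in> g -` I" for x y
      using I that clinear_map_add[OF g_linear] by (simp add: left_ideal_def vec.subspace_def)
    show "c *s x \<in> g -` I" if "x \<in> g -` I" for c x
      using I that clinear_map_scale[OF g_linear] by (simp add: left_ideal_def vec.subspace_def)
    show "mult L a x \<in> g -` I" if "x \<in> g -` I" for a x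
      using I that by (simp add: left_ideal_def mult_g[symmetric])
  qed
  then obtain J where J: "left_ideal L J" "g -` I \<inter> J = {0}"
      "\<And>x. \<exists>y\<in>g -` I. \<exists>z\<in>J. x = y + z"
    using L unfolding semisimple_algebra_def by metis
  have "left_ideal K (gi -` J)"
    unfolding left_ideal_def vec.subspace_def
  proof (intro conjI ballI allI)
    show "0 \<in> gi -` J" using J(1) clinear_map_zero[OF gi_linear] by (simp add: left_ideal_def vec.subspace_def)
    show "x + y \<in> gi -` J" if "x \<in> gi -` J" "y \<in> gi -` J" for x y
      using J(1) that clinear_map_add[OF gi_linear] by (simp add: left_ideal_def vec.subspace_def)
    show "c *s x \<in> gi -` J" if "x \<in> gi -` J" for c x
      using J(1) that clinear_map_scale[OF gi_linear] by (simp add: left_ideal_def vec.subspace_def)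
    show "mult K a x \<in> gi -` J" if "x \<in> gi -` J" for a x
    proof -
      have "gi (mult K a x) = mult L (gi a) (gi x)"
        using mult_g[of "gi a" "gi x"] by simp
      then show ?thesis using J(1) that by (simp add: left_ideal_def)
    qed
  qed
  moreover have "I \<inter> gi -` J = {0}"
  proof (intro equalityI subsetI)
    fix x assume "x \<in> I \<inter> gi -` J"
    then have "gi x \<in> g -` I \<inter> J" by simp
    then have "gi x = 0" using J(2) by blast
    then show "x \<in> {0}" by (metis g_gi clinear_map_zero[OF g_linear] singletonI)
  next
    fix x :: "complex ^ 'm" assume "x \<in> {0}"
    then show "x \<in> I \<inter> gi -` J"
      using I J(1) clinear_map_zero[OF gi_linear] by (simp add: left_ideal_def vec.subspace_def)
  qed
  moreover have "\<exists>y\<in>I. \<exists>z\<in>gi -` J. x = y + z" for x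
  proof -
    obtain y z where "g y \<in> I" "z \<in> J" "gi x = y + z" using J(3)[of "gi x"] by auto
    moreover from this have "x = g y + g z" by (metis g_gi clinear_map_add[OF g_linear])
    ultimately show ?thesis by (intro bexI[of _ "g y"] bexI[of _ "g z"]) auto
  qed
  ultimately show "\<exists>J. left_ideal K J \<and> I \<inter> J = {0} \<and> (\<forall>x. \<exists>y\<in>I. \<exists>z\<in>J. x = y + z)"
    by blast
qed

text \<open>
  A gauge transformation of \<open>K\<close> pulls back along \<open>g \<otimes> g\<close>, and \<open>g\<close> is then an isomorphism between the two twisted
  algebras.
\<close>

lemma gauge_equivalent_g:
  assumes pL: "prebialgebra L" and KN: "gauge_equivalent K N"
  shows "gauge_equivalent L N"
proof -
  obtain F' G' f where gt: "gauge_transformation K F' G'" and f: "quasi_iso (twist K F' G') N f"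
    using KN by (auto simp: gauge_equivalent_def)
  define F where "F = tmap gi gi F'"
  define G where "G = tmap gi gi G'"
  have F': "F' = g2 F" and G': "G' = g2 G"
    by (simp_all add: F_def G_def g2_inverse)
  have e: "clinear_form (counit K)" and eL: "clinear_form (counit L)"
    using pL prebialgebra_g[OF pL] by (simp_all add: prebialgebra_def)
  note lin = comult_linear[OF pL]
  note [clin] = lin clin_compose[OF lin(1)] clin_compose[OF lin(2)]
  have s1: "sw (g2 t) (\<lambda>y z. counit K y *s z) = g (sw t (\<lambda>y z. counit L y *s z))" for t
  proof -
    have "sw (g2 t) (\<lambda>y z. counit K y *s z) = sw t (\<lambda>x y. counit K (g x) *s g y)"
      by (intro sw_tmap cbilinearI clin e)
    then show ?thesis by (simp add: clinear_sw[OF g_linear] clinear_map_scale[OF g_linear] counit_g)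
  qed
  have s2: "sw (g2 t) (\<lambda>y z. counit K z *s y) = g (sw t (\<lambda>y z. counit L z *s y))" for t
  proof -
    have "sw (g2 t) (\<lambda>y z. counit K z *s y) = sw t (\<lambda>x y. counit K (g y) *s g x)"
      by (intro sw_tmap cbilinearI clin e)
    then show ?thesis by (simp add: clinear_sw[OF g_linear] clinear_map_scale[OF g_linear] counit_g)
  qed
  have g_inj: "g x = g y \<longleftrightarrow> x = y" for x y by (metis gi_g)
  have "inverse_in (mult2 L) (one2 L) F G"
    using gt unfolding gauge_transformation_def F' G' inverse_in2_g by simp
  moreover have "sw F (\<lambda>x y. counit L x *s y) = one L" "sw F (\<lambda>x y. counit L y *s x) = one L"
    using gt unfolding gauge_transformation_def F' s1 s2 one_g g_inj by simp_all
  ultimately have gtL: "gauge_transformation L F G"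
    unfolding gauge_transformation_def by blast
  have t1: "one K \<otimes> F' = g3 (one L \<otimes> F)"
    by (simp add: F' tmap_tensor clin one_g)
  have t2: "tmap id (comult K) F' = g3 (tmap id (comult L) F)"
    by (simp add: F' tmap_tmap clin comult_g)
  have t3: "reassoc (tmap (comult K) id G') = g3 (reassoc (tmap (comult L) id G))"
    by (simp add: G' tmap_tmap clin comult_g reassoc_tmap[symmetric])
  have t4: "reassoc (G' \<otimes> one K) = g3 (reassoc (G \<otimes> one L))"
    by (simp add: G' tmap_tensor clin one_g reassoc_tmap[symmetric])
  have fl: "clinear_map f" and fb: "bij f" using f by (simp_all add: quasi_iso_def)
  have "quasi_iso (twist L F G) N (\<lambda>x. f (g x))"
    unfolding quasi_iso_def
  proof (intro conjI allI)
    show "clinear_map (\<lambda>x. f (g x))" by (rule clin_compose[OF fl g_linear])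
    show "bij (\<lambda>x. f (g x))" using bij_comp[OF bij_g fb] by (simp add: o_def)
    show "f (g (one (twist L F G))) = one N"
      using f by (simp add: quasi_iso_def twist_def one_g)
    show "f (g (mult (twist L F G) x y)) = mult N (f (g x)) (f (g y))" for x y
      using f by (simp add: quasi_iso_def twist_def mult_g[symmetric])
    show "counit N (f (g a)) = counit (twist L F G) a" for a
      using f by (simp add: quasi_iso_def twist_def counit_g)
    show "comult N (f (g a)) = tmap (\<lambda>x. f (g x)) (\<lambda>x. f (g x)) (comult (twist L F G) a)" for a
    proof -
      have "comult N (f (g a)) = tmap f f (comult (twist K F' G') (g a))"
        using f by (simp add: quasi_iso_def)
      also have "comult (twist K F' G') (g a) = g2 (comult (twist L F G) a)"
        unfolding twist_def F' G' by (simp add: comult_g mult2_g)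
      finally show ?thesis by (simp add: tmap_tmap fl)
    qed
    have "associator (twist K F' G') = g3 (associator (twist L F G))"
      unfolding twist_def by (simp add: t1 t2 t3 t4 associator_g mult3_g)
    moreover have "associator N = tmap f (tmap f f) (associator (twist K F' G'))"
      using f by (simp add: quasi_iso_def)
    ultimately show "associator N =
        tmap (\<lambda>x. f (g x)) (tmap (\<lambda>x. f (g x)) (\<lambda>x. f (g x))) (associator (twist L F G))"
      by (simp add: tmap_tmap fl clin)
  qed
  then show ?thesis
    using gtL unfolding gauge_equivalent_def by blast
qed

end

section \<open>Functions on a finite group, twisted by a 3-cocycle\<close>

text \<open>
  The algebra of functions on a group with associator \<open>\<omega>\<close>; its modules are the vector spaces graded by the
  group, with associativity constraint \<open>\<omega>\<close>.
\<close>

definition twisted_functions :: "('g::finite \<Rightarrow> 'g \<Rightarrow> 'g) \<Rightarrow> 'g \<Rightarrow> ('g \<Rightarrow> 'g \<Rightarrow> 'g \<Rightarrow> complex) \<Rightarrow>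
    'g quasi_hopf_data" where
  "twisted_functions m e \<omega> =
     \<lparr>mult = (\<lambda>f f'. \<chi> x. f $ x * f' $ x), one = (\<chi> x. 1),
      comult = (\<lambda>f. \<chi> p. f $ m (fst p) (snd p)), counit = (\<lambda>f. f $ e),
      associator = (\<chi> p. \<omega> (fst p) (fst (snd p)) (snd (snd p)))\<rparr>"

lemma tmult_pointwise:
  assumes "\<And>f f'. m f f' = (\<chi> x. f $ x * f' $ x)" "\<And>f f'. n f f' = (\<chi> x. f $ x * f' $ x)"
  shows "tmult m n s t = (\<chi> x. s $ x * t $ x)"
proof -
  have bil: "cbilinear m" "cbilinear n"
    by (intro cbilinearI clinear_mapI; simp add: assms vec_eq_iff algebra_simps)+
  have "clinear_map (\<lambda>t. \<chi> x. s $ x * t $ x)" "clinear_map (\<lambda>s. \<chi> x. s $ x * t $ x)" for s t :: "complex ^ 'n"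
    by (rule clinear_mapI; simp add: vec_eq_iff algebra_simps)+
  note lin = this
  have "tmult m n (x \<otimes> y) t = (\<chi> i. (x \<otimes> y) $ i * t $ i)" for x y
    by (rule tensor_ext[of "tmult m n (x \<otimes> y)"])
      (intro clin lin | simp add: tmult_tensor bil assms vec_eq_iff)+
  then show ?thesis
    by (rule tensor_ext[where t = s and f = "\<lambda>s. tmult m n s t", rotated 2]) (intro clin lin)+
qed

lemma clin_pullback [clin]: "clinear_map f \<Longrightarrow> clinear_map (\<lambda>x. \<chi> i. f x $ p i)"
  by (rule clinear_mapI) (simp_all add: clinear_map_add clinear_map_scale vec_eq_iff)

text \<open>
  In a function algebra, comultiplication, reassociation and insertion of a unit are pullbacks of functions along
  maps of index sets.
  Tensor products of pullbacks are pullbacks, so the axioms can be compared one coordinate at a time.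
\<close>

lemma tmap_pullback:
  assumes "\<And>x. f x = (\<chi> i. x $ p i)" "\<And>x. g x = (\<chi> i. x $ q i)"
  shows "tmap f g t = (\<chi> k. t $ (p (fst k), q (snd k)))"
proof -
  have "clinear_map f" "clinear_map g" unfolding assms[abs_def] by (intro clin)+
  then show ?thesis
    by (intro tensor_ext[where t = t and f = "tmap f g"]) (intro clin | simp add: tmap_tensor assms vec_eq_iff)+
qed

text \<open>
  The assumption \<open>cocycle\<close> is what the pentagon axiom says in coordinates; normalisation gives the counit axiom.
\<close>

locale cocycle_group =
  fixes m :: "'g::finite \<Rightarrow> 'g \<Rightarrow> 'g" and e :: 'g and iv :: "'g \<Rightarrow> 'g"
    and \<omega> :: "'g \<Rightarrow> 'g \<Rightarrow> 'g \<Rightarrow> complex"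
  assumes assoc: "m (m g h) k = m g (m h k)"
    and unit: "m e g = g" "m g e = g"
    and inverse: "m (iv g) g = e" "m g (iv g) = e"
    and cocycle: "\<omega> g h (m k l) * \<omega> (m g h) k l = \<omega> h k l * (\<omega> g (m h k) l * \<omega> g h k)"
    and normalized: "\<omega> e g h = 1" "\<omega> g e h = 1" "\<omega> g h e = 1"
    and nonzero: "\<omega> g h k \<noteq> 0"
begin

abbreviation "L \<equiv> twisted_functions m e \<omega>"

lemma L_simps:
  "mult L f f' = (\<chi> x. f $ x * f' $ x)" "one L = (\<chi> x. 1)"
  "comult L f = (\<chi> p. f $ m (fst p) (snd p))" "counit L f = f $ e"
  "associator L = (\<chi> p. \<omega> (fst p) (fst (snd p)) (snd (snd p)))"
  by (simp_all add: twisted_functions_def)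

lemma mult2_L: "mult2 L s t = (\<chi> x. s $ x * t $ x)"
  unfolding mult2_def by (rule tmult_pointwise) (simp_all add: L_simps)

lemma mult3_L: "mult3 L s t = (\<chi> x. s $ x * t $ x)"
  unfolding mult3_def by (rule tmult_pointwise) (simp_all add: L_simps mult2_L)

lemma mult4_L: "mult4 L s t = (\<chi> x. s $ x * t $ x)"
  unfolding mult4_def by (rule tmult_pointwise) (simp_all add: L_simps mult3_L)

lemma mult_L: "cbilinear (mult L)"
  by (intro cbilinearI clinear_mapI; simp add: L_simps vec_eq_iff algebra_simps)

lemma one_tensor_L: "one2 L = (\<chi> x. 1)" "one3 L = (\<chi> x. 1)" "one L \<otimes> t = (\<chi> x. t $ snd x)" "z \<otimes> one L = (\<chi> x. z $ fst x)"
  by (simp_all add: L_simps vec_eq_iff)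

lemma tmap_comult_right: "tmap id (comult L) t = (\<chi> k. t $ (fst k, m (fst (snd k)) (snd (snd k))))"
  by (rule tmap_pullback) (simp_all add: L_simps)

lemma tmap_comult_left: "reassoc (tmap (comult L) id t) = (\<chi> k. t $ (m (fst k) (fst (snd k)), snd (snd k)))"
proof -
  have "tmap (comult L) id t = (\<chi> k. t $ (m (fst (fst k)) (snd (fst k)), snd k))"
    by (rule tmap_pullback) (simp_all add: L_simps)
  then show ?thesis by (simp add: reassoc_def)
qed

lemma prebialgebra_L: "prebialgebra L"
proof -
  have "unital_algebra L"
    using mult_L unfolding unital_algebra_def cbilinear_def by (simp add: L_simps mult_ac vec_eq_iff)
  moreover have "clinear_map (comult L)" unfolding L_simps[abs_def] by (intro clin)
  moreover have "clinear_form (counit L)" by (rule clinear_formI) (simp_all add: L_simps)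
  moreover have "sw (comult L a) (\<lambda>x y. counit L x *s y) = a" "sw (comult L a) (\<lambda>x y. counit L y *s x) = a" for a
  proof -
    have "sw (comult L a) (\<lambda>x y. counit L x *s y) $ k = a $ k" for k
      unfolding sw_nth by (subst sum2_single[of e k]) (auto simp: L_simps bv_nth unit)
    moreover have "sw (comult L a) (\<lambda>x y. counit L y *s x) $ k = a $ k" for k
      unfolding sw_nth by (subst sum2_single[of k e]) (auto simp: L_simps bv_nth unit)
    ultimately show "sw (comult L a) (\<lambda>x y. counit L x *s y) = a"
        "sw (comult L a) (\<lambda>x y. counit L y *s x) = a"
      by (simp_all add: vec_eq_iff)
  qed
  ultimately show ?thesis
    unfolding prebialgebra_def by (simp add: one_tensor_L mult2_L) (simp add: L_simps)
qed

lemma quasi_bialgebra_L: "quasi_bialgebra L"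
proof -
  have "inverse_in (mult3 L) (one3 L) (associator L) (\<chi> p. inverse (\<omega> (fst p) (fst (snd p)) (snd (snd p))))"
    unfolding inverse_in_def one_tensor_L mult3_L by (simp add: L_simps nonzero vec_eq_iff)
  moreover have "mult3 L (tmap id (comult L) (comult L a)) (associator L) =
      mult3 L (associator L) (reassoc (tmap (comult L) id (comult L a)))" for a
    unfolding mult3_L tmap_comult_right tmap_comult_left by (simp add: L_simps assoc vec_eq_iff)
  moreover have "mult4 L (tmap id (tmap id (comult L)) (associator L))
        (reassoc (tmap (comult L) id (associator L))) =
      mult4 L (one L \<otimes> associator L)
        (mult4 L (tmap id (\<lambda>t. reassoc (tmap (comult L) id t)) (associator L))
          (tmap id (tmap id (\<lambda>z. z \<otimes> one L)) (associator L)))"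
  proof -
    have 1: "tmap id (tmap id (comult L)) t =
        (\<chi> k. t $ (fst k, fst (snd k), m (fst (snd (snd k))) (snd (snd (snd k)))))" for t
      by (rule tmap_pullback) (simp_all add: tmap_comult_right)
    have 2: "tmap id (\<lambda>t. reassoc (tmap (comult L) id t)) t =
        (\<chi> k. t $ (fst k, m (fst (snd k)) (fst (snd (snd k))), snd (snd (snd k))))" for t
      by (rule tmap_pullback) (simp_all add: tmap_comult_left)
    have "tmap id (\<lambda>z. z \<otimes> one L) t = (\<chi> k. t $ (fst k, fst (snd k)))" for t
      by (rule tmap_pullback) (simp_all add: one_tensor_L)
    note unit = this
    have 3: "tmap id (tmap id (\<lambda>z. z \<otimes> one L)) t = (\<chi> k. t $ (fst k, fst (snd k), fst (snd (snd k))))" for t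
      by (rule tmap_pullback) (simp_all add: unit)
    show ?thesis
      unfolding 1 2 3 unfolding mult4_L tmap_comult_left one_tensor_L by (simp add: L_simps cocycle vec_eq_iff)
  qed
  moreover have "tmap id (\<lambda>t. sw t (\<lambda>y z. counit L y *s z)) (associator L) = one2 L"
  proof -
    have "sw t (\<lambda>y z. counit L y *s z) $ k = t $ (e, k)" for t :: "complex ^ ('g \<times> 'g)" and k
      unfolding sw_nth by (subst sum2_single[of e k]) (auto simp: L_simps bv_nth)
    then have "sw t (\<lambda>y z. counit L y *s z) = (\<chi> k. t $ (e, k))" for t :: "complex ^ ('g \<times> 'g)"
      by (simp add: vec_eq_iff)
    then have "tmap id (\<lambda>t. sw t (\<lambda>y z. counit L y *s z)) t = (\<chi> k. t $ (fst k, e, snd k))"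
      for t :: "complex ^ ('g \<times> 'g \<times> 'g)"
      by (intro tmap_pullback) simp_all
    then show ?thesis unfolding one_tensor_L by (simp add: L_simps normalized)
  qed
  ultimately show ?thesis
    unfolding quasi_bialgebra_def using prebialgebra_L by blast
qed

lemma iv_iv [simp]: "iv (iv g) = g"
  by (metis assoc inverse unit)

text \<open>
  The cocycle identity at \<open>(g, g\<^sup>-\<^sup>1, g, g\<^sup>-\<^sup>1)\<close>. It makes the second antipode identity for the associator follow
  from the first.
\<close>

lemma cocycle_inverse: "\<omega> (iv g) g (iv g) * \<omega> g (iv g) g = 1"
  using cocycle[of g "iv g" g "iv g"] by (simp add: inverse normalized)

text \<open>
  With \<open>S f = f \<circ> (\<lambda>x. x\<^sup>-\<^sup>1)\<close> and \<open>\<alpha> = 1\<close>, the value of \<open>\<beta>\<close> is forced by the condition that the associator,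
  evaluated at \<open>(x, x\<^sup>-\<^sup>1, x)\<close>, be cancelled by \<open>\<beta>(x)\<close>.
\<close>

lemma quasi_antipode_L:
  "quasi_antipode L (\<lambda>f. \<chi> x. f $ iv x) (\<chi> x. 1) (\<chi> x. inverse (\<omega> x (iv x) x))"
  (is "quasi_antipode L ?S ?\<alpha> ?\<beta>")
proof -
  have lin: "clinear_map ?S" by (intro clin)
  have "bij ?S"
  proof (rule bijI')
    show "(\<chi> x. f $ iv x) = (\<chi> x. f' $ iv x) \<longleftrightarrow> f = f'" for f f' :: "complex ^ 'g"
      by (auto simp: vec_eq_iff) (metis iv_iv)
    show "\<exists>f. f' = (\<chi> x. f $ iv x)" for f' :: "complex ^ 'g"
      by (intro exI[of _ "\<chi> x. f' $ iv x"]) (simp add: vec_eq_iff)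
  qed
  moreover have "sw (comult L a) (\<lambda>x y. mult L (?S x) (mult L ?\<alpha> y)) = counit L a *s ?\<alpha>" for a
  proof -
    have "sw (comult L a) (\<lambda>x y. mult L (?S x) (mult L ?\<alpha> y)) $ k = a $ e" for k
      unfolding sw_nth by (subst sum2_single[of "iv k" k]) (auto simp: L_simps bv_nth inverse)
    then show ?thesis by (simp add: vec_eq_iff L_simps)
  qed
  moreover have "sw (comult L a) (\<lambda>x y. mult L x (mult L ?\<beta> (?S y))) = counit L a *s ?\<beta>" for a
  proof -
    have "sw (comult L a) (\<lambda>x y. mult L x (mult L ?\<beta> (?S y))) $ k = a $ e * ?\<beta> $ k" for k
      unfolding sw_nth by (subst sum2_single[of k "iv k"]) (auto simp: L_simps bv_nth inverse)
    then show ?thesis by (simp add: vec_eq_iff L_simps)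
  qed
  moreover have "sw (associator L) (\<lambda>x t. sw t (\<lambda>y z.
        mult L x (mult L ?\<beta> (mult L (?S y) (mult L ?\<alpha> z))))) = one L"
  proof -
    have "sw (associator L) (\<lambda>x t. sw t (\<lambda>y z.
        mult L x (mult L ?\<beta> (mult L (?S y) (mult L ?\<alpha> z))))) $ k = 1" for k
      unfolding sw_nth[of "associator L"]
      by (subst sum2_single[of k "(iv k, k)"]) (auto simp: sw_bv L_simps bv_nth nonzero)
    then show ?thesis by (simp add: vec_eq_iff L_simps)
  qed
  moreover have "sw \<psi> (\<lambda>x t. sw t (\<lambda>y z. mult L (?S x) (mult L ?\<alpha> (mult L y (mult L ?\<beta> (?S z)))))) = one L"
    if "inverse_in (mult3 L) (one3 L) (associator L) \<psi>" for \<psi>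
  proof -
    have "mult3 L (associator L) \<psi> = one3 L" using that by (simp add: inverse_in_def)
    then have "\<omega> i j k * \<psi> $ (i, j, k) = 1" for i j k
      unfolding mult3_L one_tensor_L by (simp add: vec_eq_iff L_simps)
    then have \<psi>: "\<psi> $ (i, j, k) = inverse (\<omega> i j k)" for i j k
      by (metis inverse_unique)
    have "sw \<psi> (\<lambda>x t. sw t (\<lambda>y z. mult L (?S x) (mult L ?\<alpha> (mult L y (mult L ?\<beta> (?S z)))))) $ k = 1" for k
      unfolding sw_nth[of \<psi>] using cocycle_inverse[of k]
      by (subst sum2_single[of "iv k" "(k, iv k)"])
        (auto simp: sw_bv L_simps bv_nth \<psi> simp flip: inverse_mult_distrib)
    then show ?thesis by (simp add: vec_eq_iff L_simps)
  qed
  ultimately show ?thesis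
    unfolding quasi_antipode_def using lin by (simp add: L_simps mult.commute)
qed

lemma quasi_hopf_algebra_L: "quasi_hopf_algebra L"
  unfolding quasi_hopf_algebra_def using quasi_bialgebra_L quasi_antipode_L by blast

lemma commutative_algebra_L: "commutative_algebra L"
  by (simp add: commutative_algebra_def L_simps mult.commute)

text \<open>
  An ideal contains the indicator function of each point at which one of its members does not vanish. It is thus
  the set of all functions supported on some subset \<open>A\<close>, and the functions vanishing on \<open>A\<close> are a complement.
\<close>

lemma semisimple_algebra_L: "semisimple_algebra L"
  unfolding semisimple_algebra_def
proof (intro allI impI)
  fix I assume I: "left_ideal L I"
  define A where "A = {x. \<exists>f\<in>I. f $ x \<noteq> 0}"
  define J where "J = {f :: complex ^ 'g. \<forall>x\<in>A. f $ x = 0}"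
  have sub: "vec.subspace I" using I by (simp add: left_ideal_def)
  have "left_ideal L J"
    unfolding left_ideal_def vec.subspace_def J_def by (simp add: L_simps)
  moreover have "I \<inter> J = {0}"
  proof (intro equalityI subsetI)
    fix f assume "f \<in> I \<inter> J"
    then have "f $ x = 0" for x by (auto simp: J_def A_def)
    then show "f \<in> {0}" by (simp add: vec_eq_iff)
  qed (use vec.subspace_0[OF sub] in \<open>auto simp: J_def\<close>)
  moreover have "\<exists>y\<in>I. \<exists>z\<in>J. f = y + z" for f
  proof -
    have bv: "bv x \<in> I" if "x \<in> A" for x
    proof -
      from that obtain f where f: "f \<in> I" "f $ x \<noteq> 0" by (auto simp: A_def)
      have "mult L ((1 / f $ x) *s bv x) f = bv x"
        using f(2) by (simp add: L_simps vec_eq_iff bv_nth)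
      then show ?thesis using I f(1) unfolding left_ideal_def by metis
    qed
    have "(\<chi> x. if x \<in> A then f $ x else 0) = (\<Sum>x\<in>A. f $ x *s bv x)"
      by (simp add: vec_eq_iff bv_nth if_distrib sum.delta cong: if_cong)
    also have "\<dots> \<in> I"
      by (intro vec.subspace_sum[OF sub] vec.subspace_scale[OF sub] bv)
    finally have "(\<chi> x. if x \<in> A then f $ x else 0) \<in> I" .
    moreover have "(\<chi> x. if x \<in> A then 0 else f $ x) \<in> J" by (simp add: J_def)
    moreover have "f = (\<chi> x. if x \<in> A then f $ x else 0) + (\<chi> x. if x \<in> A then 0 else f $ x)"
      by (simp add: vec_eq_iff)
    ultimately show ?thesis by blast
  qed
  ultimately show "\<exists>J. left_ideal L J \<and> I \<inter> J = {0} \<and> (\<forall>x. \<exists>y\<in>I. \<exists>z\<in>J. x = y + z)"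
    by blast
qed

definition power :: "'g \<Rightarrow> nat \<Rightarrow> 'g" where "power g n = (m g ^^ n) e"

lemma power_Suc: "power g (Suc n) = m g (power g n)" "power g (Suc n) = m (power g n) g"
proof -
  show 1: "power g (Suc n) = m g (power g n)" for n by (simp add: power_def)
  show "power g (Suc n) = m (power g n) g"
  proof (induction n)
    case 0 then show ?case by (simp add: power_def unit)
  next
    case (Suc n) then show ?case by (metis 1 assoc)
  qed
qed

text \<open>
  If \<open>\<omega>\<close> is the coboundary of \<open>F\<^sup>-\<^sup>1\<close>, then \<open>\<omega>(g, g\<^sup>k, g) = P(k) / P(k + 1)\<close> with
  \<open>P(k) = F(g, g\<^sup>k) / F(g\<^sup>k, g)\<close>, because \<open>g g\<^sup>k = g\<^sup>k g\<close>. The product telescopes to \<open>P(0) / P(n)\<close>.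
\<close>

lemma trivial_periods:
  assumes gt: "gauge_transformation L F G" and triv: "associator (twist L F G) = one3 L"
    and n: "power g n = e"
  shows "(\<Prod>k<n. \<omega> g (power g k) g) = 1"
proof -
  have "mult2 L F G = one2 L" using gt by (simp add: gauge_transformation_def inverse_in_def)
  then have FG: "F $ p * G $ p = 1" for p
    unfolding mult2_L one_tensor_L by (cases p) (simp add: vec_eq_iff L_simps)
  then have F0: "F $ p \<noteq> 0" for p by (metis mult_zero_left zero_neq_one)
  have G: "G $ p = inverse (F $ p)" for p using FG[of p] F0[of p] by (simp add: field_simps)
  have "reassoc (G \<otimes> one L) = (\<chi> k. G $ (fst k, fst (snd k)))"
    by (simp add: reassoc_def one_tensor_L)
  then have "associator (twist L F G) = (\<chi> k. F $ snd k * (F $ (fst k, m (fst (snd k)) (snd (snd k))) *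
      (associator L $ k * (G $ (m (fst k) (fst (snd k)), snd (snd k)) * G $ (fst k, fst (snd k))))))"
    unfolding twist_def by (simp add: mult3_L tmap_comult_left tmap_comult_right one_tensor_L)
  then have *: "F $ (h, k) * (F $ (g, m h k) * (\<omega> g h k * (G $ (m g h, k) * G $ (g, h)))) = 1" for g h k
    using triv unfolding one_tensor_L vec_eq_iff L_simps by simp
  define P where "P k = F $ (g, power g k) / F $ (power g k, g)" for k
  have "\<omega> g (power g k) g = P k / P (Suc k)" for k
    using *[of "power g k" g g] F0 unfolding G power_Suc(1)[symmetric] power_Suc(2)[symmetric] P_def
    by (simp add: field_simps)
  then have "(\<Prod>k<n. \<omega> g (power g k) g) = P 0 / P n"
    using F0 by (induction n) (auto simp: P_def)
  also have "\<dots> = 1" using n F0 by (simp add: P_def power_def)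
  finally show ?thesis .
qed

text \<open>
  The isomorphism part of a gauge equivalence is injective on the third tensor power, so a trivial associator on
  the side of the Hopf algebra forces the twisted associator of the function algebra to be trivial.
\<close>

lemma genuine_L:
  assumes "power g n = e" "(\<Prod>k<n. \<omega> g (power g k) g) \<noteq> 1"
  shows "\<not> (hopf_algebra H \<and> gauge_equivalent L (hopf_as_quasi H))"
proof
  assume H: "hopf_algebra H \<and> gauge_equivalent L (hopf_as_quasi H)"
  then obtain F G f where gt: "gauge_transformation L F G" and f: "quasi_iso (twist L F G) (hopf_as_quasi H) f"
    by (auto simp: gauge_equivalent_def)
  have lin: "clinear_map f" and one: "f (one L) = one H"
    and ass: "one3 H = tmap f (tmap f f) (associator (twist L F G))"
    using f by (simp_all add: quasi_iso_def hopf_as_quasi_def twist_def)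
  interpret f: transport "twist L F G" "hopf_as_quasi H" f
    using f mult_L by unfold_locales (simp_all add: twist_def)
  have "tmap f (tmap f f) (one3 L) = one3 H"
    using lin by (simp add: tmap_tensor one clin)
  then have "associator (twist L F G) = one3 L"
    using ass f.g3_inject by metis
  then show False using trivial_periods[OF gt] assms by blast
qed

end

section \<open>Recognising twisted function algebras\<close>

definition lin_comb :: "('i::finite \<Rightarrow> complex ^ 'n) \<Rightarrow> complex ^ 'i \<Rightarrow> complex ^ 'n" where
  "lin_comb u v = (\<Sum>i\<in>UNIV. v $ i *s u i)"

lemma clin_lin_comb [clin]: "clinear_map f \<Longrightarrow> clinear_map (\<lambda>x. lin_comb u (f x))"
  by (rule clinear_mapI)
    (simp_all add: lin_comb_def clinear_map_add clinear_map_scale vec.scale_left_distrib sum.distrib scale_sum vec.scale_scale)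

lemma clin_lin_comb' [clin]: "clinear_map (lin_comb u)"
  by (rule clin_lin_comb) (rule clin)

lemma lin_comb_bv: "lin_comb u (bv i) = u i"
  by (simp add: lin_comb_def bv_nth of_bool_scale)

lemma bij_lin_comb:
  assumes "dual_bases u d"
  shows "bij (lin_comb u)"
proof (rule bijI')
  fix v w
  have "pair (d i) (lin_comb u v) = v $ i" for i v
    by (simp add: lin_comb_def pair_sum pair_linear dual_bases_pair[OF assms] of_bool_def if_distrib cong: if_cong)
  then show "lin_comb u v = lin_comb u w \<longleftrightarrow> v = w"
    by (metis vec_eq_iff)
next
  fix x
  show "\<exists>v. x = lin_comb u v"
    by (rule exI[of _ "\<chi> i. pair (d i) x"]) (simp add: lin_comb_def dual_bases_expansion[OF assms, symmetric])
qed

text \<open>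
  The basis \<open>E\<close> plays the role of the indicator functions of the points of the group.
\<close>

lemma quasi_iso_twisted_functions:
  assumes E: "dual_bases E D" and mK: "cbilinear (mult K)"
    and mult: "\<And>g h. mult K (E g) (E h) = of_bool (g = h) *s E g" and one: "one K = (\<Sum>g\<in>UNIV. E g)"
    and lin: "clinear_map (comult K)" "clinear_form (counit K)"
    and comult: "\<And>g. comult K (E g) = (\<Sum>h\<in>UNIV. \<Sum>k\<in>UNIV. of_bool (m h k = g) *s (E h \<otimes> E k))"
    and counit: "\<And>g. counit K (E g) = of_bool (g = e)"
    and assoc: "associator K = (\<Sum>g\<in>UNIV. \<Sum>h\<in>UNIV. \<Sum>k\<in>UNIV. \<omega> g h k *s (E g \<otimes> E h \<otimes> E k))"
  shows "quasi_iso (twisted_functions m e \<omega>) K (lin_comb E)"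
    (is "quasi_iso ?L K ?g")
  unfolding quasi_iso_def
proof (intro conjI allI)
  show "clinear_map ?g" by (intro clin)
  show "bij ?g" by (rule bij_lin_comb[OF E])
  show "?g (one ?L) = one K" by (simp add: lin_comb_def twisted_functions_def one)
  show "?g (mult ?L x y) = mult K (?g x) (?g y)" for x y
    by (simp add: lin_comb_def twisted_functions_def cbilinear_sum[OF mK] cbilinearD[OF mK] mult
        of_bool_scale if_distrib scale_sum vec.scale_scale cong: if_cong)
      (simp add: mult.commute)
  show "counit K (?g a) = counit ?L a" for a
    by (simp add: lin_comb_def twisted_functions_def clinear_form_sum[OF lin(2)] clinear_form_scale[OF lin(2)]
        counit of_bool_def if_distrib cong: if_cong)
  show "comult K (?g a) = tmap ?g ?g (comult ?L a)" for a
  proof -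
    have "comult K (?g a) = (\<Sum>g\<in>UNIV. a $ g *s (\<Sum>h\<in>UNIV. \<Sum>k\<in>UNIV. of_bool (m h k = g) *s (E h \<otimes> E k)))"
      by (simp add: lin_comb_def clinear_map_sum[OF lin(1)] clinear_map_scale[OF lin(1)] comult)
    also have "\<dots> = (\<Sum>g\<in>UNIV. \<Sum>h\<in>UNIV. \<Sum>k\<in>UNIV. (a $ g * of_bool (m h k = g)) *s (E h \<otimes> E k))"
      by (simp add: scale_sum vec.scale_scale)
    also have "\<dots> = (\<Sum>h\<in>UNIV. \<Sum>g\<in>UNIV. \<Sum>k\<in>UNIV. (a $ g * of_bool (m h k = g)) *s (E h \<otimes> E k))"
      by (rule sum.swap)
    also have "\<dots> = (\<Sum>h\<in>UNIV. \<Sum>k\<in>UNIV. \<Sum>g\<in>UNIV. (a $ g * of_bool (m h k = g)) *s (E h \<otimes> E k))"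
      by (rule sum.cong[OF refl]) (rule sum.swap)
    also have "\<dots> = (\<Sum>h\<in>UNIV. \<Sum>k\<in>UNIV. a $ m h k *s (E h \<otimes> E k))"
    proof (intro sum.cong refl)
      fix h k
      show "(\<Sum>g\<in>UNIV. (a $ g * of_bool (m h k = g)) *s (E h \<otimes> E k)) = a $ m h k *s (E h \<otimes> E k)"
        by (subst sum_single[of "m h k"]) auto
    qed
    finally show ?thesis
      by (simp add: tmap_expand twisted_functions_def lin_comb_bv)
  qed
  have "tmap ?g ?g (bv (h, k)) = E h \<otimes> E k" for h k
    unfolding bv_tensor[symmetric] by (simp add: tmap_tensor clin lin_comb_bv)
  then show "associator K = tmap ?g (tmap ?g ?g) (associator ?L)"
    by (simp add: tmap_expand[of ?g "tmap ?g ?g"] lin_comb_bv sum_UNIV_prod assoc twisted_functions_def)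
qed

text \<open>
  The variant for an algebra that is given by the inverse of its associator. Inverses in the third tensor power are
  unique because they are so for functions; this identifies the element chosen by \<open>THE\<close>.
\<close>

lemma (in cocycle_group) quasi_iso_inverse_associator:
  fixes K :: "'n::finite quasi_hopf_data"
  assumes E: "dual_bases E D" and mK: "cbilinear (mult K)"
    and mult: "\<And>g h. mult K (E g) (E h) = of_bool (g = h) *s E g" and one: "one K = (\<Sum>g\<in>UNIV. E g)"
    and lin: "clinear_map (comult K)" "clinear_form (counit K)"
    and comult: "\<And>g. comult K (E g) = (\<Sum>h\<in>UNIV. \<Sum>k\<in>UNIV. of_bool (m h k = g) *s (E h \<otimes> E k))"
    and counit: "\<And>g. counit K (E g) = of_bool (g = e)"
    and assoc: "associator K = (THE x. inverse_in (mult3 K) (one3 K) \<Psi> x)"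
    and \<Psi>: "\<Psi> = (\<Sum>g\<in>UNIV. \<Sum>h\<in>UNIV. \<Sum>k\<in>UNIV. inverse (\<omega> g h k) *s (E g \<otimes> E h \<otimes> E k))"
  shows "quasi_iso L K (lin_comb E)"
proof -
  define \<Phi> where "\<Phi> = (\<Sum>g\<in>UNIV. \<Sum>h\<in>UNIV. \<Sum>k\<in>UNIV. \<omega> g h k *s (E g \<otimes> E h \<otimes> E k))"
  \<comment> \<open>\<open>K'\<close> has an explicit associator, and inverses in its third tensor power can be computed in \<open>L\<close>.
    It turns out to be \<open>K\<close>.\<close>
  define K' where "K' = K\<lparr>associator := \<Phi>\<rparr>"
  have iso: "quasi_iso L K' (lin_comb E)"
    by (rule quasi_iso_twisted_functions[OF E]) (simp_all add: K'_def mK mult one lin comult counit \<Phi>_def)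
  interpret transport L K' "lin_comb E"
    using iso mult_L by unfold_locales
  define \<psi> where "\<psi> = (\<chi> p. inverse (\<omega> (fst p) (fst (snd p)) (snd (snd p))))"
  have bv: "g2 (bv (h, k)) = E h \<otimes> E k" for h k
    unfolding bv_tensor[symmetric] by (simp add: tmap_tensor clin lin_comb_bv)
  have \<Psi>': "\<Psi> = g3 \<psi>"
    by (simp add: tmap_expand[of "lin_comb E" g2] bv lin_comb_bv sum_UNIV_prod \<Psi> \<psi>_def)
  have m3: "mult3 K' = mult3 K" "one K' = one K"
    by (simp_all add: K'_def mult3_def mult2_def)
  have L: "inverse_in (mult3 L) (one3 L) \<psi> t \<longleftrightarrow> t = associator L" for t
  proof -
    have "inverse a * b = 1 \<and> b * inverse a = 1 \<longleftrightarrow> b = a" if "a \<noteq> 0" for a b :: complex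
      using that by (auto simp: field_simps)
    then have "inverse (\<omega> g h k) * t $ (g, h, k) = 1 \<and> t $ (g, h, k) * inverse (\<omega> g h k) = 1 \<longleftrightarrow>
        t $ (g, h, k) = \<omega> g h k" for g h k
      using nonzero by blast
    then show ?thesis
      unfolding inverse_in_def mult3_L one_tensor_L vec_eq_iff \<psi>_def L_simps by simp metis
  qed
  have "inverse_in (mult3 K) (one3 K) \<Psi> x \<longleftrightarrow> x = \<Phi>" for x
  proof -
    define s where "s = tmap gi (tmap gi gi) x"
    have x: "x = g3 s" by (simp add: s_def g3_inverse)
    have "\<Phi> = g3 (associator L)" using associator_g by (simp add: K'_def)
    then show ?thesis
      using inverse_in_g[of \<psi> s] L[of s] unfolding \<Psi>' m3 x by (simp only: g3_inject)
  qed
  then have "associator K = \<Phi>" by (simp add: assoc)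
  then have "K' = K" by (simp add: K'_def)
  then show ?thesis using iso by simp
qed

section \<open>The dihedral group of order eight and its 3-cocycle\<close>

text \<open>
  The pair of truth values \<open>(s, t)\<close> stands for the character of \<open>\<langle>b, c\<rangle>\<close> with values \<open>sg s\<close> on \<open>b\<close> and \<open>sg t\<close> on \<open>c\<close>,
  and the third truth value of an element of \<open>d4\<close> is the exponent of \<open>w\<close>. The group of order two acts on
  characters from the right by exchanging the two values, and \<open>d4_mult\<close> is the multiplication of the semidirect
  product.
\<close>

type_synonym chr = "bool \<times> bool"
type_synonym d4 = "chr \<times> bool"

definition sg :: "bool \<Rightarrow> complex" where "sg s = (if s then - 1 else 1)"

definition chr_mult :: "chr \<Rightarrow> chr \<Rightarrow> chr" (infixl "\<odot>" 70) where
  "p \<odot> q = (fst p \<noteq> fst q, snd p \<noteq> snd q)"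

definition tw :: "bool \<Rightarrow> chr \<Rightarrow> chr" where "tw x p = (if x then prod.swap p else p)"

abbreviation chr_one :: chr where "chr_one \<equiv> (False, False)"

definition d4_mult :: "d4 \<Rightarrow> d4 \<Rightarrow> d4" where
  "d4_mult g h = (tw (snd h) (fst g) \<odot> fst h, snd g \<noteq> snd h)"

definition d4_inv :: "d4 \<Rightarrow> d4" where "d4_inv g = (tw (snd g) (fst g), snd g)"

text \<open>
  The coefficients of \<open>\<Delta>(w)\<close> in the basis \<open>e\<^sub>p w \<otimes> e\<^sub>q w\<close>: the factor \<open>1 + b c\<close> of the given formula for
  \<open>\<Delta>(w)\<close> survives on the characters with equal values on \<open>b\<close> and \<open>c\<close>, the factor \<open>1 - b c\<close> on the others.
\<close>

definition J :: "chr \<Rightarrow> chr \<Rightarrow> complex" where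
  "J p q = (if fst p = snd p then 1 else (1 + \<i>) / 2 * sg (fst q) + (1 - \<i>) / 2 * sg (snd q))"

definition d4_cocycle :: "d4 \<Rightarrow> d4 \<Rightarrow> d4 \<Rightarrow> complex" where
  "d4_cocycle g h k = (if snd k then inverse (J (fst g) (fst h)) else 1)"

lemma J_eq: "J (s, t) (s', t') = (if s = t then 1 else if s' = t' then sg s' else \<i> * sg s')"
  by (simp add: J_def sg_def complex_eq_iff)

lemma J_nonzero: "J p q \<noteq> 0"
  by (cases p; cases q) (simp add: J_eq sg_def)

lemma J_one: "J chr_one q = 1" "J p chr_one = 1"
  by (cases p; cases q, simp add: J_eq sg_def)+

lemma J_tw: "J (tw x p) q = J p q" "J (tw x p \<odot> p') q = J (p \<odot> p') q"
  by (cases p; cases p'; cases q; auto simp: J_eq tw_def chr_mult_def)+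

text \<open>
  The identity of a 2-cocycle on the character group. It is the cocycle identity of \<open>d4_cocycle\<close> at \<open>(g, h, k, l)\<close>
  for \<open>k\<close> in the group of characters and \<open>l\<close> outside.
\<close>

lemma J_cocycle: "J p q * J (p \<odot> q) r = J q r * J p (q \<odot> r)"
  by (cases p; cases q; cases r; auto simp: J_eq chr_mult_def sg_def)

text \<open>
  The cocycle identity of \<open>d4_cocycle\<close> when both \<open>k\<close> and \<open>l\<close> lie outside the group of characters, so that
  \<open>k l\<close> lies inside.
\<close>

lemma J_twisted_cocycle: "J (p \<odot> q) r = J q r * (J p (tw True q \<odot> r) * J p q)"
  by (cases p; cases q; cases r; auto simp: J_eq chr_mult_def sg_def tw_def)

interpretation d4: cocycle_group d4_mult "(chr_one, False)" d4_inv d4_cocycle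
proof
  fix g h k l :: d4
  show "d4_mult (d4_mult g h) k = d4_mult g (d4_mult h k)"
    by (auto simp: d4_mult_def chr_mult_def tw_def)
  show "d4_mult (chr_one, False) g = g" "d4_mult g (chr_one, False) = g"
    "d4_mult (d4_inv g) g = (chr_one, False)" "d4_mult g (d4_inv g) = (chr_one, False)"
    by (cases g, simp add: d4_mult_def chr_mult_def tw_def d4_inv_def)+
  show "d4_cocycle (chr_one, False) g h = 1" "d4_cocycle g (chr_one, False) h = 1"
    "d4_cocycle g h (chr_one, False) = 1" "d4_cocycle g h k \<noteq> 0"
    by (simp_all add: d4_cocycle_def J_one J_nonzero)
  \<comment> \<open>The identity is written as \<open>tw False\<close> to match \<open>d4_mult h k\<close> for \<open>snd k = False\<close>.\<close>
  have "J (fst g) (fst h) * J (fst g \<odot> fst h) (fst k) = J (fst h) (fst k) * J (fst g) (tw False (fst h) \<odot> fst k)"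
    unfolding tw_def by (simp add: J_cocycle)
  then have 1: "inverse (J (fst g) (fst h)) * inverse (J (fst g \<odot> fst h) (fst k)) =
      inverse (J (fst h) (fst k)) * inverse (J (fst g) (tw False (fst h) \<odot> fst k))"
    by (metis inverse_mult_distrib)
  have 2: "inverse (J (fst g \<odot> fst h) (fst k)) = inverse (J (fst h) (fst k)) *
      (inverse (J (fst g) (tw True (fst h) \<odot> fst k)) * inverse (J (fst g) (fst h)))"
    by (subst J_twisted_cocycle) simp
  show "d4_cocycle g h (d4_mult k l) * d4_cocycle (d4_mult g h) k l =
      d4_cocycle h k l * (d4_cocycle g (d4_mult h k) l * d4_cocycle g h k)"
    using 1 2 by (cases "snd k"; cases "snd l") (simp_all add: d4_cocycle_def d4_mult_def J_tw)
qed

text \<open>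
  The powers of this rotation run through \<open>((F, F), F)\<close>, \<open>((F, T), T)\<close>, \<open>((T, T), F)\<close>, \<open>((T, F), T)\<close>; the values of
  the cocycle are the inverses of \<open>1, \<i>, -1, -\<i>\<close>, with product \<open>-1\<close>.
\<close>

lemma d4_period:
  defines "g \<equiv> ((False, True), True)"
  shows "d4.power g 4 = (chr_one, False)" "(\<Prod>k<4. d4_cocycle g (d4.power g k) g) \<noteq> 1"
  by (simp_all add: g_def d4.power_def d4_mult_def tw_def chr_mult_def eval_nat_numeral
      d4_cocycle_def J_eq sg_def)

section \<open>A basis of the Kac algebra\<close>

lemma sum_chr: "(\<Sum>p\<in>UNIV. f p) = f (False, False) + f (False, True) + f (True, False) + f (True, True)"
  by (simp add: sum_UNIV_prod UNIV_bool add_ac)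

locale kac =
  fixes H :: "'h::finite hopf_data" and b c w :: "complex ^ 'h"
  assumes kac: "kac_algebra H b c w"
begin

abbreviation mul (infixl "\<star>" 70) where "x \<star> y \<equiv> mult H x y"
abbreviation u where "u \<equiv> one H"

lemma hopf: "hopf_algebra H" using kac by (simp add: kac_algebra_def)

lemma prebialgebra: "prebialgebra H" using hopf by (simp add: hopf_algebra_def)

lemma mult_H: "cbilinear (mult H)"
  using prebialgebra by (auto simp: prebialgebra_def unital_algebra_def cbilinear_def)

lemmas mult_simps = cbilinearD[OF mult_H] cbilinear_sum[OF mult_H]

lemma mult_lin [clin]:
  "clinear_map f \<Longrightarrow> clinear_map (\<lambda>x. f x \<star> y)" "clinear_map f \<Longrightarrow> clinear_map (\<lambda>x. y \<star> f x)"
  by (rule clin_bilinear[OF mult_H]; assumption)+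

lemma mult_assoc: "x \<star> y \<star> z = x \<star> (y \<star> z)" and mult_one: "u \<star> x = x" "x \<star> u = x"
  using prebialgebra by (auto simp: prebialgebra_def unital_algebra_def)

lemma comult_lin: "clinear_map (comult H)" and counit_lin: "clinear_form (counit H)"
  and comult_one: "comult H u = u \<otimes> u" and counit_one: "counit H u = 1"
  and comult_mult: "comult H (x \<star> y) = mult2 H (comult H x) (comult H y)"
  and counit_mult: "counit H (x \<star> y) = counit H x * counit H y"
  using prebialgebra by (auto simp: prebialgebra_def)

lemmas comult_simps = clinear_map_add[OF comult_lin] clinear_map_scale[OF comult_lin] clinear_map_sum[OF comult_lin]
lemmas counit_simps = clinear_form_add[OF counit_lin] clinear_form_scale[OF counit_lin] clinear_form_sum[OF counit_lin]

lemma comult_clin [clin]: "clinear_map f \<Longrightarrow> clinear_map (\<lambda>x. comult H (f x))"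
  by (rule clin_compose[OF comult_lin])

lemma mult2_tensor: "mult2 H (x \<otimes> y) (x' \<otimes> y') = (x \<star> x') \<otimes> (y \<star> y')"
  unfolding mult2_def by (rule tmult_tensor[OF mult_H mult_H])

lemma mult2_H: "cbilinear (mult2 H)"
  unfolding mult2_def by (rule cbilinear_tmult)

lemmas mult2_simps = cbilinearD[OF mult2_H] cbilinear_sum[OF mult2_H]

lemma relations: "b \<star> b = u" "c \<star> c = u" "w \<star> w = u" "c \<star> b = b \<star> c" "w \<star> b = c \<star> w" "w \<star> c = b \<star> w"
  using kac by (auto simp: kac_algebra_def)

lemma relations':
  "b \<star> (b \<star> x) = x" "c \<star> (c \<star> x) = x" "w \<star> (w \<star> x) = x" "c \<star> (b \<star> x) = b \<star> (c \<star> x)"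
  "w \<star> (b \<star> x) = c \<star> (w \<star> x)" "w \<star> (c \<star> x) = b \<star> (w \<star> x)"
  by (simp_all only: mult_assoc[symmetric] relations mult_one)

text \<open>
  The primitive idempotent of \<open>\<complex>\<langle>b, c\<rangle>\<close> on which the group acts through the character \<open>p\<close>.
\<close>

definition ep :: "chr \<Rightarrow> complex ^ 'h" where
  "ep p = (1 / 4) *s (u + sg (fst p) *s b + sg (snd p) *s c + (sg (fst p) * sg (snd p)) *s (b \<star> c))"

definition W :: "bool \<Rightarrow> complex ^ 'h" where "W x = (if x then w else u)"

definition hb :: "d4 \<Rightarrow> complex ^ 'h" where "hb g = ep (fst g) \<star> W (snd g)"

lemma b_ep: "b \<star> ep p = sg (fst p) *s ep p" and c_ep: "c \<star> ep p = sg (snd p) *s ep p"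
  by (cases "fst p"; cases "snd p"; simp add: ep_def mult_simps relations relations' mult_one sg_def vec_eq_iff algebra_simps)+

lemma w_ep: "w \<star> ep p = ep (prod.swap p) \<star> w"
  by (simp add: ep_def mult_simps relations relations' mult_one mult_assoc vec_eq_iff algebra_simps)

text \<open>
  By \<open>b_ep\<close> and \<open>c_ep\<close>, the product is \<open>e\<^sub>q\<close> times the inner product of the characters \<open>p\<close> and \<open>q\<close>.
\<close>

lemma ep_ep: "ep p \<star> ep q = of_bool (p = q) *s ep p"
proof -
  have "ep p \<star> ep q = (1 / 4) *s (ep q + sg (fst p) *s (b \<star> ep q) + sg (snd p) *s (c \<star> ep q) +
      (sg (fst p) * sg (snd p)) *s (b \<star> (c \<star> ep q)))"
    by (subst (1) ep_def) (simp add: mult_simps mult_one mult_assoc)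
  also have "\<dots> = ((1 + sg (fst p) * sg (fst q) + sg (snd p) * sg (snd q) +
      sg (fst p) * sg (snd p) * (sg (fst q) * sg (snd q))) / 4) *s ep q"
    by (simp add: b_ep c_ep mult_simps vec_eq_iff algebra_simps)
  finally show ?thesis
    by (cases p; cases q) (auto simp: sg_def)
qed

lemma ep_sums:
  "(\<Sum>p\<in>UNIV. ep p) = u" "(\<Sum>p\<in>UNIV. sg (fst p) *s ep p) = b" "(\<Sum>p\<in>UNIV. sg (snd p) *s ep p) = c"
  by (simp_all add: sum_chr ep_def sg_def vec_eq_iff algebra_simps)

lemma W_ep: "W x \<star> ep p = ep (tw x p) \<star> W x"
  by (simp add: W_def tw_def w_ep mult_one)

lemma W_W: "W x \<star> W y = W (x \<noteq> y)"
  by (simp add: W_def mult_one relations)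

lemma ep_hb: "ep p \<star> hb g = of_bool (p = fst g) *s hb g"
  by (cases "p = fst g") (simp_all add: hb_def mult_assoc[symmetric] ep_ep mult_simps)

lemma hb_mult: "hb g \<star> hb h = of_bool (fst g = tw (snd g) (fst h)) *s hb (fst g, snd g \<noteq> snd h)"
proof -
  have "hb g \<star> hb h = ep (fst g) \<star> (W (snd g) \<star> ep (fst h)) \<star> W (snd h)"
    by (simp add: hb_def mult_assoc)
  also have "\<dots> = (ep (fst g) \<star> ep (tw (snd g) (fst h))) \<star> (W (snd g) \<star> W (snd h))"
    by (simp add: W_ep mult_assoc)
  finally show ?thesis by (simp add: ep_ep W_W mult_simps hb_def)
qed

lemma W_expansion: "W x = (\<Sum>p\<in>UNIV. hb (p, x))"
  by (simp add: hb_def mult_simps(9)[symmetric] ep_sums mult_one)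

lemma counit_ep: "counit H (ep p) = of_bool (p = chr_one)"
proof -
  have "counit H b = 1" "counit H c = 1" using kac by (auto simp: kac_algebra_def group_like_def)
  then show ?thesis
    by (cases p) (auto simp: ep_def counit_simps counit_mult counit_one sg_def)
qed

lemma counit_W: "counit H (W x) = 1"
  using kac by (simp add: W_def counit_one kac_algebra_def)

lemma counit_hb: "counit H (hb g) = of_bool (fst g = chr_one)"
  by (simp add: hb_def counit_mult counit_ep counit_W)

text \<open>
  The coalgebra spanned by the group-like elements \<open>1, b, c, b c\<close> is the dual of the group algebra of the
  characters.
\<close>

lemma comult_ep: "comult H (ep p) = (\<Sum>q\<in>UNIV. \<Sum>r\<in>UNIV. of_bool (q \<odot> r = p) *s (ep q \<otimes> ep r))"
proof -
  have bc: "comult H b = b \<otimes> b" "comult H c = c \<otimes> c"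
    using kac by (auto simp: kac_algebra_def group_like_def)
  have "comult H (ep p) = (1 / 4) *s (u \<otimes> u + sg (fst p) *s (b \<otimes> b) + sg (snd p) *s (c \<otimes> c) +
      (sg (fst p) * sg (snd p)) *s ((b \<star> c) \<otimes> (b \<star> c)))"
    by (simp add: ep_def comult_simps comult_mult comult_one bc mult2_tensor)
  also have "\<dots> = (\<Sum>q\<in>UNIV. \<Sum>r\<in>UNIV. of_bool (q \<odot> r = p) *s (ep q \<otimes> ep r))"
    by (cases p; cases "fst p"; cases "snd p")
      (simp_all add: sum_chr chr_mult_def ep_def sg_def vec_eq_iff field_simps)
  finally show ?thesis .
qed

lemma comult_w: "comult H w = (\<Sum>q\<in>UNIV. \<Sum>r\<in>UNIV. J q r *s (hb (q, True) \<otimes> hb (r, True)))"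
proof -
  have "(1 / 2) *s (u + b \<star> c) \<otimes> u + ((1 + \<i>) / 4) *s (u - b \<star> c) \<otimes> b + ((1 - \<i>) / 4) *s (u - b \<star> c) \<otimes> c =
      (\<Sum>q\<in>UNIV. \<Sum>r\<in>UNIV. J q r *s (ep q \<otimes> ep r))"
    by (simp add: sum_chr J_def ep_def sg_def vec_eq_iff field_simps)
  then have "comult H w = mult2 H (\<Sum>q\<in>UNIV. \<Sum>r\<in>UNIV. J q r *s (ep q \<otimes> ep r)) (w \<otimes> w)"
    using kac by (simp add: kac_algebra_def)
  then show ?thesis
    by (simp add: mult2_simps mult2_tensor hb_def W_def)
qed

lemma comult_W:
  "comult H (W x) = (\<Sum>q\<in>UNIV. \<Sum>r\<in>UNIV. (if x then J q r else 1) *s (hb (q, x) \<otimes> hb (r, x)))"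
proof (cases x)
  case False
  have "comult H u = (\<Sum>q\<in>UNIV. hb (q, False)) \<otimes> (\<Sum>r\<in>UNIV. hb (r, False))"
    unfolding W_expansion[symmetric] by (simp add: W_def comult_one)
  also have "\<dots> = (\<Sum>r\<in>UNIV. \<Sum>q\<in>UNIV. hb (q, False) \<otimes> hb (r, False))"
    by (simp add: tensor_sum)
  also have "\<dots> = (\<Sum>q\<in>UNIV. \<Sum>r\<in>UNIV. hb (q, False) \<otimes> hb (r, False))"
    by (rule sum.swap)
  finally show ?thesis using False by (simp add: W_def)
qed (simp add: W_def comult_w)

lemma comult_hb:
  "comult H (hb (p, x)) = (\<Sum>q\<in>UNIV. \<Sum>r\<in>UNIV. (of_bool (q \<odot> r = p) * (if x then J q r else 1)) *s
      (hb (q, x) \<otimes> hb (r, x)))"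
proof -
  have "mult2 H (ep q \<otimes> ep r) (comult H (W x)) = (if x then J q r else 1) *s (hb (q, x) \<otimes> hb (r, x))" for q r
  proof -
    have "mult2 H (ep q \<otimes> ep r) (comult H (W x)) = (\<Sum>q'\<in>UNIV. \<Sum>r'\<in>UNIV. (if x then J q' r' else 1) *s
        ((ep q \<star> hb (q', x)) \<otimes> (ep r \<star> hb (r', x))))"
      by (simp add: comult_W mult2_simps mult2_tensor)
    also have "\<dots> = (if x then J q r else 1) *s (hb (q, x) \<otimes> hb (r, x))"
      by (subst sum2_single[of q r]) (auto simp: ep_hb tensor_linear)
    finally show ?thesis .
  qed
  then show ?thesis
    unfolding hb_def[of "(p, x)"]
    by (simp add: comult_mult comult_ep mult2_simps vec.scale_scale)
qed

text \<open>
  The span is closed under multiplication by \<open>hb_mult\<close> and contains the generators.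
\<close>

lemma span_hb: "vec.span (range hb) = UNIV"
proof -
  let ?A = "vec.span (range hb)"
  have hb: "hb g \<in> ?A" for g by (rule vec.span_base) simp
  have W: "W x \<in> ?A" for x unfolding W_expansion by (intro vec.span_sum hb)
  have ep: "ep p \<in> ?A" for p using hb[of "(p, False)"] by (simp add: hb_def W_def mult_one)
  have 1: "x \<star> hb g \<in> ?A" if "x \<in> ?A" for x g
    using that
  proof (rule vec.span_induct)
    show "vec.subspace {x. x \<star> hb g \<in> ?A}"
      unfolding vec.subspace_def by (simp add: mult_simps vec.span_zero vec.span_add vec.span_scale)
  qed (auto simp: hb_mult vec.span_zero intro!: vec.span_scale hb)
  have 2: "x \<star> y \<in> ?A" if "x \<in> ?A" "y \<in> ?A" for x y
    using that(2)
  proof (rule vec.span_induct)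
    show "vec.subspace {y. x \<star> y \<in> ?A}"
      unfolding vec.subspace_def by (simp add: mult_simps vec.span_zero vec.span_add vec.span_scale)
  qed (auto intro: 1 that(1))
  have "{b, c, w} \<subseteq> ?A"
    using W[of True] ep_sums(2,3)
    by (auto simp: W_def) (metis (no_types, lifting) vec.span_sum vec.span_scale ep)+
  moreover have "u \<in> ?A" using W[of False] by (simp add: W_def)
  ultimately have "subalgebra_generated H {b, c, w} \<subseteq> ?A"
    unfolding subalgebra_generated_def by (intro Inter_lower) (simp add: 2 vec.subspace_span)
  then show ?thesis using kac by (auto simp: kac_algebra_def)
qed

definition hdual :: "d4 \<Rightarrow> complex ^ 'h" where "hdual = (SOME d. dual_bases hb d)"

lemma dual_bases_H: "dual_bases hb hdual"
proof -
  have "CARD(d4) = CARD('h)" using kac by (simp add: kac_algebra_def)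
  from dual_bases_of_spanning[OF this span_hb] show ?thesis
    unfolding hdual_def by (rule someI_ex)
qed

lemma hdual_hb: "pair (hdual g) (hb h) = of_bool (g = h)"
  by (rule dual_bases_pair[OF dual_bases_H])

end

locale kac_system = kac H b c w for H :: "'h::finite hopf_data" and b c w +
  fixes \<iota> :: "complex ^ 'b::finite \<Rightarrow> complex ^ 'h"
    and \<pi> :: "complex ^ 'h \<Rightarrow> complex ^ 'c::finite"
    and \<zeta> :: "complex ^ 'h \<Rightarrow> complex ^ 'b"
    and \<gamma> :: "complex ^ 'c \<Rightarrow> complex ^ 'h"
  assumes iota: "clinear_map \<iota>" "inj \<iota>" "range \<iota> = vec.span {one H, b, c, mult H b c}"
    and pi: "quotient_projection H \<iota> \<pi>"
    and zeta: "clinear_map \<zeta>" "\<And>x h. \<zeta> (mult H (\<iota> x) h) = sub_mult H \<iota> x (\<zeta> h)"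
      "\<zeta> w = sub_one H \<iota>" "\<And>x. \<zeta> (\<iota> x) = x"
    and gamma: "clinear_map \<gamma>" "\<gamma> (\<pi> (one H)) = one H" "\<gamma> (\<pi> w) = w"
begin

section \<open>The subalgebra spanned by the idempotents\<close>

lemma pi_lin: "clinear_map \<pi>" and pi_surj: "surj \<pi>"
  and pi_kernel: "{h. \<pi> h = 0} = vec.span {mult H (\<iota> x) h | x h. counit H (\<iota> x) = 0}"
  using pi by (simp_all add: quotient_projection_def)

lemma maps_clin [clin]:
  "clinear_map f1 \<Longrightarrow> clinear_map (\<lambda>x. \<iota> (f1 x))"
  "clinear_map f2 \<Longrightarrow> clinear_map (\<lambda>x. \<pi> (f2 x))"
  "clinear_map f3 \<Longrightarrow> clinear_map (\<lambda>x. \<zeta> (f3 x))"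
  "clinear_map f4 \<Longrightarrow> clinear_map (\<lambda>x. \<gamma> (f4 x))"
  by (rule clin_compose[OF iota(1)] clin_compose[OF pi_lin] clin_compose[OF zeta(1)] clin_compose[OF gamma(1)]; assumption)+

lemma maps_lin [clin]: "clinear_map \<iota>" "clinear_map \<pi>" "clinear_map \<zeta>" "clinear_map \<gamma>"
  by (rule iota pi_lin zeta gamma)+

lemmas iota_simps = clinear_map_add[OF iota(1)] clinear_map_scale[OF iota(1)] clinear_map_sum[OF iota(1)]
lemmas pi_simps = clinear_map_add[OF pi_lin] clinear_map_scale[OF pi_lin] clinear_map_sum[OF pi_lin] clinear_map_zero[OF pi_lin]
lemmas zeta_simps = clinear_map_add[OF zeta(1)] clinear_map_scale[OF zeta(1)] clinear_map_sum[OF zeta(1)]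
lemmas gamma_simps = clinear_map_add[OF gamma(1)] clinear_map_scale[OF gamma(1)] clinear_map_sum[OF gamma(1)]

lemma ep_hb_False: "ep p = hb (p, False)"
  by (simp add: hb_def W_def mult_one)

lemma iota_inv: "z \<in> range \<iota> \<Longrightarrow> \<iota> (inv \<iota> z) = z"
  by (rule f_inv_into_f)

lemma inv_iota [simp]: "inv \<iota> (\<iota> y) = y"
  using iota(2) by simp

lemma ep_range: "ep p \<in> range \<iota>"
  unfolding iota(3) ep_def
  by (intro vec.span_scale vec.span_add vec.span_base) auto

definition eb :: "chr \<Rightarrow> complex ^ 'b" where "eb p = inv \<iota> (ep p)"
definition ebd :: "chr \<Rightarrow> complex ^ 'b" where "ebd p = transp \<iota> (hdual (p, False))"

lemma iota_eb: "\<iota> (eb p) = ep p"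
  unfolding eb_def by (rule iota_inv[OF ep_range])

lemma pair_ebd: "pair (ebd p) y = pair (hdual (p, False)) (\<iota> y)"
  unfolding ebd_def by (rule pair_transp[OF iota(1)])

text \<open>
  The group elements \<open>1, b, c, b c\<close> are combinations of the idempotents, with the values of the characters as
  coefficients.
\<close>

lemma iota_eq_ep_sum: "\<exists>f. \<iota> y = (\<Sum>p\<in>UNIV. f p *s ep p)"
proof -
  have "\<iota> y \<in> vec.span {u, b, c, b \<star> c}" unfolding iota(3)[symmetric] by simp
  then show ?thesis
  proof (rule vec.span_induct)
    show "vec.subspace {z. \<exists>f. z = (\<Sum>p\<in>UNIV. f p *s ep p)}"
      unfolding vec.subspace_def
    proof (safe, goal_cases)
      case 1
      show ?case by (rule exI[of _ "\<lambda>_. 0"]) simp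
    next
      case (2 _ _ f g)
      show ?case by (rule exI[of _ "\<lambda>p. f p + g p"]) (simp add: vec.scale_left_distrib sum.distrib)
    next
      case (3 a _ f)
      show ?case by (rule exI[of _ "\<lambda>p. a * f p"]) (simp add: scale_sum vec.scale_scale)
    qed
    have bc: "(\<Sum>p\<in>UNIV. (sg (snd p) * sg (fst p)) *s ep p) = b \<star> c"
      by (subst (2) ep_sums(3)[symmetric]) (simp add: mult_simps b_ep vec.scale_scale)
    fix z assume "z \<in> {u, b, c, b \<star> c}"
    then consider "z = u" | "z = b" | "z = c" | "z = b \<star> c" by blast
    then show "\<exists>f. z = (\<Sum>p\<in>UNIV. f p *s ep p)"
    proof cases
      case 1 show ?thesis unfolding 1 ep_sums(1)[symmetric] by (rule exI[of _ "\<lambda>_. 1"]) simp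
    next
      case 2 show ?thesis unfolding 2 by (rule exI, rule ep_sums(2)[symmetric])
    next
      case 3 show ?thesis unfolding 3 by (rule exI, rule ep_sums(3)[symmetric])
    next
      case 4 show ?thesis unfolding 4 by (rule exI, rule bc[symmetric])
    qed
  qed
qed

lemma iota_expansion: "\<iota> y = (\<Sum>p\<in>UNIV. pair (ebd p) y *s ep p)"
proof -
  obtain f where f: "\<iota> y = (\<Sum>p\<in>UNIV. f p *s ep p)" using iota_eq_ep_sum by blast
  have "pair (ebd q) y = f q" for q
    unfolding pair_ebd f pair_sum pair_linear ep_hb_False hdual_hb by (subst sum_single[of q]) auto
  then show ?thesis using f by simp
qed

lemma dual_bases_B: "dual_bases eb ebd"
  unfolding dual_bases_def
proof (intro conjI allI)
  show "pair (ebd p) (eb q) = of_bool (p = q)" for p q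
    by (simp add: pair_ebd iota_eb ep_hb_False hdual_hb)
  show "y = (\<Sum>p\<in>UNIV. pair (ebd p) y *s eb p)" for y
  proof (rule injD[OF iota(2)])
    show "\<iota> y = \<iota> (\<Sum>p\<in>UNIV. pair (ebd p) y *s eb p)"
      by (subst iota_expansion) (simp add: iota_simps iota_eb)
  qed
qed

lemma ebd_eb: "pair (ebd p) (eb q) = of_bool (p = q)"
  by (rule dual_bases_pair[OF dual_bases_B])

lemma iota_sub_mult: "\<iota> (sub_mult H \<iota> x y) = \<iota> x \<star> \<iota> y"
proof -
  have "\<iota> x \<star> \<iota> y \<in> range \<iota>"
    unfolding iota_expansion[of x] iota_expansion[of y] mult_simps ep_ep iota(3)
    by (intro vec.span_sum vec.span_scale) (rule ep_range[unfolded iota(3)])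
  then show ?thesis unfolding sub_mult_def by (rule iota_inv)
qed

lemma iota_inject: "\<iota> x = \<iota> y \<longleftrightarrow> x = y"
  using iota(2) by (simp add: inj_eq)

lemma sub_mult_bilinear: "cbilinear (sub_mult H \<iota>)"
  by (intro cbilinearI clinear_mapI; simp add: iota_inject[symmetric] iota_sub_mult iota_simps mult_simps)

lemmas sub_mult_simps = cbilinearD[OF sub_mult_bilinear] cbilinear_sum[OF sub_mult_bilinear]

lemma sub_mult_clin [clin]:
  "clinear_map f \<Longrightarrow> clinear_map (\<lambda>x. sub_mult H \<iota> (f x) y)" "clinear_map f \<Longrightarrow> clinear_map (\<lambda>x. sub_mult H \<iota> y (f x))"
  by (rule clin_bilinear[OF sub_mult_bilinear]; assumption)+

lemma sub_mult_eb: "sub_mult H \<iota> (eb p) (eb q) = of_bool (p = q) *s eb p"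
  by (simp add: iota_inject[symmetric] iota_sub_mult iota_eb ep_ep iota_simps)

lemma iota_sub_one: "\<iota> (sub_one H \<iota>) = u"
  unfolding sub_one_def by (rule iota_inv) (simp add: iota(3) vec.span_base)

lemma sub_one_eq: "sub_one H \<iota> = (\<Sum>p\<in>UNIV. eb p)"
  by (simp add: iota_inject[symmetric] iota_sub_one iota_simps iota_eb ep_sums)

lemma sub_mult_one: "sub_mult H \<iota> x (sub_one H \<iota>) = x"
  by (simp add: iota_inject[symmetric] iota_sub_mult iota_sub_one mult_one)

text \<open>
  A closed form of \<open>sub_coact\<close>, which is defined through a choice of preimages.
\<close>

definition coact :: "complex ^ 'b \<Rightarrow> complex ^ ('h \<times> 'b)" where
  "coact y = (\<Sum>p\<in>UNIV. pair (ebd p) y *s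
     (\<Sum>q\<in>UNIV. \<Sum>r\<in>UNIV. of_bool (q \<odot> r = p) *s (hb (q, False) \<otimes> eb r)))"

lemma coact_clin [clin]: "clinear_map coact"
  unfolding coact_def[abs_def] by (intro clin)

lemma comult_iota: "comult H (\<iota> y) = tmap id \<iota> (coact y)"
proof (rule dual_bases_ext[OF dual_bases_B, of "\<lambda>y. comult H (\<iota> y)" "\<lambda>y. tmap id \<iota> (coact y)"])
  show "comult H (\<iota> (eb p)) = tmap id \<iota> (coact (eb p))" for p
  proof -
    have "coact (eb p) = (\<Sum>q\<in>UNIV. \<Sum>r\<in>UNIV. of_bool (q \<odot> r = p) *s (hb (q, False) \<otimes> eb r))"
      unfolding coact_def by (subst sum_single[of p]) (auto simp: ebd_eb)
    then show ?thesis
      by (simp add: iota_eb comult_ep clinear_map_sum[OF clin_tmap'] clinear_map_scale[OF clin_tmap']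
          tmap_tensor clin ep_hb_False[symmetric])
  qed
qed (intro clin clin_tmap; rule clin coact_clin)+

lemma tmap_iota_inj: "inj (tmap (id :: complex ^ 'h \<Rightarrow> complex ^ 'h) \<iota>)"
proof -
  have "tmap id (\<lambda>z. \<Sum>p\<in>UNIV. pair (hdual (p, False)) z *s eb p) (tmap (id :: complex ^ 'h \<Rightarrow> complex ^ 'h) \<iota> t) = t" for t
  proof -
    have "(\<Sum>p\<in>UNIV. pair (hdual (p, False)) (\<iota> y) *s eb p) = y" for y
      unfolding pair_ebd[symmetric] by (rule dual_bases_expansion[OF dual_bases_B, symmetric])
    then show ?thesis
      by (simp add: tmap_tmap clin tmap_id)
  qed
  then show ?thesis by (rule inj_on_inverseI)
qed

lemma sub_coact_eq: "sub_coact H \<iota> = coact"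
  unfolding sub_coact_def[abs_def] comult_iota using tmap_iota_inj by simp

lemma sub_coact_clin [clin]: "clinear_map f \<Longrightarrow> clinear_map (\<lambda>x. sub_coact H \<iota> (f x))"
  unfolding sub_coact_eq by (rule clin_compose[OF coact_clin])

lemma sw_sub_coact:
  assumes "cbilinear F"
  shows "sw (sub_coact H \<iota> (eb p)) F = (\<Sum>q\<in>UNIV. \<Sum>r\<in>UNIV. of_bool (q \<odot> r = p) *s F (hb (q, False)) (eb r))"
proof (rule sw_expansion[OF _ assms])
  show "sub_coact H \<iota> (eb p) = (\<Sum>q\<in>UNIV. \<Sum>r\<in>UNIV. of_bool (q \<odot> r = p) *s (hb (q, False) \<otimes> eb r))"
    unfolding sub_coact_eq coact_def by (subst sum_single[of p]) (auto simp: ebd_eb)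
qed

section \<open>The quotient coalgebra\<close>

definition pc :: "bool \<Rightarrow> complex ^ 'c" where "pc x = \<pi> (W x)"
definition pcd :: "bool \<Rightarrow> complex ^ 'c" where "pcd x = transp \<gamma> (hdual (chr_one, x))"

text \<open>
  For a non-trivial character \<open>p\<close> the idempotent \<open>e\<^sub>p\<close> lies in \<open>B\<^sup>+\<close>, so \<open>e\<^sub>p w\<^sup>x\<close> is in the kernel of \<open>\<pi>\<close>. As \<open>w\<^sup>x\<close> is
  the sum of all \<open>e\<^sub>p w\<^sup>x\<close>, its image is that of the summand for the trivial character.
\<close>

lemma pi_hb: "\<pi> (hb (p, x)) = of_bool (p = chr_one) *s pc x"
proof -
  have 0: "\<pi> (hb (p, x)) = 0" if "p \<noteq> chr_one" for p
  proof -
    have "hb (p, x) = \<iota> (eb p) \<star> W x" "counit H (\<iota> (eb p)) = 0"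
      using that by (simp_all add: hb_def iota_eb counit_ep)
    then have "hb (p, x) \<in> {h. \<pi> h = 0}"
      unfolding pi_kernel by (intro vec.span_base) blast
    then show ?thesis by simp
  qed
  have "pc x = \<pi> (hb (chr_one, x))"
    unfolding pc_def W_expansion pi_simps by (rule sum_single) (rule 0)
  then show ?thesis using 0 by simp
qed

lemma gamma_pc: "\<gamma> (pc x) = W x"
  using gamma by (simp add: pc_def W_def)

lemma pair_pcd: "pair (pcd x) y = pair (hdual (chr_one, x)) (\<gamma> y)"
  unfolding pcd_def by (rule pair_transp[OF gamma(1)])

lemma hdual_W: "pair (hdual (p, x)) (W y) = of_bool (x = y)"
  unfolding W_expansion pair_sum hdual_hb by (subst sum_single[of p]) auto

lemma pcd_pc: "pair (pcd x) (pc y) = of_bool (x = y)"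
  by (simp add: pair_pcd gamma_pc hdual_W)

lemma pi_expansion: "\<pi> h = (\<Sum>x\<in>UNIV. pair (hdual (chr_one, x)) h *s pc x)"
proof (rule dual_bases_ext[OF dual_bases_H, of \<pi> "\<lambda>h. \<Sum>x\<in>UNIV. pair (hdual (chr_one, x)) h *s pc x"])
  show "\<pi> (hb g) = (\<Sum>x\<in>UNIV. pair (hdual (chr_one, x)) (hb g) *s pc x)" for g
    unfolding hdual_hb by (cases g) (auto simp: pi_hb sum_single[of "snd g"] UNIV_bool)
qed (intro clin)+

text \<open>
  The coefficient of \<open>\<pi>(w\<^sup>x)\<close> in \<open>\<pi>(h)\<close> can be read off from any preimage \<open>h\<close>; hence the operations on the quotient
  do not depend on the preimages chosen by \<open>inv \<pi>\<close>.
\<close>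

lemma pcd_pi: "pair (pcd x) (\<pi> h) = pair (hdual (chr_one, x)) h"
  unfolding pi_expansion[of h] pair_sum pair_linear pcd_pc by (subst sum_single[of x]) auto

lemma dual_bases_C: "dual_bases pc pcd"
  unfolding dual_bases_def
proof (intro conjI allI pcd_pc)
  fix y
  obtain h where "y = \<pi> h" using pi_surj by blast
  then show "y = (\<Sum>x\<in>UNIV. pair (pcd x) y *s pc x)"
    by (simp only: pcd_pi) (rule pi_expansion)
qed

lemma pi_inv: "\<pi> (inv \<pi> y) = y"
  by (rule surj_f_inv_f[OF pi_surj])

text \<open>
  The quotient is the group algebra of the group of order two. The factor \<open>J\<close> disappears because it is \<open>1\<close> at the
  trivial character.
\<close>

lemma quot_comult_eq: "quot_comult H \<pi> y = (\<Sum>x\<in>UNIV. pair (pcd x) y *s (pc x \<otimes> pc x))"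
proof -
  have "tmap \<pi> \<pi> (comult H h) = (\<Sum>x\<in>UNIV. pair (hdual (chr_one, x)) h *s (pc x \<otimes> pc x))" for h
  proof (rule dual_bases_ext[OF dual_bases_H, of "\<lambda>h. tmap \<pi> \<pi> (comult H h)"
        "\<lambda>h. \<Sum>x\<in>UNIV. pair (hdual (chr_one, x)) h *s (pc x \<otimes> pc x)"])
    show "tmap \<pi> \<pi> (comult H (hb g)) = (\<Sum>x\<in>UNIV. pair (hdual (chr_one, x)) (hb g) *s (pc x \<otimes> pc x))" for g
    proof (cases g)
      case (Pair p y)
      have "tmap \<pi> \<pi> (comult H (hb g)) = of_bool (p = chr_one) *s (pc y \<otimes> pc y)"
        unfolding Pair comult_hb clinear_map_sum[OF clin_tmap'] clinear_map_scale[OF clin_tmap']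
          tmap_tensor[OF pi_lin pi_lin] pi_hb
        by (subst sum2_single[of chr_one chr_one]) (auto simp: J_one tensor_linear chr_mult_def)
      also have "\<dots> = (\<Sum>x\<in>UNIV. pair (hdual (chr_one, x)) (hb g) *s (pc x \<otimes> pc x))"
        unfolding hdual_hb Pair by (subst sum_single[of y]) auto
      finally show ?thesis .
    qed
  qed (intro clin comult_lin)+
  from this[of "inv \<pi> y"] show ?thesis
    by (simp add: quot_comult_def pi_inv flip: pcd_pi)
qed

lemma quot_comult_pc: "quot_comult H \<pi> (pc x) = pc x \<otimes> pc x"
  unfolding quot_comult_eq pcd_pc by (subst sum_single[of x]) auto

lemma quot_comult_lin: "clinear_map (quot_comult H \<pi>)"
  unfolding quot_comult_eq[abs_def] by (intro clin)

lemma quot_counit_eq: "quot_counit H \<pi> y = (\<Sum>x\<in>UNIV. pair (pcd x) y)"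
proof -
  have "counit H h = (\<Sum>x\<in>UNIV. pair (hdual (chr_one, x)) h)" for h
  proof -
    have "counit H h = counit H (\<Sum>g\<in>UNIV. pair (hdual g) h *s hb g)"
      by (simp only: dual_bases_expansion[OF dual_bases_H, symmetric])
    also have "\<dots> = (\<Sum>p\<in>UNIV. \<Sum>x\<in>UNIV. pair (hdual (p, x)) h * of_bool (p = chr_one))"
      by (simp add: counit_simps counit_hb sum_UNIV_prod[where f = "\<lambda>g. pair (hdual g) h * of_bool (fst g = chr_one)"])
    also have "\<dots> = (\<Sum>x\<in>UNIV. pair (hdual (chr_one, x)) h)"
      by (subst sum_single[of chr_one]) auto
    finally show ?thesis .
  qed
  from this[of "inv \<pi> y"] show ?thesis
    by (simp add: quot_counit_def pi_inv flip: pcd_pi)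
qed

lemma quot_act_bilinear: "cbilinear (quot_act H \<pi>)"
  and quot_act_pc: "quot_act H \<pi> (pc x) (hb (p, y)) = of_bool (p = chr_one) *s pc (x \<noteq> y)"
proof -
  have \<pi>_mult: "\<pi> (h \<star> v) = (\<Sum>x\<in>UNIV. pair (pcd x) (\<pi> h) *s \<pi> (W x \<star> v))" for h v
  proof (rule dual_bases_ext[OF dual_bases_H, of "\<lambda>h. \<pi> (h \<star> v)"
        "\<lambda>h. \<Sum>x\<in>UNIV. pair (pcd x) (\<pi> h) *s \<pi> (W x \<star> v)"])
    fix g :: d4
    obtain q z where g: "g = (q, z)" by (cases g)
    show "\<pi> (hb g \<star> v) = (\<Sum>x\<in>UNIV. pair (pcd x) (\<pi> (hb g)) *s \<pi> (W x \<star> v))"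
    proof (rule dual_bases_ext[OF dual_bases_H, of "\<lambda>v. \<pi> (hb g \<star> v)"
          "\<lambda>v. \<Sum>x\<in>UNIV. pair (pcd x) (\<pi> (hb g)) *s \<pi> (W x \<star> v)"])
      fix k :: d4
      obtain r y where k: "k = (r, y)" by (cases k)
      have "(\<Sum>x\<in>UNIV. pair (pcd x) (\<pi> (hb g)) *s \<pi> (W x \<star> hb k)) = of_bool (q = chr_one) *s \<pi> (W z \<star> hb k)"
        unfolding pcd_pi hdual_hb g by (subst sum_single[of z]) auto
      also have "W z \<star> hb k = hb (tw z r, z \<noteq> y)"
        unfolding W_expansion mult_simps hb_mult k by (subst sum_single[of "tw z r"]) auto
      also have "of_bool (q = chr_one) *s \<pi> (hb (tw z r, z \<noteq> y)) = \<pi> (hb g \<star> hb k)"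
        by (auto simp: g k hb_mult pi_simps pi_hb)
      finally show "\<pi> (hb g \<star> hb k) = (\<Sum>x\<in>UNIV. pair (pcd x) (\<pi> (hb g)) *s \<pi> (W x \<star> hb k))" by simp
    qed (intro clin)+
  qed (intro clin)+
  have eq: "quot_act H \<pi> y v = (\<Sum>x\<in>UNIV. pair (pcd x) y *s \<pi> (W x \<star> v))" for y v
    unfolding quot_act_def \<pi>_mult[of "inv \<pi> y"] pi_inv ..
  show "cbilinear (quot_act H \<pi>)"
    unfolding eq[abs_def] by (intro cbilinearI clin)
  have "W x \<star> hb (p, y) = hb (tw x p, x \<noteq> y)"
    unfolding W_expansion mult_simps hb_mult by (subst sum_single[of "tw x p"]) auto
  moreover have "tw x p = chr_one \<longleftrightarrow> p = chr_one" by (cases p) (auto simp: tw_def)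
  ultimately show "quot_act H \<pi> (pc x) (hb (p, y)) = of_bool (p = chr_one) *s pc (x \<noteq> y)"
    unfolding eq pcd_pc by (subst sum_single[of x]) (auto simp: pi_hb)
qed

lemma sw_transp2_quot_act:
  assumes F: "cbilinear F"
  shows "sw (transp2 (quot_act H \<pi>) (pcd x)) F = (\<Sum>z\<in>UNIV. F (pcd (x \<noteq> z)) (hdual (chr_one, z)))"
proof -
  have "sw (transp2 (quot_act H \<pi>) (pcd x)) F =
      (\<Sum>y\<in>UNIV. \<Sum>g\<in>UNIV. pair (pcd x) (quot_act H \<pi> (pc y) (hb g)) *s F (pcd y) (hdual g))"
    by (rule sw_expansion[OF transp2_expansion F]) (rule dual_bases_C dual_bases_H quot_act_bilinear)+
  also have "\<dots> = (\<Sum>g\<in>UNIV. \<Sum>y\<in>UNIV. pair (pcd x) (quot_act H \<pi> (pc y) (hb g)) *s F (pcd y) (hdual g))"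
    by (rule sum.swap)
  also have "\<dots> = (\<Sum>p\<in>UNIV. \<Sum>z\<in>UNIV. of_bool (p = chr_one) *s F (pcd (x \<noteq> z)) (hdual (p, z)))"
    unfolding sum_UNIV_prod[of "\<lambda>g. \<Sum>y\<in>UNIV. pair (pcd x) (quot_act H \<pi> (pc y) (hb g)) *s F (pcd y) (hdual g)"]
  proof (intro sum.cong refl)
    fix p z
    show "(\<Sum>y\<in>UNIV. pair (pcd x) (quot_act H \<pi> (pc y) (hb (p, z))) *s F (pcd y) (hdual (p, z))) =
        of_bool (p = chr_one) *s F (pcd (x \<noteq> z)) (hdual (p, z))"
      unfolding quot_act_pc pair_linear pcd_pc
      by (subst sum_single[of "x \<noteq> z"]) auto
  qed
  also have "\<dots> = (\<Sum>z\<in>UNIV. F (pcd (x \<noteq> z)) (hdual (chr_one, z)))"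
    by (subst sum_single[of chr_one]) auto
  finally show ?thesis .
qed

lemma zeta_W: "\<zeta> (W x) = sub_one H \<iota>"
  using zeta(3) zeta(4)[of "sub_one H \<iota>"] by (simp add: W_def iota_sub_one)

text \<open>
  Since \<open>\<zeta>\<close> is left \<open>B\<close>-linear and sends \<open>w\<close> to \<open>1\<close>.
\<close>

lemma zeta_hb: "\<zeta> (hb (p, x)) = eb p"
  using zeta(2)[of "eb p" "W x"] by (simp add: hb_def iota_eb zeta_W sub_mult_one)

section \<open>The partially admissible mapping system\<close>

lemma left_coideal: "left_coideal_subalgebra H \<iota>"
  unfolding left_coideal_subalgebra_def
proof (intro conjI allI iota(1,2))
  show "u \<in> range \<iota>" using iota_sub_one by (metis rangeI)
  show "\<iota> x \<star> \<iota> y \<in> range \<iota>" for x y using iota_sub_mult by (metis rangeI)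
  show "comult H (\<iota> x) \<in> range (tmap (id :: complex ^ 'h \<Rightarrow> complex ^ 'h) \<iota>)" for x
    unfolding comult_iota by (rule rangeI)
qed

lemma sw_comult_hb:
  assumes "cbilinear F"
  shows "sw (comult H (hb (p, x))) F =
    (\<Sum>q\<in>UNIV. \<Sum>r\<in>UNIV. (of_bool (q \<odot> r = p) * (if x then J q r else 1)) *s F (hb (q, x)) (hb (r, x)))"
  by (rule sw_expansion[OF comult_hb assms])

lemma chr_self: "q \<odot> q = chr_one"
  by (simp add: chr_mult_def)

lemma chr_mult_one: "q \<odot> chr_one = q" "chr_one \<odot> q = q"
  by (simp_all add: chr_mult_def)

text \<open>
  By \<open>sw_comult_hb\<close> and \<open>zeta_hb\<close>, the convolution product of \<open>\<zeta>\<close> with a map that sends each \<open>e\<^sub>q w\<^sup>x\<close> to a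
  multiple of \<open>e\<^sub>q\<close> has at \<open>e\<^sub>p w\<^sup>x\<close> only terms \<open>e\<^sub>q e\<^sub>q\<close>, whose characters multiply to \<open>q q = 1\<close>. The multiples
  must cancel the coefficients \<open>J(q, q)\<close> that occur for \<open>x = 1\<close>.
\<close>

lemma zeta_convolution: "convolution_invertible (comult H) (counit H) (sub_mult H \<iota>) (sub_one H \<iota>) \<zeta>"
proof -
  \<comment> \<open>\<open>z\<close> sends \<open>e\<^sub>q w\<^sup>x\<close> to \<open>e\<^sub>q\<close>, divided by \<open>J(q, q)\<close> if \<open>x = 1\<close>.\<close>
  define z where "z h = (\<Sum>g\<in>UNIV. (pair (hdual g) h * (if snd g then inverse (J (fst g) (fst g)) else 1)) *s eb (fst g))" for h
  have z_alt: "z = (\<lambda>h. \<Sum>g\<in>UNIV. (if snd g then inverse (J (fst g) (fst g)) else 1) *s (pair (hdual g) h *s eb (fst g)))"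
    unfolding z_def[abs_def] by (simp add: vec.scale_scale mult.commute)
  have lin: "clinear_map z"
    unfolding z_alt by (intro clin)
  note [clin] = clin_compose[OF lin]
  have z_hb: "z (hb (p, x)) = (if x then inverse (J p p) else 1) *s eb p" for p x
    unfolding z_def hdual_hb by (subst sum_single[of "(p, x)"]) auto
  have 1: "sw (comult H (hb (p, x))) (\<lambda>y v. sub_mult H \<iota> (\<zeta> y) (z v)) = of_bool (p = chr_one) *s sub_one H \<iota>" for p x
  proof -
    have "sw (comult H (hb (p, x))) (\<lambda>y v. sub_mult H \<iota> (\<zeta> y) (z v)) =
      (\<Sum>q\<in>UNIV. \<Sum>r\<in>UNIV. (of_bool (q \<odot> r = p) * (if x then J q r else 1)) *s sub_mult H \<iota> (\<zeta> (hb (q, x))) (z (hb (r, x))))"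
      by (intro sw_comult_hb cbilinearI clin)
    also have "\<dots> = (\<Sum>q\<in>UNIV. of_bool (p = chr_one) *s eb q)"
    proof (intro sum.cong refl)
      fix q
      show "(\<Sum>r\<in>UNIV. (of_bool (q \<odot> r = p) * (if x then J q r else 1)) *s
          sub_mult H \<iota> (\<zeta> (hb (q, x))) (z (hb (r, x)))) = of_bool (p = chr_one) *s eb q"
        unfolding zeta_hb z_hb sub_mult_simps sub_mult_eb
        by (subst sum_single[of q]) (auto simp: chr_self J_nonzero)
    qed
    finally show ?thesis by (simp add: sub_one_eq scale_sum)
  qed
  have 2: "sw (comult H (hb (p, x))) (\<lambda>y v. sub_mult H \<iota> (z y) (\<zeta> v)) = of_bool (p = chr_one) *s sub_one H \<iota>" for p x
  proof -
    have "sw (comult H (hb (p, x))) (\<lambda>y v. sub_mult H \<iota> (z y) (\<zeta> v)) =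
      (\<Sum>q\<in>UNIV. \<Sum>r\<in>UNIV. (of_bool (q \<odot> r = p) * (if x then J q r else 1)) *s sub_mult H \<iota> (z (hb (q, x))) (\<zeta> (hb (r, x))))"
      by (intro sw_comult_hb cbilinearI clin)
    also have "\<dots> = (\<Sum>q\<in>UNIV. of_bool (p = chr_one) *s eb q)"
    proof (intro sum.cong refl)
      fix q
      show "(\<Sum>r\<in>UNIV. (of_bool (q \<odot> r = p) * (if x then J q r else 1)) *s
          sub_mult H \<iota> (z (hb (q, x))) (\<zeta> (hb (r, x)))) = of_bool (p = chr_one) *s eb q"
        unfolding zeta_hb z_hb sub_mult_simps sub_mult_eb
        by (subst sum_single[of q]) (auto simp: chr_self J_nonzero)
    qed
    finally show ?thesis by (simp add: sub_one_eq scale_sum)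
  qed
  have "sw (comult H h) (\<lambda>y v. sub_mult H \<iota> (\<zeta> y) (z v)) = counit H h *s sub_one H \<iota>" for h
    by (rule dual_bases_ext[OF dual_bases_H, of "\<lambda>h. sw (comult H h) (\<lambda>y v. sub_mult H \<iota> (\<zeta> y) (z v))"
          "\<lambda>h. counit H h *s sub_one H \<iota>"])
      (intro clin comult_lin, intro clin counit_lin, simp add: 1 counit_hb split_paired_all)
  moreover have "sw (comult H h) (\<lambda>y v. sub_mult H \<iota> (z y) (\<zeta> v)) = counit H h *s sub_one H \<iota>" for h
    by (rule dual_bases_ext[OF dual_bases_H, of "\<lambda>h. sw (comult H h) (\<lambda>y v. sub_mult H \<iota> (z y) (\<zeta> v))"
          "\<lambda>h. counit H h *s sub_one H \<iota>"])
      (intro clin comult_lin, intro clin counit_lin, simp add: 2 counit_hb split_paired_all)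
  ultimately show ?thesis
    unfolding convolution_invertible_def using lin by blast
qed

text \<open>
  On the group-like basis \<open>\<pi>(w\<^sup>x)\<close> the map \<open>\<gamma>\<close> has the values \<open>w\<^sup>x\<close>, which are their own inverses. So \<open>\<gamma>\<close> is its own
  convolution inverse.
\<close>

lemma gamma_convolution: "convolution_invertible (quot_comult H \<pi>) (quot_counit H \<pi>) (mult H) u \<gamma>"
proof -
  have "sw (quot_comult H \<pi> y) (\<lambda>a v. \<gamma> a \<star> \<gamma> v) = quot_counit H \<pi> y *s u" for y
  proof -
    have "sw (quot_comult H \<pi> y) (\<lambda>a v. \<gamma> a \<star> \<gamma> v) = (\<Sum>x\<in>UNIV. pair (pcd x) y *s sw (pc x \<otimes> pc x) (\<lambda>a v. \<gamma> a \<star> \<gamma> v))"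
      by (simp add: quot_comult_eq sw_sum sw_linear)
    also have "\<dots> = (\<Sum>x\<in>UNIV. pair (pcd x) y *s (\<gamma> (pc x) \<star> \<gamma> (pc x)))"
      by (intro sum.cong refl arg_cong2[of _ _ _ _ "(*s)"] sw_tensor cbilinearI clin)
    finally show ?thesis
      by (simp add: gamma_pc W_W quot_counit_eq sum_scale) (simp add: W_def)
  qed
  then show ?thesis
    unfolding convolution_invertible_def using gamma(1) by blast
qed

lemma gamma_comodule: "tmap id \<pi> (comult H (\<gamma> y)) = tmap \<gamma> id (quot_comult H \<pi> y)"
proof (rule dual_bases_ext[OF dual_bases_C, of "\<lambda>y. tmap id \<pi> (comult H (\<gamma> y))" "\<lambda>y. tmap \<gamma> id (quot_comult H \<pi> y)"])
  fix x
  have "tmap id \<pi> (comult H (W x)) = (\<Sum>q\<in>UNIV. \<Sum>r\<in>UNIV. (if x then J q r else 1) *s (hb (q, x) \<otimes> \<pi> (hb (r, x))))"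
    unfolding comult_W clinear_map_sum[OF clin_tmap'] clinear_map_scale[OF clin_tmap']
      tmap_tensor[OF clin_basic(2) pi_lin] id_apply ..
  also have "\<dots> = (\<Sum>q\<in>UNIV. hb (q, x) \<otimes> pc x)"
  proof (intro sum.cong refl)
    fix q
    show "(\<Sum>r\<in>UNIV. (if x then J q r else 1) *s (hb (q, x) \<otimes> \<pi> (hb (r, x)))) = hb (q, x) \<otimes> pc x"
      unfolding pi_hb by (subst sum_single[of chr_one]) (auto simp: tensor_linear J_one)
  qed
  finally show "tmap id \<pi> (comult H (\<gamma> (pc x))) = tmap \<gamma> id (quot_comult H \<pi> (pc x))"
    by (simp add: gamma_pc quot_comult_pc tmap_tensor clin W_expansion tensor_sum)
qed (intro clin quot_comult_lin)+

lemma partially_admissible: "partially_admissible H \<iota> \<pi> \<zeta> \<gamma>"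
  unfolding partially_admissible_def
proof (intro conjI allI)
  show "\<zeta> (\<iota> x \<star> h) = sub_mult H \<iota> x (\<zeta> h)" for x h by (rule zeta)
  show "\<zeta> u = sub_one H \<iota>" using zeta_W[of False] by (simp add: W_def)
  show "counit H (\<iota> (\<zeta> h)) = counit H h" for h
  proof -
    have "counit H (\<iota> (\<zeta> (\<Sum>g\<in>UNIV. pair (hdual g) h *s hb g))) = counit H (\<Sum>g\<in>UNIV. pair (hdual g) h *s hb g)"
      by (simp add: zeta_simps iota_simps counit_simps sum_UNIV_prod zeta_hb iota_eb counit_ep counit_hb)
    then show ?thesis by (simp only: dual_bases_expansion[OF dual_bases_H, symmetric])
  qed
  show "\<gamma> (\<pi> u) = u" by (rule gamma)
  show "counit H (\<gamma> x) = quot_counit H \<pi> x" for x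
  proof -
    have "counit H (\<gamma> (\<Sum>y\<in>UNIV. pair (pcd y) x *s pc y)) = quot_counit H \<pi> x"
      by (simp add: gamma_simps counit_simps gamma_pc counit_W quot_counit_eq)
    then show ?thesis by (simp only: dual_bases_expansion[OF dual_bases_C, symmetric])
  qed
  show "sw (comult H h) (\<lambda>x y. \<iota> (\<zeta> x) \<star> \<gamma> (\<pi> y)) = h" for h
  proof (rule dual_bases_ext[OF dual_bases_H, of "\<lambda>h. sw (comult H h) (\<lambda>x y. \<iota> (\<zeta> x) \<star> \<gamma> (\<pi> y))" "\<lambda>h. h"])
    fix g :: d4
    obtain p x where g: "g = (p, x)" by (cases g)
    have "sw (comult H (hb (p, x))) (\<lambda>x y. \<iota> (\<zeta> x) \<star> \<gamma> (\<pi> y)) = (\<Sum>q\<in>UNIV. \<Sum>r\<in>UNIV.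
        (of_bool (q \<odot> r = p) * (if x then J q r else 1)) *s (\<iota> (\<zeta> (hb (q, x))) \<star> \<gamma> (\<pi> (hb (r, x)))))"
      by (intro sw_comult_hb cbilinearI clin)
    also have "\<dots> = ep p \<star> W x"
      unfolding zeta_hb iota_eb pi_hb
      by (subst sum2_single[of p chr_one]) (auto simp: chr_mult_one J_one gamma_pc gamma_simps mult_simps clinear_map_zero[OF gamma(1)])
    finally show "sw (comult H (hb g)) (\<lambda>x y. \<iota> (\<zeta> x) \<star> \<gamma> (\<pi> y)) = hb g"
      by (simp add: g hb_def)
  qed (intro clin comult_lin)+
qed (rule left_coideal pi zeta gamma zeta_convolution gamma_convolution gamma_comodule)+

section \<open>The left partial dual\<close>

abbreviation "K \<equiv> left_partial_dual H \<iota> \<pi> \<zeta> \<gamma>"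

definition E :: "d4 \<Rightarrow> complex ^ ('c \<times> 'b)" where "E g = pcd (snd g) \<otimes> eb (fst g)"

lemma dual_bases_E: "dual_bases E (\<lambda>g. pc (snd g) \<otimes> ebd (fst g))"
  unfolding E_def[abs_def] by (intro dual_bases_tensor dual_bases_B dual_bases_swap[OF dual_bases_C])

lemma K_simps:
  "mult K = pd_mult H \<iota> \<pi>" "one K = pd_one H \<iota> \<pi>" "comult K = pd_comult H \<iota> \<pi> \<zeta> \<gamma>" "counit K = pd_counit H \<iota> \<pi>"
  "associator K = (THE x. inverse_in (mult3 K) (one3 K) (pd_associator_inv H \<iota> \<pi> \<zeta> \<gamma>) x)"
  by (simp_all add: left_partial_dual_def Let_def mult3_def mult2_def)

lemma dual_mult_pcd: "dual_mult (quot_comult H \<pi>) (pcd x) (pcd y) = of_bool (x = y) *s pcd x"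
  by (rule dual_bases_dual_ext[OF dual_bases_C])
    (auto simp: dual_mult_def pair_transp quot_comult_lin quot_comult_pc pair_tensor pair_linear pcd_pc)

lemma pd_mult_lin: "cbilinear (pd_mult H \<iota> \<pi>)"
  unfolding pd_mult_def[abs_def] by (intro cbilinearI clin)

text \<open>
  The coaction of \<open>B\<close> on itself lies in \<open>B \<otimes> B\<close>, and \<open>B\<close> acts on the quotient through the counit. The cross product
  is therefore an ordinary tensor product of algebras.
\<close>

lemma pd_mult_E: "pd_mult H \<iota> \<pi> (E g) (E h) = of_bool (g = h) *s E g"
proof -
  obtain p x q y where g: "g = (p, x)" and h: "h = (q, y)" by (metis surj_pair)
  let ?F = "\<lambda>f1 f2 b1 b2. dual_mult (quot_comult H \<pi>) (pcd x) f1 \<otimes> (pair f2 b1 *s sub_mult H \<iota> b2 (eb q))"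
  have "pd_mult H \<iota> \<pi> (E g) (E h) = sw (E h) (\<lambda>g c.
       sw (transp2 (quot_act H \<pi>) g) (\<lambda>g1 g2. sw (sub_coact H \<iota> (eb p)) (\<lambda>b1 b2.
         dual_mult (quot_comult H \<pi>) (pcd x) g1 \<otimes> (pair g2 b1 *s sub_mult H \<iota> b2 c))))"
    unfolding pd_mult_def g E_def[of "(p, x)"] fst_conv snd_conv by (intro sw_tensor cbilinearI clin)
  also have "\<dots> = sw (transp2 (quot_act H \<pi>) (pcd y)) (\<lambda>g1 g2. sw (sub_coact H \<iota> (eb p)) (?F g1 g2))"
    unfolding h E_def[of "(q, y)"] fst_conv snd_conv by (intro sw_tensor cbilinearI clin)
  also have "\<dots> = (\<Sum>z\<in>UNIV. sw (sub_coact H \<iota> (eb p)) (?F (pcd (y \<noteq> z)) (hdual (chr_one, z))))"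
    by (intro sw_transp2_quot_act cbilinearI clin)
  also have "\<dots> = (\<Sum>z\<in>UNIV. \<Sum>r\<in>UNIV. \<Sum>r'\<in>UNIV. of_bool (r \<odot> r' = p) *s
      ?F (pcd (y \<noteq> z)) (hdual (chr_one, z)) (hb (r, False)) (eb r'))"
    by (intro sum.cong refl sw_sub_coact cbilinearI clin)
  also have "\<dots> = (\<Sum>r\<in>UNIV. \<Sum>r'\<in>UNIV. of_bool (r \<odot> r' = p) *s
      ?F (pcd y) (hdual (chr_one, False)) (hb (r, False)) (eb r'))"
    by (subst sum_single[of False]) (auto simp: hdual_hb tensor_linear)
  also have "\<dots> = ?F (pcd y) (hdual (chr_one, False)) (hb (chr_one, False)) (eb p)"
    by (subst sum2_single[of chr_one p]) (auto simp: hdual_hb tensor_linear chr_mult_one)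
  also have "\<dots> = of_bool (g = h) *s E g"
    by (auto simp: hdual_hb dual_mult_pcd sub_mult_eb g h E_def tensor_linear)
  finally show ?thesis .
qed

lemma dual_unit_eq: "dual_unit (quot_counit H \<pi>) = (\<Sum>x\<in>UNIV. pcd x)"
  by (simp add: dual_unit_def vec_eq_iff quot_counit_eq)

lemma pd_one_E: "pd_one H \<iota> \<pi> = (\<Sum>g\<in>UNIV. E g)"
  unfolding pd_one_def dual_unit_eq sub_one_eq E_def
  by (simp add: tensor_sum sum_UNIV_prod[of "\<lambda>g. pcd (snd g) \<otimes> eb (fst g)"])

lemma pd_counit_lin: "clinear_form (pd_counit H \<iota> \<pi>)"
  by (rule clinear_formI) (simp_all add: pd_counit_def sum.distrib sum_distrib_left algebra_simps)

lemma pd_counit_E: "pd_counit H \<iota> \<pi> (E g) = of_bool (g = (chr_one, False))"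
proof -
  have "pd_counit H \<iota> \<pi> (E g) = (\<Sum>k\<in>UNIV. pcd (snd g) $ k * \<pi> u $ k) * (\<Sum>i\<in>UNIV. eb (fst g) $ i * counit H (\<iota> (bv i)))"
    unfolding pd_counit_def E_def sum_product by (simp add: mult_ac)
  also have "(\<Sum>k\<in>UNIV. pcd (snd g) $ k * \<pi> u $ k) = pair (pcd (snd g)) (pc False)"
    by (simp add: pair_def pc_def W_def)
  also have "(\<Sum>i\<in>UNIV. eb (fst g) $ i * counit H (\<iota> (bv i))) = counit H (\<iota> (\<Sum>i\<in>UNIV. eb (fst g) $ i *s bv i))"
    by (simp add: iota_simps counit_simps)
  also have "\<dots> = of_bool (fst g = chr_one)"
    by (simp only: bv_expansion[symmetric] iota_eb counit_ep)
  finally show ?thesis by (cases g) (auto simp: pcd_pc)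
qed

lemma gamma_dual: "transp \<gamma> (hdual (p, x)) = pcd x"
  by (rule dual_bases_dual_ext[OF dual_bases_C]) (simp add: pair_transp gamma gamma_pc hdual_W pcd_pc)

text \<open>
  Both sides are functionals on the quotient; at \<open>\<pi>(w\<^sup>y)\<close> the left one picks the coefficient of
  \<open>e\<^sub>p w\<^sup>x \<otimes> e\<^sub>q w\<^sup>y\<close> in \<open>\<Delta>(w\<^sup>y)\<close>. This is how \<open>J\<close> enters the associator.
\<close>

lemma gamma_zeta_dual:
  "transp \<gamma> (dual_mult (comult H) (hdual (p, x)) (transp \<zeta> (ebd q))) = (if x then J p q else 1) *s pcd x"
proof (rule dual_bases_dual_ext[OF dual_bases_C])
  fix y
  have "pair (transp \<gamma> (dual_mult (comult H) (hdual (p, x)) (transp \<zeta> (ebd q)))) (pc y) =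
      pair (hdual (p, x) \<otimes> transp \<zeta> (ebd q)) (comult H (W y))"
    by (simp add: pair_transp gamma(1) gamma_pc dual_mult_def comult_lin)
  also have "\<dots> = (\<Sum>p'\<in>UNIV. \<Sum>r\<in>UNIV. (if y then J p' r else 1) * (of_bool ((p, x) = (p', y)) * of_bool (q = r)))"
    unfolding comult_W pair_sum pair_linear pair_tensor pair_transp[OF zeta(1)] zeta_hb hdual_hb ebd_eb ..
  also have "\<dots> = (if y then J p q else 1) * of_bool (x = y)"
    by (subst sum2_single[of p q]) auto
  finally show "pair (transp \<gamma> (dual_mult (comult H) (hdual (p, x)) (transp \<zeta> (ebd q)))) (pc y) =
      pair ((if x then J p q else 1) *s pcd x) (pc y)"
    by (auto simp: pair_linear pcd_pc)
qed

text \<open>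
  The double sum in the comultiplication runs over two canonical elements, which can be taken in the bases of
  idempotents and group-like elements.
\<close>

lemma pd_comult_contract:
  "(\<Sum>i\<in>UNIV. \<Sum>j\<in>UNIV. (f1 \<otimes> sub_mult H \<iota> (bv i) (\<zeta> (\<gamma> (bv j) \<star> b1))) \<otimes>
      (dual_mult (quot_comult H \<pi>) (transp \<gamma> (dual_mult (comult H) f2 (transp \<zeta> (bv i)))) (bv j) \<otimes> b2)) =
   (\<Sum>q\<in>UNIV. \<Sum>z\<in>UNIV. (f1 \<otimes> sub_mult H \<iota> (eb q) (\<zeta> (\<gamma> (pc z) \<star> b1))) \<otimes>
      (dual_mult (quot_comult H \<pi>) (transp \<gamma> (dual_mult (comult H) f2 (transp \<zeta> (ebd q)))) (pcd z) \<otimes> b2))"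
proof -
  let ?T = "\<lambda>d i e j. (f1 \<otimes> sub_mult H \<iota> i (\<zeta> (\<gamma> j \<star> b1))) \<otimes>
      (dual_mult (quot_comult H \<pi>) (transp \<gamma> (dual_mult (comult H) f2 (transp \<zeta> d))) e \<otimes> b2)"
  have "(\<Sum>j\<in>UNIV. ?T d i (bv j) (bv j)) = (\<Sum>z\<in>UNIV. ?T d i (pcd z) (pc z))" for d i
    by (rule dual_bases_contract[OF dual_bases_C]) (intro cbilinearI clin)
  moreover have "(\<Sum>k\<in>UNIV. \<Sum>z\<in>UNIV. ?T (bv k) (bv k) (pcd z) (pc z)) =
      (\<Sum>q\<in>UNIV. \<Sum>z\<in>UNIV. ?T (ebd q) (eb q) (pcd z) (pc z))"
    by (rule dual_bases_contract[OF dual_bases_B, of "\<lambda>d i. \<Sum>z\<in>UNIV. ?T d i (pcd z) (pc z)"])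
      (intro cbilinearI clin)
  ultimately show ?thesis by simp
qed

lemma pd_comult_lin: "clinear_map (pd_comult H \<iota> \<pi> \<zeta> \<gamma>)"
  unfolding pd_comult_def[abs_def] by (intro clin)

lemma tw_tw: "tw x (tw x p) = p"
  by (simp add: tw_def)

text \<open>
  The coaction splits \<open>p\<close> as \<open>q r\<close>, the action splits \<open>x\<close> as \<open>(x - y) + y\<close>, and moving \<open>w\<^sup>y\<close> past \<open>e\<^sub>q\<close> exchanges the
  values of \<open>q\<close> if \<open>y = 1\<close>. The two tensor factors obtained in this way are exactly the factorisations of
  \<open>(p, x)\<close> in the semidirect product.
\<close>

lemma pd_comult_E:
  "pd_comult H \<iota> \<pi> \<zeta> \<gamma> (E g) = (\<Sum>h\<in>UNIV. \<Sum>k\<in>UNIV. of_bool (d4_mult h k = g) *s (E h \<otimes> E k))"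
proof -
  obtain p x where g: "g = (p, x)" by (cases g)
  let ?T = "\<lambda>f1 f2 b1 b2. \<Sum>q\<in>UNIV. \<Sum>z\<in>UNIV. (f1 \<otimes> sub_mult H \<iota> (eb q) (\<zeta> (\<gamma> (pc z) \<star> b1))) \<otimes>
      (dual_mult (quot_comult H \<pi>) (transp \<gamma> (dual_mult (comult H) f2 (transp \<zeta> (ebd q)))) (pcd z) \<otimes> b2)"
  have T: "?T (pcd a) (hdual (chr_one, y)) (hb (q, False)) (eb r) = E (tw y q, a) \<otimes> E (r, y)" for a y q r
  proof -
    have W: "W z \<star> hb (q, False) = hb (tw z q, z)" for z
      unfolding W_expansion mult_simps hb_mult by (subst sum_single[of "tw z q"]) auto
    have "(pcd a \<otimes> sub_mult H \<iota> (eb q') (\<zeta> (\<gamma> (pc z) \<star> hb (q, False)))) \<otimes>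
        (dual_mult (quot_comult H \<pi>) (transp \<gamma> (dual_mult (comult H) (hdual (chr_one, y)) (transp \<zeta> (ebd q')))) (pcd z) \<otimes> eb r) =
        of_bool (z = y \<and> q' = tw y q) *s (E (tw y q, a) \<otimes> E (r, y))" for q' z
      unfolding gamma_pc W zeta_hb sub_mult_eb gamma_zeta_dual
      by (cases "z = y"; cases "q' = tw y q"; simp add: J_one dual_mult_pcd tensor_linear E_def)
    then show ?thesis
      by (simp only:) (subst sum2_single[of "tw y q" y]; auto)
  qed
  have "pd_comult H \<iota> \<pi> \<zeta> \<gamma> (E g) = sw (transp2 (quot_act H \<pi>) (pcd x)) (\<lambda>f1 f2. sw (sub_coact H \<iota> (eb p)) (?T f1 f2))"
    unfolding pd_comult_def pd_comult_contract g E_def fst_conv snd_conv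
    by (intro sw_tensor cbilinearI clin)
  also have "\<dots> = (\<Sum>y\<in>UNIV. sw (sub_coact H \<iota> (eb p)) (?T (pcd (x \<noteq> y)) (hdual (chr_one, y))))"
    by (intro sw_transp2_quot_act cbilinearI clin)
  also have "\<dots> = (\<Sum>y\<in>UNIV. \<Sum>q\<in>UNIV. \<Sum>r\<in>UNIV. of_bool (q \<odot> r = p) *s
      ?T (pcd (x \<noteq> y)) (hdual (chr_one, y)) (hb (q, False)) (eb r))"
    by (intro sum.cong refl sw_sub_coact cbilinearI clin)
  also have "\<dots> = (\<Sum>y\<in>UNIV. \<Sum>q\<in>UNIV. \<Sum>r\<in>UNIV. of_bool (q \<odot> r = p) *s (E (tw y q, x \<noteq> y) \<otimes> E (r, y)))"
    unfolding T ..
  also have "\<dots> = (\<Sum>y\<in>UNIV. \<Sum>q\<in>UNIV. \<Sum>r\<in>UNIV. of_bool (tw y q \<odot> r = p) *s (E (q, x \<noteq> y) \<otimes> E (r, y)))"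
  proof (rule sum.cong[OF refl])
    fix y
    show "(\<Sum>q\<in>UNIV. \<Sum>r\<in>UNIV. of_bool (q \<odot> r = p) *s (E (tw y q, x \<noteq> y) \<otimes> E (r, y))) =
        (\<Sum>q\<in>UNIV. \<Sum>r\<in>UNIV. of_bool (tw y q \<odot> r = p) *s (E (q, x \<noteq> y) \<otimes> E (r, y)))"
      by (rule sum.reindex_bij_witness[of _ "tw y" "tw y"]) (simp_all add: tw_tw)
  qed
  also have "\<dots> = (\<Sum>y\<in>UNIV. \<Sum>q\<in>UNIV. \<Sum>z\<in>UNIV. \<Sum>r\<in>UNIV. of_bool (d4_mult (q, z) (r, y) = g) *s (E (q, z) \<otimes> E (r, y)))"
  proof (intro sum.cong refl)
    fix y q
    have "d4_mult (q, z) (r, y) = g \<longleftrightarrow> tw y q \<odot> r = p \<and> z = (x \<noteq> y)" for z r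
      by (auto simp: d4_mult_def g)
    note mult = this
    have "(\<Sum>z\<in>UNIV. \<Sum>r\<in>UNIV. of_bool (P r \<and> z = a) *s F z r) = (\<Sum>r\<in>UNIV. of_bool (P r) *s F a r)"
      for P :: "chr \<Rightarrow> bool" and a :: bool and F :: "bool \<Rightarrow> chr \<Rightarrow> complex ^ (('c \<times> 'b) \<times> ('c \<times> 'b))"
      by (subst sum_single[of a]) auto
    note single = this
    show "(\<Sum>r\<in>UNIV. of_bool (tw y q \<odot> r = p) *s (E (q, x \<noteq> y) \<otimes> E (r, y))) =
        (\<Sum>z\<in>UNIV. \<Sum>r\<in>UNIV. of_bool (d4_mult (q, z) (r, y) = g) *s (E (q, z) \<otimes> E (r, y)))"
      unfolding mult single ..
  qed
  also have "\<dots> = (\<Sum>q\<in>UNIV. \<Sum>z\<in>UNIV. \<Sum>y\<in>UNIV. \<Sum>r\<in>UNIV. of_bool (d4_mult (q, z) (r, y) = g) *s (E (q, z) \<otimes> E (r, y)))"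
    by (subst sum.swap, rule sum.cong[OF refl], rule sum.swap)
  also have "\<dots> = (\<Sum>q\<in>UNIV. \<Sum>z\<in>UNIV. \<Sum>r\<in>UNIV. \<Sum>y\<in>UNIV. of_bool (d4_mult (q, z) (r, y) = g) *s (E (q, z) \<otimes> E (r, y)))"
    by (rule sum.cong[OF refl], rule sum.cong[OF refl], rule sum.swap)
  also have "\<dots> = (\<Sum>h\<in>UNIV. \<Sum>k\<in>UNIV. of_bool (d4_mult h k = g) *s (E h \<otimes> E k))"
    by (simp only: sum_UNIV_prod)
  finally show ?thesis .
qed

lemma sw_transp2_mult:
  assumes F: "cbilinear F"
  shows "sw (transp2 (mult H) (transp \<zeta> (ebd p))) F =
    (\<Sum>x\<in>UNIV. \<Sum>y\<in>UNIV. F (hdual (p, x)) (hdual (tw x p, y)))"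
proof -
  have "sw (transp2 (mult H) (transp \<zeta> (ebd p))) F =
      (\<Sum>g\<in>UNIV. \<Sum>k\<in>UNIV. pair (transp \<zeta> (ebd p)) (hb g \<star> hb k) *s F (hdual g) (hdual k))"
    by (rule sw_expansion[OF transp2_expansion F]) (rule dual_bases_H mult_H)+
  also have "\<dots> = (\<Sum>q\<in>UNIV. \<Sum>x\<in>UNIV. \<Sum>r\<in>UNIV. \<Sum>y\<in>UNIV.
      (of_bool (q = tw x r) * of_bool (p = q)) *s F (hdual (q, x)) (hdual (r, y)))"
    by (simp only: sum_UNIV_prod hb_mult pair_linear pair_transp[OF zeta(1)] zeta_hb ebd_eb fst_conv snd_conv)
  also have "\<dots> = (\<Sum>x\<in>UNIV. \<Sum>r\<in>UNIV. \<Sum>y\<in>UNIV. of_bool (p = tw x r) *s F (hdual (p, x)) (hdual (r, y)))"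
    by (subst sum_single[of p]) auto
  also have "\<dots> = (\<Sum>x\<in>UNIV. \<Sum>y\<in>UNIV. F (hdual (p, x)) (hdual (tw x p, y)))"
  proof (intro sum.cong refl)
    fix x
    show "(\<Sum>r\<in>UNIV. \<Sum>y\<in>UNIV. of_bool (p = tw x r) *s F (hdual (p, x)) (hdual (r, y))) =
        (\<Sum>y\<in>UNIV. F (hdual (p, x)) (hdual (tw x p, y)))"
      by (subst sum_single[of "tw x p"]) (auto simp: tw_tw)
  qed
  finally show ?thesis .
qed

lemma tensor3_sums:
  "(\<Sum>i\<in>UNIV. A i) \<otimes> B \<otimes> (\<Sum>j\<in>UNIV. C j) = (\<Sum>i\<in>UNIV. \<Sum>j\<in>UNIV. A i \<otimes> B \<otimes> C j)"
  unfolding tensor_sum(1) by (simp only: tensor_sum(2))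

text \<open>
  The inner sums over dual bases are canonical elements, so they can be evaluated in the adapted bases. The entry
  of the result at \<open>E(p, x') \<otimes> E(r, x) \<otimes> E(q, y)\<close> comes from \<open>gamma_zeta_dual\<close>; the exchange by \<open>w\<^sup>x\<close> of the values of \<open>p\<close>
  does not affect it, by \<open>J_tw\<close>.
\<close>

lemma pd_associator_inv_E:
  "pd_associator_inv H \<iota> \<pi> \<zeta> \<gamma> =
    (\<Sum>g\<in>UNIV. \<Sum>h\<in>UNIV. \<Sum>k\<in>UNIV. inverse (d4_cocycle g h k) *s (E g \<otimes> E h \<otimes> E k))"
proof -
  let ?e = "dual_unit (quot_counit H \<pi>)" and ?one = "sub_one H \<iota>"
  let ?T = "\<lambda>d i d' i' f f'. (?e \<otimes> i) \<otimes> (transp \<gamma> f \<otimes> i') \<otimes>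
        (transp \<gamma> (dual_mult (comult H) f' (transp \<zeta> d')) \<otimes> ?one)"
  let ?S = "\<lambda>d i d' i'. sw (transp2 (mult H) (transp \<zeta> d)) (?T d i d' i')"
  let ?c = "\<lambda>p r y. if y then J p r else 1"
  have "pd_associator_inv H \<iota> \<pi> \<zeta> \<gamma> = (\<Sum>k\<in>UNIV. \<Sum>l\<in>UNIV. ?S (bv k) (bv k) (bv l) (bv l))"
    by (simp add: pd_associator_inv_def)
  also have "\<dots> = (\<Sum>k\<in>UNIV. \<Sum>r\<in>UNIV. ?S (bv k) (bv k) (ebd r) (eb r))"
  proof (rule sum.cong[OF refl])
    fix k
    show "(\<Sum>l\<in>UNIV. ?S (bv k) (bv k) (bv l) (bv l)) = (\<Sum>r\<in>UNIV. ?S (bv k) (bv k) (ebd r) (eb r))"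
      by (rule dual_bases_contract[OF dual_bases_B, of "?S (bv k) (bv k)"]) (intro cbilinearI clin)
  qed
  also have "\<dots> = (\<Sum>p\<in>UNIV. \<Sum>r\<in>UNIV. ?S (ebd p) (eb p) (ebd r) (eb r))"
    by (rule dual_bases_contract[OF dual_bases_B, of "\<lambda>d i. \<Sum>r\<in>UNIV. ?S d i (ebd r) (eb r)"]) (intro cbilinearI clin)
  also have "\<dots> = (\<Sum>p\<in>UNIV. \<Sum>r\<in>UNIV. \<Sum>x\<in>UNIV. \<Sum>y\<in>UNIV.
      ?T (ebd p) (eb p) (ebd r) (eb r) (hdual (p, x)) (hdual (tw x p, y)))"
    by (intro sum.cong refl sw_transp2_mult cbilinearI clin)
  also have "\<dots> = (\<Sum>p\<in>UNIV. \<Sum>r\<in>UNIV. \<Sum>x\<in>UNIV. \<Sum>y\<in>UNIV. \<Sum>x'\<in>UNIV. \<Sum>q\<in>UNIV.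
      ?c p r y *s (E (p, x') \<otimes> E (r, x) \<otimes> E (q, y)))"
  proof (intro sum.cong refl)
    fix p r x y
    have "?e \<otimes> eb p = (\<Sum>x'\<in>UNIV. E (p, x'))"
      by (simp add: dual_unit_eq tensor_sum E_def)
    moreover have "(?c p r y *s pcd y) \<otimes> ?one = (\<Sum>q\<in>UNIV. ?c p r y *s E (q, y))"
      by (simp only: sub_one_eq tensor_sum E_def tensor_linear fst_conv snd_conv)
    ultimately show "?T (ebd p) (eb p) (ebd r) (eb r) (hdual (p, x)) (hdual (tw x p, y)) =
        (\<Sum>x'\<in>UNIV. \<Sum>q\<in>UNIV. ?c p r y *s (E (p, x') \<otimes> E (r, x) \<otimes> E (q, y)))"
      by (simp only: gamma_dual gamma_zeta_dual J_tw tensor3_sums tensor_linear)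
        (simp add: E_def tensor3_sums tensor_linear)
  qed
  also have "\<dots> = (\<Sum>p\<in>UNIV. \<Sum>x'\<in>UNIV. \<Sum>r\<in>UNIV. \<Sum>x\<in>UNIV. \<Sum>q\<in>UNIV. \<Sum>y\<in>UNIV.
      ?c p r y *s (E (p, x') \<otimes> E (r, x) \<otimes> E (q, y)))"
  proof (rule sum.cong[OF refl])
    fix p
    let ?t = "\<lambda>r x y x' q. ?c p r y *s (E (p, x') \<otimes> E (r, x) \<otimes> E (q, y))"
    have "(\<Sum>r\<in>UNIV. \<Sum>x\<in>UNIV. \<Sum>y\<in>UNIV. \<Sum>x'\<in>UNIV. \<Sum>q\<in>UNIV. ?t r x y x' q) =
        (\<Sum>r\<in>UNIV. \<Sum>x\<in>UNIV. \<Sum>x'\<in>UNIV. \<Sum>y\<in>UNIV. \<Sum>q\<in>UNIV. ?t r x y x' q)"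
      by (rule sum.cong[OF refl], rule sum.cong[OF refl], rule sum.swap)
    also have "\<dots> = (\<Sum>r\<in>UNIV. \<Sum>x'\<in>UNIV. \<Sum>x\<in>UNIV. \<Sum>y\<in>UNIV. \<Sum>q\<in>UNIV. ?t r x y x' q)"
      by (rule sum.cong[OF refl], rule sum.swap)
    also have "\<dots> = (\<Sum>x'\<in>UNIV. \<Sum>r\<in>UNIV. \<Sum>x\<in>UNIV. \<Sum>y\<in>UNIV. \<Sum>q\<in>UNIV. ?t r x y x' q)"
      by (rule sum.swap)
    also have "\<dots> = (\<Sum>x'\<in>UNIV. \<Sum>r\<in>UNIV. \<Sum>x\<in>UNIV. \<Sum>q\<in>UNIV. \<Sum>y\<in>UNIV. ?t r x y x' q)"
      by (rule sum.cong[OF refl], rule sum.cong[OF refl], rule sum.cong[OF refl], rule sum.swap)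
    finally show "(\<Sum>r\<in>UNIV. \<Sum>x\<in>UNIV. \<Sum>y\<in>UNIV. \<Sum>x'\<in>UNIV. \<Sum>q\<in>UNIV. ?t r x y x' q) =
        (\<Sum>x'\<in>UNIV. \<Sum>r\<in>UNIV. \<Sum>x\<in>UNIV. \<Sum>q\<in>UNIV. \<Sum>y\<in>UNIV. ?t r x y x' q)" .
  qed
  also have "\<dots> = (\<Sum>g\<in>UNIV. \<Sum>h\<in>UNIV. \<Sum>k\<in>UNIV. inverse (d4_cocycle g h k) *s (E g \<otimes> E h \<otimes> E k))"
  proof -
    have "inverse (d4_cocycle (p, x') (r, x) (q, y)) = ?c p r y" for p x' r x q y
      by (simp add: d4_cocycle_def)
    then show ?thesis by (simp only: sum_UNIV_prod)
  qed
  finally show ?thesis .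
qed

lemma quasi_iso_K: "quasi_iso d4.L K (lin_comb E)"
proof (rule d4.quasi_iso_inverse_associator[OF dual_bases_E, where \<Psi> = "pd_associator_inv H \<iota> \<pi> \<zeta> \<gamma>"])
  show "associator K = (THE x. inverse_in (mult3 K) (one3 K) (pd_associator_inv H \<iota> \<pi> \<zeta> \<gamma>) x)"
    by (rule K_simps(5))
  show "pd_associator_inv H \<iota> \<pi> \<zeta> \<gamma> =
      (\<Sum>g\<in>UNIV. \<Sum>h\<in>UNIV. \<Sum>k\<in>UNIV. inverse (d4_cocycle g h k) *s (E g \<otimes> E h \<otimes> E k))"
    by (rule pd_associator_inv_E)
qed (simp_all only: K_simps(1-4) pd_mult_lin pd_mult_E pd_one_E pd_counit_lin pd_counit_E pd_comult_lin pd_comult_E)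

lemma genuine_K:
  "\<not> (hopf_algebra N \<and> gauge_equivalent K (hopf_as_quasi N))"
proof -
  interpret transport d4.L K "lin_comb E"
    by unfold_locales (rule quasi_iso_K d4.mult_L)+
  show ?thesis
  proof
    assume N: "hopf_algebra N \<and> gauge_equivalent K (hopf_as_quasi N)"
    have "gauge_equivalent d4.L (hopf_as_quasi N)"
      by (rule gauge_equivalent_g[OF d4.prebialgebra_L conjunct2[OF N]])
    from conjI[OF conjunct1[OF N] this] show False
      by (rule notE[OF d4.genuine_L[OF d4_period]])
  qed
qed

lemma properties_K:
  "quasi_hopf_algebra K" "commutative_algebra K" "semisimple_algebra K"
proof -
  interpret transport d4.L K "lin_comb E"
    by unfold_locales (rule quasi_iso_K d4.mult_L)+
  show "quasi_hopf_algebra K" "commutative_algebra K" "semisimple_algebra K"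
    by (rule quasi_hopf_algebra_g[OF d4.quasi_hopf_algebra_L] commutative_algebra_g[OF d4.commutative_algebra_L]
        semisimple_algebra_g[OF d4.semisimple_algebra_L])+
qed

end

theorem proposition7p16:
  fixes H :: "'h::finite hopf_data"
    and b c w :: "complex ^ 'h"
    and \<iota> :: "complex ^ 'b::finite \<Rightarrow> complex ^ 'h"
    and \<pi> :: "complex ^ 'h \<Rightarrow> complex ^ 'c::finite"
    and \<zeta> :: "complex ^ 'h \<Rightarrow> complex ^ 'b"
    and \<gamma> :: "complex ^ 'c \<Rightarrow> complex ^ 'h"
  assumes kac: "kac_algebra H b c w"
    and iota: "clinear_map \<iota>" "inj \<iota>" "range \<iota> = vec.span {one H, b, c, mult H b c}"
    and pi: "quotient_projection H \<iota> \<pi>"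
    and zeta: "clinear_map \<zeta>" "\<And>x h. \<zeta> (mult H (\<iota> x) h) = sub_mult H \<iota> x (\<zeta> h)"
      "\<zeta> w = sub_one H \<iota>" "\<And>x. \<zeta> (\<iota> x) = x"
    and gamma: "clinear_map \<gamma>" "\<gamma> (\<pi> (one H)) = one H" "\<gamma> (\<pi> w) = w"
  shows "partially_admissible H \<iota> \<pi> \<zeta> \<gamma> \<and>
    quasi_hopf_algebra (left_partial_dual H \<iota> \<pi> \<zeta> \<gamma>) \<and>
    commutative_algebra (left_partial_dual H \<iota> \<pi> \<zeta> \<gamma>) \<and>
    semisimple_algebra (left_partial_dual H \<iota> \<pi> \<zeta> \<gamma>) \<and>
    genuine TYPE('k::finite) (left_partial_dual H \<iota> \<pi> \<zeta> \<gamma>)"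
proof -
  interpret kac_system H b c w \<iota> \<pi> \<zeta> \<gamma>
    by (intro kac_system.intro kac.intro kac_system_axioms.intro) (fact assms)+
  have "\<not> (\<exists>N :: 'k hopf_data. hopf_algebra N \<and> gauge_equivalent K (hopf_as_quasi N))"
    by (rule notI, erule exE, erule notE[OF genuine_K])
  then show ?thesis
    unfolding genuine_def by (intro conjI partially_admissible properties_K)
qed

end
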